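(* Let $\Delta\in\mathbb{K}^{m\times k}$ be such that $I-\Delta D$ is invertible. Then the following are equivalent for the perturbed system $(\Sigma_{P_0}^\Delta)$: (i) $(\Sigma_{P_0}^\Delta)$ is asymptotically stable; (ii) $(\Sigma_{P_0}^\Delta)$ is exponentially stable; (iii) $\sigma\left(A+B(I-\Delta D)^{-1}\Delta C\right)\subset\mathbb{D}:=\{z\in\mathbb{C}:|z|<1\}$, where $\sigma(J)$ denotes the set of all (complex) eigenvalues of a matrix $J$.
   Context: Setting. Let $\mathbb{K}=\mathbb{R}$ or $\mathbb{K}=\mathbb{C}$, let $n,m,k$ be positive integers with $m\le n$, let $\lambda_0,\lambda_0^{-1}\in L^\infty([0,1];(0,\infty))$, $P_0\in L^\infty([0,1];\mathbb{K}^{n\times n})$, $K,L\in\mathbb{K}^{n\times n}$ with $K$ invertible, and $K_y,L_y\in\mathbb{K}^{k\times n}$. Put $E=\begin{bmatrix}0\\ I\end{bmatrix}\in\mathbb{K}^{n\times m}$ with $I$ the $m\times m$ identity. Let $P:[0,1]\to\mathbb{K}^{n\times n}$ be the absolutely continuous (Carathéodory) solution of $P'(\xi)=P_0(\xi)P(\xi)$, $P(0)=I$, and define $$A=-K^{-1}LP(1),\quad B=-K^{-1}E,\quad C=(K_yK^{-1}L-L_y)P(1),\quad D=K_yK^{-1}E.$$ Perturbed system. For $\Delta\in\mathbb{K}^{m\times k}$, $(\Sigma_{P_0}^\Delta)$ is the system on $L^2([0,1];\mathbb{K}^n)$ $$\frac{\partial x}{\partial t}(\xi,t)=-\frac{\partial}{\partial\xi}(\lambda_0(\xi)x(\xi,t))+P_0(\xi)\lambda_0(\xi)x(\xi,t),\quad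 x(\xi,0)=x_0(\xi),$$ $$0=-(K-E\Delta K_y)\lambda_0(0)x(0,t)-(L-E\Delta L_y)\lambda_0(1)x(1,t),\quad t\ge0,$$ that is, $x(\cdot,t)=T(t)x_0$ where $T$ is the strongly continuous semigroup generated by $f\mapsto-(\lambda_0f)'+P_0\lambda_0f$ with domain $\{f\in L^2([0,1];\mathbb{K}^n):\lambda_0f\in H^1([0,1];\mathbb{K}^n),\ (K-E\Delta K_y)(\lambda_0f)(0)=-(L-E\Delta L_y)(\lambda_0f)(1)\}$ (this operator generates a strongly continuous semigroup when $I-\Delta D$ is invertible). Stability. $(\Sigma_{P_0}^\Delta)$ is asymptotically stable if $\lim_{t\to\infty}x(\cdot,t)=0$ in $L^2([0,1];\mathbb{K}^n)$ for every $x_0\in L^2([0,1];\mathbb{K}^n)$. It is exponentially stable if there exist $\omega>0$, $M\ge1$ such that $\|x(\cdot,t)\|_{L^2}\le Me^{-\omega t}\|x_0\|_{L^2}$ for all $x_0\in L^2([0,1];\mathbb{K}^n)$ and all $t>0$. *)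

theory Defs
  imports "HOL-Analysis.Analysis"
begin

(* The scalar field: real and complex are the instances (up to isometric isomorphism the only
   ones, see range_to_complex), so a type variable of this class ranges over K = R and K = C. *)
class real_or_complex = real_normed_field + euclidean_space +
  fixes to_complex :: "'a \<Rightarrow> complex"
  assumes to_complex_add: "to_complex (x + y) = to_complex x + to_complex y"
    and to_complex_mult: "to_complex (x * y) = to_complex x * to_complex y"
    and to_complex_scaleR: "to_complex (r *\<^sub>R x) = r *\<^sub>R to_complex x"
    and to_complex_one: "to_complex 1 = 1"
    and norm_to_complex: "norm (to_complex x) = norm x"

instantiation real :: real_or_complex
begin
definition "to_complex (x :: real) = complex_of_real x"
instance by standard (simp_all add: to_complex_real_def scaleR_conv_of_real)
end

instantiation complex :: real_or_complex
begin
definition "to_complex (x :: complex) = x"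
instance by standard (simp_all add: to_complex_complex_def)
end

lemma range_to_complex:
  "range (to_complex :: 'a::real_or_complex \<Rightarrow> complex) = \<real> \<or>
   range (to_complex :: 'a \<Rightarrow> complex) = UNIV"
proof (cases "\<exists>x::'a. Im (to_complex x) \<noteq> 0")
  case True
  then obtain x :: 'a where x: "Im (to_complex x) \<noteq> 0" by blast
  have "z \<in> range (to_complex :: 'a \<Rightarrow> complex)" for z
  proof -
    let ?b = "Im z / Im (to_complex x)"
    have "z = to_complex ((Re z - ?b * Re (to_complex x)) *\<^sub>R 1 + ?b *\<^sub>R x)"
      using x by (simp add: to_complex_add to_complex_scaleR to_complex_one complex_eq_iff)
    then show ?thesis by blast
  qed
  then show ?thesis by blast
next
  case False
  have "z \<in> range (to_complex :: 'a \<Rightarrow> complex)" if "z \<in> \<real>" for z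
  proof -
    have "z = to_complex (Re z *\<^sub>R (1::'a))"
      using that by (auto simp: to_complex_scaleR to_complex_one complex_eq_iff complex_is_Real_iff)
    then show ?thesis by blast
  qed
  moreover have "range (to_complex :: 'a \<Rightarrow> complex) \<subseteq> \<real>"
    using False by (auto simp: complex_is_Real_iff)
  ultimately show ?thesis by blast
qed

(* r x c matrices; unlike 'a^'c^'r, this does not fix the sort of the index types. *)
type_synonym ('a, 'r, 'c) matrix = "(('a, 'c) vec, 'r) vec"

abbreviation leb01 :: "real measure"
  where "leb01 \<equiv> lebesgue_on {0..1}"

definition Linfty :: "(real \<Rightarrow> 'b::real_normed_vector) \<Rightarrow> bool"
  where "Linfty f \<longleftrightarrow> f \<in> borel_measurable leb01 \<and> (\<exists>c. AE \<xi> in leb01. norm (f \<xi>) \<le> c)"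

definition square_integrable :: "(real \<Rightarrow> 'b::euclidean_space) \<Rightarrow> bool"
  where "square_integrable f \<longleftrightarrow>
    f \<in> borel_measurable leb01 \<and> integrable leb01 (\<lambda>\<xi>. (norm (f \<xi>))\<^sup>2)"

definition L2_eq :: "(real \<Rightarrow> 'b::euclidean_space) \<Rightarrow> (real \<Rightarrow> 'b) \<Rightarrow> bool"
  where "L2_eq f g \<longleftrightarrow>
    square_integrable f \<and> square_integrable g \<and> (AE \<xi> in leb01. f \<xi> = g \<xi>)"

lemma square_integrable_add:
  assumes "square_integrable f" "square_integrable g"
  shows "square_integrable (\<lambda>\<xi>. f \<xi> + g \<xi>)"
proof -
  have m: "f \<in> borel_measurable leb01" "g \<in> borel_measurable leb01"
    and i: "integrable leb01 (\<lambda>\<xi>. (norm (f \<xi>))\<^sup>2)" "integrable leb01 (\<lambda>\<xi>. (norm (g \<xi>))\<^sup>2)"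
    using assms by (auto simp: square_integrable_def)
  have bd: "(norm (a + b))\<^sup>2 \<le> 2 * (norm a)\<^sup>2 + 2 * (norm b)\<^sup>2" for a b :: 'a
  proof -
    have "(norm (a + b))\<^sup>2 \<le> (norm a + norm b)\<^sup>2"
      by (simp add: norm_triangle_ineq power_mono)
    also have "\<dots> \<le> 2 * (norm a)\<^sup>2 + 2 * (norm b)\<^sup>2"
      using sum_squares_bound[of "norm a" "norm b"] by (simp add: power2_sum)
    finally show ?thesis .
  qed
  have "integrable leb01 (\<lambda>\<xi>. 2 * (norm (f \<xi>))\<^sup>2 + 2 * (norm (g \<xi>))\<^sup>2)"
    using i by auto
  then have "integrable leb01 (\<lambda>\<xi>. (norm (f \<xi> + g \<xi>))\<^sup>2)"
    by (rule Bochner_Integration.integrable_bound) (use m bd in auto)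
  then show ?thesis
    using m by (simp add: square_integrable_def)
qed

lemma square_integrable_scaleR:
  assumes "square_integrable f"
  shows "square_integrable (\<lambda>\<xi>. c *\<^sub>R f \<xi>)"
  using assms by (auto simp: square_integrable_def power_mult_distrib)

lemma square_integrable_uminus: "square_integrable f \<Longrightarrow> square_integrable (\<lambda>\<xi>. - f \<xi>)"
  using square_integrable_scaleR[of f "-1"] by simp

lemma square_integrable_diff:
  assumes "square_integrable f" "square_integrable g"
  shows "square_integrable (\<lambda>\<xi>. f \<xi> - g \<xi>)"
  using square_integrable_add[OF assms(1) square_integrable_uminus[OF assms(2)]] by simp

lemma square_integrable_zero: "square_integrable (\<lambda>\<xi>. 0)"
  by (simp add: square_integrable_def)

lemma integrable_inner_square_integrable:
  assumes "square_integrable f" "square_integrable g"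
  shows "integrable leb01 (\<lambda>\<xi>. f \<xi> \<bullet> g \<xi>)"
proof -
  have m: "f \<in> borel_measurable leb01" "g \<in> borel_measurable leb01"
    and i: "integrable leb01 (\<lambda>\<xi>. (norm (f \<xi>))\<^sup>2)" "integrable leb01 (\<lambda>\<xi>. (norm (g \<xi>))\<^sup>2)"
    using assms by (auto simp: square_integrable_def)
  have bd: "\<bar>a \<bullet> b\<bar> \<le> (norm a)\<^sup>2 + (norm b)\<^sup>2" for a b :: 'a
  proof -
    have "0 \<le> norm a * norm b" by simp
    then show ?thesis
      using Cauchy_Schwarz_ineq2[of a b] sum_squares_bound[of "norm a" "norm b"] by linarith
  qed
  have "integrable leb01 (\<lambda>\<xi>. (norm (f \<xi>))\<^sup>2 + (norm (g \<xi>))\<^sup>2)"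
    using i by auto
  then show ?thesis
    by (rule Bochner_Integration.integrable_bound) (use m bd in simp_all)
qed

lemma L2_eq_AE_cong:
  assumes "L2_eq f f'"
  shows "AE \<xi> in leb01. F (f \<xi>) = F (f' \<xi>)"
proof -
  have "AE \<xi> in leb01. f \<xi> = f' \<xi>"
    using assms by (simp add: L2_eq_def)
  then show ?thesis by eventually_elim simp
qed

lemma L2_eq_AE_cong2:
  assumes "L2_eq f f'" "L2_eq g g'"
  shows "AE \<xi> in leb01. F (f \<xi>) (g \<xi>) = F (f' \<xi>) (g' \<xi>)"
proof -
  have "AE \<xi> in leb01. f \<xi> = f' \<xi>" "AE \<xi> in leb01. g \<xi> = g' \<xi>"
    using assms by (simp_all add: L2_eq_def)
  then show ?thesis by eventually_elim simp
qed

lemma L2_eqD: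
  assumes "L2_eq f g"
  shows "square_integrable f" "square_integrable g"
    "f \<in> borel_measurable leb01" "g \<in> borel_measurable leb01"
  using assms by (simp_all add: L2_eq_def square_integrable_def)

lemma L2_eqI:
  "square_integrable f \<Longrightarrow> square_integrable g \<Longrightarrow> AE \<xi> in leb01. f \<xi> = g \<xi> \<Longrightarrow> L2_eq f g"
  by (simp add: L2_eq_def)

lemma L2_eq_part_equivp: "part_equivp (L2_eq :: (real \<Rightarrow> 'b::euclidean_space) \<Rightarrow> _)"
proof (rule part_equivpI)
  show "\<exists>x. L2_eq x (x :: real \<Rightarrow> 'b)"
    by (rule exI[of _ "\<lambda>_. 0"]) (simp add: L2_eq_def square_integrable_zero)
  show "symp (L2_eq :: (real \<Rightarrow> 'b) \<Rightarrow> _)"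
    by (rule sympI) (simp add: L2_eq_def eq_commute)
  show "transp (L2_eq :: (real \<Rightarrow> 'b) \<Rightarrow> _)"
  proof (rule transpI)
    fix f g h :: "real \<Rightarrow> 'b" assume fg: "L2_eq f g" and gh: "L2_eq g h"
    have "AE \<xi> in leb01. f \<xi> = g \<xi>" "AE \<xi> in leb01. g \<xi> = h \<xi>"
      using fg gh by (simp_all add: L2_eq_def)
    then have "AE \<xi> in leb01. f \<xi> = h \<xi>" by eventually_elim simp
    then show "L2_eq f h" using fg gh by (simp add: L2_eq_def)
  qed
qed

(* L^2([0,1]; 'b): square integrable functions modulo equality almost everywhere. *)
quotient_type (overloaded) 'b L2 = "real \<Rightarrow> 'b::euclidean_space" / partial: L2_eq
  by (rule L2_eq_part_equivp)

(* For complex 'b the inner product of L2 is the real part of the usual Hermitian one; the norm,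
   hence the topology, is the same. *)
instantiation L2 :: (euclidean_space) real_inner
begin

lift_definition zero_L2 :: "'a L2" is "\<lambda>\<xi>. 0"
  by (simp add: L2_eq_def square_integrable_zero)

lift_definition plus_L2 :: "'a L2 \<Rightarrow> 'a L2 \<Rightarrow> 'a L2" is "\<lambda>f g \<xi>. f \<xi> + g \<xi>"
  subgoal for f f' g g'
    using L2_eq_AE_cong2[of f f' g g' "(+)"]
    by (simp add: L2_eq_def square_integrable_add)
  done

lift_definition scaleR_L2 :: "real \<Rightarrow> 'a L2 \<Rightarrow> 'a L2" is "\<lambda>c f \<xi>. c *\<^sub>R f \<xi>"
  subgoal for c f f'
    using L2_eq_AE_cong[of f f' "scaleR c"]
    by (simp add: L2_eq_def square_integrable_scaleR del: scaleR_cancel_left)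
  done

lift_definition uminus_L2 :: "'a L2 \<Rightarrow> 'a L2" is "\<lambda>f \<xi>. - f \<xi>"
  by (simp add: L2_eq_def square_integrable_uminus)

lift_definition minus_L2 :: "'a L2 \<Rightarrow> 'a L2 \<Rightarrow> 'a L2" is "\<lambda>f g \<xi>. f \<xi> - g \<xi>"
  subgoal for f f' g g'
    using L2_eq_AE_cong2[of f f' g g' "(-)"]
    by (simp add: L2_eq_def square_integrable_diff)
  done

lift_definition inner_L2 :: "'a L2 \<Rightarrow> 'a L2 \<Rightarrow> real" is "\<lambda>f g. LINT \<xi>|leb01. f \<xi> \<bullet> g \<xi>"
  subgoal for f f' g g'
    by (rule integral_cong_AE)
      (simp_all add: L2_eq_AE_cong2 borel_measurable_inner L2_eqD[of f f'] L2_eqD[of g g'])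
  done

lift_definition norm_L2 :: "'a L2 \<Rightarrow> real" is "\<lambda>f. sqrt (LINT \<xi>|leb01. (norm (f \<xi>))\<^sup>2)"
  subgoal for f f'
  proof -
    assume *: "L2_eq f f'"
    have "(\<lambda>\<xi>. (norm (f \<xi>))\<^sup>2) \<in> borel_measurable leb01"
      "(\<lambda>\<xi>. (norm (f' \<xi>))\<^sup>2) \<in> borel_measurable leb01"
      using L2_eqD(3,4)[OF *] by measurable
    then have "(LINT \<xi>|leb01. (norm (f \<xi>))\<^sup>2) = (LINT \<xi>|leb01. (norm (f' \<xi>))\<^sup>2)"
      using L2_eq_AE_cong[OF *] by (rule integral_cong_AE)
    then show ?thesis by simp
  qed
  done

definition "sgn (x :: 'a L2) = scaleR (inverse (norm x)) x"
definition "dist (x :: 'a L2) y = norm (x - y)"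
definition "uniformity = (INF e\<in>{0<..}. principal {(x :: 'a L2, y). dist x y < e})"
definition "open (U :: 'a L2 set) = (\<forall>x\<in>U. \<forall>\<^sub>F (x', y) in uniformity. x' = x \<longrightarrow> y \<in> U)"

instance
proof
  fix x y z :: "'a L2" and a b r :: real
  note si = square_integrable_add square_integrable_diff square_integrable_uminus
    square_integrable_scaleR square_integrable_zero
  show "x + y + z = x + (y + z)"
    by transfer (simp add: L2_eq_def si add.assoc)
  show "x + y = y + x"
    by transfer (simp add: L2_eq_def si add.commute)
  show "0 + x = x"
    by transfer simp
  show "- x + x = 0"
    by transfer (simp add: L2_eq_def si)
  show "x - y = x + - y"
    by transfer (simp add: L2_eq_def si)
  show "a *\<^sub>R (x + y) = a *\<^sub>R x + a *\<^sub>R y"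
    by transfer (simp add: L2_eq_def si scaleR_add_right)
  show "(a + b) *\<^sub>R x = a *\<^sub>R x + b *\<^sub>R x"
    by transfer (simp add: L2_eq_def si scaleR_add_left)
  show "a *\<^sub>R b *\<^sub>R x = (a * b) *\<^sub>R x"
    by transfer (simp add: L2_eq_def si)
  show "1 *\<^sub>R x = x"
    by transfer simp
  show "dist x y = norm (x - y)" by (fact dist_L2_def)
  show "sgn x = scaleR (inverse (norm x)) x" by (fact sgn_L2_def)
  show "uniformity = (INF e\<in>{0<..}. principal {(x :: 'a L2, y). dist x y < e})"
    by (fact uniformity_L2_def)
  show "open U = (\<forall>x\<in>U. \<forall>\<^sub>F (x', y) in uniformity. x' = x \<longrightarrow> y \<in> U)" for U :: "'a L2 set"
    by (fact open_L2_def)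
  show "inner x y = inner y x"
    by transfer (simp add: inner_commute)
  show "inner (x + y) z = inner x z + inner y z"
    by transfer (simp add: inner_add_left integrable_inner_square_integrable L2_eqD)
  show "inner (r *\<^sub>R x) y = r * inner x y"
    by transfer simp
  show "0 \<le> inner x x"
    by transfer simp
  show "inner x x = 0 \<longleftrightarrow> x = 0"
  proof transfer
    fix f :: "real \<Rightarrow> 'a" assume f: "L2_eq f f"
    have "(LINT \<xi>|leb01. f \<xi> \<bullet> f \<xi>) = 0 \<longleftrightarrow> (AE \<xi> in leb01. f \<xi> \<bullet> f \<xi> = 0)"
      by (rule integral_nonneg_eq_0_iff_AE)
        (simp_all add: integrable_inner_square_integrable L2_eqD[OF f])
    then show "(LINT \<xi>|leb01. f \<xi> \<bullet> f \<xi>) = 0 \<longleftrightarrow> L2_eq f (\<lambda>\<xi>. 0)"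
      using f by (simp add: L2_eq_def square_integrable_zero)
  qed
  show "norm x = sqrt (inner x x)"
    by transfer (simp add: power2_norm_eq_inner)
qed

end

definition represents :: "(real \<Rightarrow> 'b::euclidean_space) \<Rightarrow> 'b L2 \<Rightarrow> bool"
  where "represents f x \<longleftrightarrow> square_integrable f \<and> abs_L2 f = x"

(* The usual epsilon-delta definition; the members of d are nonoverlapping compact subintervals
   of S. *)
definition abs_continuous_on :: "real set \<Rightarrow> (real \<Rightarrow> 'b::real_normed_vector) \<Rightarrow> bool"
  where "abs_continuous_on S h \<longleftrightarrow>
    (\<forall>\<epsilon>>0. \<exists>\<delta>>0. \<forall>d t. d division_of t \<and> t \<subseteq> S \<and> (\<Sum>J\<in>d. Sup J - Inf J) < \<delta> \<longrightarrow>
      (\<Sum>J\<in>d. norm (h (Sup J) - h (Inf J))) < \<epsilon>)"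

(* h is absolutely continuous on [0,1] and g is its derivative almost everywhere. *)
definition ac_with_derivative ::
    "(real \<Rightarrow> 'b::real_normed_vector) \<Rightarrow> (real \<Rightarrow> 'b) \<Rightarrow> bool"
  where "ac_with_derivative h g \<longleftrightarrow> abs_continuous_on {0..1} h \<and>
    (AE \<xi> in leb01. (h has_vector_derivative g \<xi>) (at \<xi> within {0..1}))"

definition fundamental_solution ::
    "(real \<Rightarrow> 'a::real_or_complex^'n^'n) \<Rightarrow> (real \<Rightarrow> 'a^'n^'n) \<Rightarrow> bool"
  where "fundamental_solution P0 P \<longleftrightarrow>
    ac_with_derivative P (\<lambda>\<xi>. P0 \<xi> ** P \<xi>) \<and> P 0 = mat 1"

(* One-parameter semigroups (T t) for t >= 0; the values of T at negative times are irrelevant. *)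
definition c0_semigroup :: "(real \<Rightarrow> 'x::real_normed_vector \<Rightarrow> 'x) \<Rightarrow> bool"
  where "c0_semigroup T \<longleftrightarrow>
    (\<forall>t\<ge>0. bounded_linear (T t)) \<and>
    T 0 = id \<and>
    (\<forall>s\<ge>0. \<forall>t\<ge>0. T (s + t) = T s \<circ> T t) \<and>
    (\<forall>x. ((\<lambda>t. T t x) \<longlongrightarrow> x) (at_right 0))"

(* Unbounded operators are given by their graphs. *)
definition generator :: "(real \<Rightarrow> 'x::real_normed_vector \<Rightarrow> 'x) \<Rightarrow> ('x \<times> 'x) set"
  where "generator T = {(x, y). ((\<lambda>t. (T t x - x) /\<^sub>R t) \<longlongrightarrow> y) (at_right 0)}"

definition asymptotically_stable :: "(real \<Rightarrow> 'x::real_normed_vector \<Rightarrow> 'x) \<Rightarrow> bool"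
  where "asymptotically_stable T \<longleftrightarrow> (\<forall>x0. ((\<lambda>t. T t x0) \<longlongrightarrow> 0) at_top)"

definition exponentially_stable :: "(real \<Rightarrow> 'x::real_normed_vector \<Rightarrow> 'x) \<Rightarrow> bool"
  where "exponentially_stable T \<longleftrightarrow>
    (\<exists>\<omega>>0. \<exists>M\<ge>1. \<forall>x0. \<forall>t>0. norm (T t x0) \<le> M * exp (- \<omega> * t) * norm x0)"

(* The graph of f |-> -(lam f)' + P0 lam f on the domain of all f in L^2 such that lam f is in H^1
   and K (lam f)(0) = - L (lam f)(1). Here h is the absolutely continuous representative of lam f;
   point values are taken of h, since those of lam f itself are meaningless. *)
definition transport_operator ::
    "(real \<Rightarrow> real) \<Rightarrow> (real \<Rightarrow> 'a::real_or_complex^'n^'n) \<Rightarrow> 'a^'n^'n \<Rightarrow> 'a^'n^'n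
      \<Rightarrow> (('a^'n) L2 \<times> ('a^'n) L2) set"
  where "transport_operator lam P0 K L = {(x, y). \<exists>f h h'.
    represents f x \<and>
    (AE \<xi> in leb01. h \<xi> = lam \<xi> *\<^sub>R f \<xi>) \<and>
    ac_with_derivative h h' \<and> square_integrable h' \<and>
    K *v h 0 = - (L *v h 1) \<and>
    represents (\<lambda>\<xi>. - h' \<xi> + P0 \<xi> *v h \<xi>) y}"

definition row_index :: "'i::{finite,linorder} \<Rightarrow> nat"
  where "row_index i = card {j. j < i}"

(* The n x m block matrix with an (n - m) x m zero block on top of the m x m identity matrix,
   for m <= n; indices are counted in increasing order. *)
definition E_mat :: "'a::real_or_complex^('m::{finite,linorder})^('n::{finite,linorder})"
  where "E_mat = (\<chi> i j. if row_index i = (CARD('n) - CARD('m)) + row_index j then 1 else 0)"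

definition complex_eigenvalues :: "'a::real_or_complex^'n^'n \<Rightarrow> complex set"
  where "complex_eigenvalues J =
    {z. \<exists>v::complex^'n. v \<noteq> 0 \<and> (\<chi> i j. to_complex (J $ i $ j)) *v v = z *s v}"

end

theory Submission
  imports Defs "HOL-Computational_Algebra.Fundamental_Theorem_Algebra"
begin

text \<open>
  Let \<open>x\<close> be a solution of the perturbed system and put \<open>g = P\<^sup>-\<^sup>1 (\<lambda>\<^sub>0 x)\<close>. Since \<open>\<lambda>\<^sub>0\<close> is scalar,
  it commutes with \<open>P\<close>, and \<open>g\<close> satisfies the decoupled transport equation
  \<open>g\<^sub>t = - \<lambda>\<^sub>0 g\<^sub>\<xi>\<close>; eliminating the feedback from the boundary condition leaves \<open>g(0) = J g(1)\<close> with
  \<open>J = A + B (I - \<Delta>D)\<^sup>-\<^sup>1 \<Delta>C\<close> (\<open>feedback_boundary_condition\<close>). So every passage through the interval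
  applies \<open>J\<close> once, and stability is decided by whether the powers of \<open>J\<close> decay.

  The proof expresses this by energies instead of solution formulas. For a symmetric
  bilinear form \<open>\<beta>\<close> on the space of the vectors \<open>g(\<xi>)\<close> and a real number \<open>\<mu>\<close> consider
  \<open>\<Phi>(x, x) = \<integral> e\<^sup>-\<^sup>\<mu>\<^sup>\<xi> \<lambda>\<^sub>0\<^sup>-\<^sup>1 \<beta>(g, g) d\<xi>\<close>. The product rule for absolutely continuous functions gives,
  along solutions starting in the domain (\<open>energy_identity\<close>),
  \<open>d/dt \<Phi> = \<beta>(J g(1), J g(1)) - e\<^sup>-\<^sup>\<mu> \<beta>(g(1), g(1)) - \<mu> \<integral> e\<^sup>-\<^sup>\<mu>\<^sup>\<xi> \<beta>(g, g) d\<xi>\<close>.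

  If all eigenvalues of \<open>J\<close> lie in the open disc, then \<open>J\<^sup>k v\<close> tends to \<open>0\<close> for every \<open>v\<close>, and a weighted
  sum of the forms \<open>J\<^sup>k u \<bullet> J\<^sup>k v\<close> is an inner product \<open>\<beta>\<close> with \<open>\<beta>(Jv, Jv) \<le> \<rho> \<beta>(v, v)\<close> for some
  \<open>\<rho> < 1\<close> (\<open>contractive_inner_product\<close>). With \<open>e\<^sup>-\<^sup>\<mu> = \<rho>\<close> the boundary terms are nonpositive and the integral
  dominates a multiple of \<open>\<Phi>\<close>, which is equivalent to the squared norm; so \<open>\<Phi>\<close>, and with it the
  state, decays exponentially. If, on the other hand, \<open>J\<close> has an eigenvalue \<open>z\<close> with \<open>|z| \<ge> 1\<close>, take a left
  eigenvector \<open>y\<close>; the semidefinite form \<open>\<beta>\<close> with \<open>\<beta>(v, v) = |y \<bullet> v|\<^sup>2\<close> satisfies \<open>\<beta>(Jv, Jv) = |z|\<^sup>2 \<beta>(v, v)\<close>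
  (\<open>expansive_semi_inner_product\<close>). With \<open>\<mu> = 0\<close> the energy is nondecreasing in time, and as it is not
  identically zero, some solution does not tend to \<open>0\<close>. The remaining implication, from exponential to
  asymptotic stability, is immediate.

  What has to be supplied is analysis: the fundamental theorem of calculus for absolutely
  continuous functions, the invertibility of \<open>P\<close> with a bound on its inverse, the density of the domain in \<open>L\<^sup>2\<close>,
  and the differentiability of the orbits of a semigroup, on which \<open>lyapunov_estimate\<close> rests.
\<close>

section \<open>Absolutely continuous functions\<close>

lemma division_of_real_cell:
  fixes d :: "real set set"
  assumes "d division_of t" "J \<in> d"
  obtains a b where "J = {a..b}" "a \<le> b" "{a..b} \<subseteq> t"
proof -
  obtain a b where "J = cbox a b" using division_ofD(4)[OF assms] by blast
  moreover have "J \<noteq> {}" "J \<subseteq> t" using division_ofD(2,3)[OF assms] by auto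
  ultimately show ?thesis using that[of a b] by auto
qed

text \<open>
  All closure properties of absolute continuity that are needed below (Lipschitz functions, products,
  solutions of linear systems) are instances of this comparison of increments.
\<close>

lemma abs_continuous_on_dominated:
  assumes "abs_continuous_on S h" "abs_continuous_on S k" and "0 \<le> c"
    and le: "\<And>u v. u \<in> S \<Longrightarrow> v \<in> S \<Longrightarrow>
      norm (r v - r u) \<le> c * (norm (h v - h u) + norm (k v - k u))"
  shows "abs_continuous_on S r"
  unfolding abs_continuous_on_def
proof (intro allI impI)
  fix e :: real assume "e > 0"
  define e' where "e' = e / (c + 1) / 2"
  have "e' > 0" using \<open>e > 0\<close> \<open>0 \<le> c\<close> by (simp add: e'_def)
  obtain d1 where d1: "d1 > 0" "\<And>d t. d division_of t \<Longrightarrow> t \<subseteq> S \<Longrightarrow> (\<Sum>J\<in>d. Sup J - Inf J) < d1 \<Longrightarrow>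
      (\<Sum>J\<in>d. norm (h (Sup J) - h (Inf J))) < e'"
    using assms(1) \<open>e' > 0\<close> unfolding abs_continuous_on_def by meson
  obtain d2 where d2: "d2 > 0" "\<And>d t. d division_of t \<Longrightarrow> t \<subseteq> S \<Longrightarrow> (\<Sum>J\<in>d. Sup J - Inf J) < d2 \<Longrightarrow>
      (\<Sum>J\<in>d. norm (k (Sup J) - k (Inf J))) < e'"
    using assms(2) \<open>e' > 0\<close> unfolding abs_continuous_on_def by meson
  show "\<exists>\<delta>>0. \<forall>d t. d division_of t \<and> t \<subseteq> S \<and> (\<Sum>J\<in>d. Sup J - Inf J) < \<delta> \<longrightarrow>
      (\<Sum>J\<in>d. norm (r (Sup J) - r (Inf J))) < e"
  proof (intro exI conjI allI impI)
    show "min d1 d2 > 0" using d1 d2 by simp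
    fix d t assume *: "d division_of t \<and> t \<subseteq> S \<and> (\<Sum>J\<in>d. Sup J - Inf J) < min d1 d2"
    have ends: "Sup J \<in> S" "Inf J \<in> S" if J: "J \<in> d" for J
    proof -
      obtain a b where "J = {a..b}" "a \<le> b" "{a..b} \<subseteq> t"
        using division_of_real_cell[OF conjunct1[OF *] J] .
      then show "Sup J \<in> S" "Inf J \<in> S" using * by auto
    qed
    have "(\<Sum>J\<in>d. norm (r (Sup J) - r (Inf J)))
        \<le> (\<Sum>J\<in>d. c * (norm (h (Sup J) - h (Inf J)) + norm (k (Sup J) - k (Inf J))))"
      using ends le by (intro sum_mono) auto
    also have "\<dots> = c * ((\<Sum>J\<in>d. norm (h (Sup J) - h (Inf J))) + (\<Sum>J\<in>d. norm (k (Sup J) - k (Inf J))))"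
      by (simp add: sum_distrib_left sum.distrib distrib_left)
    also have "\<dots> \<le> c * (e' + e')"
      using d1(2)[of d t] d2(2)[of d t] * \<open>0 \<le> c\<close> by (intro mult_left_mono) auto
    also have "\<dots> = c / (c + 1) * e"
      by (simp only: e'_def field_sum_of_halves) simp
    also have "\<dots> < 1 * e"
      using \<open>e > 0\<close> \<open>0 \<le> c\<close> by (intro mult_strict_right_mono) (auto simp: divide_simps)
    finally show "(\<Sum>J\<in>d. norm (r (Sup J) - r (Inf J))) < e" by simp
  qed
qed

lemma abs_continuous_on_subset:
  "abs_continuous_on S h \<Longrightarrow> T \<subseteq> S \<Longrightarrow> abs_continuous_on T h"
  unfolding abs_continuous_on_def by (meson subset_trans)

lemma sum_division_lengths:
  fixes d :: "real set set"
  assumes "d division_of t"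
  shows "(\<Sum>J\<in>d. Sup J - Inf J) = measure lebesgue t"
proof -
  have "(\<Sum>J\<in>d. Sup J - Inf J) = (\<Sum>J\<in>d. measure lborel J)"
  proof (rule sum.cong)
    fix J assume "J \<in> d"
    then obtain a b where "J = {a..b}" "a \<le> b"
      using division_of_real_cell[OF assms] by blast
    then show "Sup J - Inf J = measure lborel J" by simp
  qed simp
  also have "\<dots> = (\<Sum>J\<in>d. measure lebesgue J)"
    by (rule sum.cong) (use assms in \<open>auto dest!: division_ofD(4)\<close>)
  also have "\<dots> = measure lebesgue (\<Union>d)"
  proof (rule measure_negligible_finite_Union[symmetric])
    show "finite d" using assms by blast
    show "J \<in> lmeasurable" if "J \<in> d" for J
      using division_ofD(4)[OF assms that] by auto
    show "pairwise (\<lambda>J J'. negligible (J \<inter> J')) d"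
    proof (rule pairwiseI)
      fix J J' assume J: "J \<in> d" "J' \<in> d" "J \<noteq> J'"
      obtain a b where "J = cbox a b" using division_ofD(4)[OF assms J(1)] by blast
      moreover obtain a' b' where "J' = cbox a' b'" using division_ofD(4)[OF assms J(2)] by blast
      moreover have "interior J \<inter> interior J' = {}" using division_ofD(5)[OF assms J] .
      ultimately show "negligible (J \<inter> J')"
        by (simp add: negligible_convex_interior convex_Int interior_Int del: box_real)
    qed
  qed
  also have "\<Union>d = t" using assms by blast
  finally show ?thesis .
qed

lemma abs_continuous_on_lipschitz:
  assumes "\<And>u v. u \<in> S \<Longrightarrow> v \<in> S \<Longrightarrow> norm (h v - h u) \<le> c * \<bar>v - u\<bar>"
  shows "abs_continuous_on S h"
proof -
  have id: "abs_continuous_on S (\<lambda>x::real. x)"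
    unfolding abs_continuous_on_def
  proof (intro allI impI exI conjI)
    fix e :: real and d :: "real set set" and t
    show "0 < e" if "0 < e" using that .
    assume *: "d division_of t \<and> t \<subseteq> S \<and> (\<Sum>J\<in>d. Sup J - Inf J) < e"
    have "(\<Sum>J\<in>d. norm (Sup J - Inf J)) = (\<Sum>J\<in>d. Sup J - Inf J)"
    proof (rule sum.cong)
      fix J assume "J \<in> d"
      then obtain a b where "J = {a..b}" "a \<le> b"
        using division_of_real_cell[OF conjunct1[OF *]] by blast
      then show "norm (Sup J - Inf J) = Sup J - Inf J" by simp
    qed simp
    then show "(\<Sum>J\<in>d. norm (Sup J - Inf J)) < e" using * by simp
  qed
  have "norm (h v - h u) \<le> \<bar>c\<bar> * (norm (v - u) + norm (v - u))" if "u \<in> S" "v \<in> S" for u v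
  proof -
    have "c * \<bar>v - u\<bar> \<le> \<bar>c\<bar> * \<bar>v - u\<bar>" by (simp add: mult_right_mono)
    moreover have "0 \<le> \<bar>c\<bar> * \<bar>v - u\<bar>" by simp
    ultimately show ?thesis using assms[OF that] unfolding distrib_left real_norm_def by linarith
  qed
  then show ?thesis
    by (rule abs_continuous_on_dominated[OF id id abs_ge_zero])
qed

lemma abs_continuous_on_imp_continuous:
  assumes "abs_continuous_on {a..b} h"
  shows "continuous_on {a..b} h"
  unfolding continuous_on_iff
proof (intro ballI allI impI)
  fix x e :: real assume "x \<in> {a..b}" "e > 0"
  obtain \<delta> where \<delta>: "\<delta> > 0" "\<And>d t. d division_of t \<Longrightarrow> t \<subseteq> {a..b} \<Longrightarrow> (\<Sum>J\<in>d. Sup J - Inf J) < \<delta> \<Longrightarrow>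
      (\<Sum>J\<in>d. norm (h (Sup J) - h (Inf J))) < e"
    using assms \<open>e > 0\<close> unfolding abs_continuous_on_def by meson
  have *: "norm (h v - h u) < e" if "a \<le> u" "u \<le> v" "v \<le> b" "v - u < \<delta>" for u v
  proof -
    have "{cbox u v} division_of {u..v}"
      using that division_of_self[of u v] by (metis atLeastatMost_empty_iff2 box_real(2))
    from \<delta>(2)[OF this] show ?thesis using that by simp
  qed
  show "\<exists>d>0. \<forall>x'\<in>{a..b}. dist x' x < d \<longrightarrow> dist (h x') (h x) < e"
  proof (intro exI[of _ \<delta>] conjI ballI impI \<delta>(1))
    fix x' assume "x' \<in> {a..b}" "dist x' x < \<delta>"
    then show "dist (h x') (h x) < e"
      using *[of x x'] *[of x' x] \<open>x \<in> {a..b}\<close>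
      by (cases "x \<le> x'") (auto simp: dist_norm norm_minus_commute)
  qed
qed

lemma vector_derivative_straddle:
  fixes h :: "real \<Rightarrow> 'b::real_normed_vector"
  assumes "(h has_vector_derivative h') (at x within S)" "e > 0"
  obtains d where "d > 0"
    "\<And>u v. u \<in> S \<Longrightarrow> v \<in> S \<Longrightarrow> u \<le> x \<Longrightarrow> x \<le> v \<Longrightarrow> u \<in> ball x d \<Longrightarrow> v \<in> ball x d \<Longrightarrow>
       norm (h v - h u - (v - u) *\<^sub>R h') \<le> e * (v - u)"
proof -
  obtain d where d: "d > 0" "\<And>y. y \<in> S \<Longrightarrow> norm (y - x) < d \<Longrightarrow>
      norm (h y - h x - (y - x) *\<^sub>R h') \<le> e * norm (y - x)"
    using assms unfolding has_vector_derivative_def has_derivative_within_alt by blast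
  show ?thesis
  proof (rule that[OF d(1)])
    fix u v assume uv: "u \<in> S" "v \<in> S" "u \<le> x" "x \<le> v" "u \<in> ball x d" "v \<in> ball x d"
    have "norm (h v - h x - (v - x) *\<^sub>R h') \<le> e * (v - x)"
      using d(2)[of v] uv by (simp add: dist_real_def)
    moreover have "norm (h u - h x - (u - x) *\<^sub>R h') \<le> e * (x - u)"
      using d(2)[of u] uv by (simp add: dist_real_def)
    moreover have "h v - h u - (v - u) *\<^sub>R h' = (h v - h x - (v - x) *\<^sub>R h') - (h u - h x - (u - x) *\<^sub>R h')"
      by (simp add: algebra_simps)
    ultimately show "norm (h v - h u - (v - u) *\<^sub>R h') \<le> e * (v - u)"
      using norm_triangle_ineq4[of "h v - h x - (v - x) *\<^sub>R h'" "h u - h x - (u - x) *\<^sub>R h'"]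
      by (simp add: algebra_simps)
  qed
qed

text \<open>
  The Henstock--Kurzweil integral allows a direct proof by gauges. At a tag where \<open>h\<close> is differentiable
  the gauge makes the increment of \<open>h\<close> close to the Riemann term. The intervals with tags in the exceptional
  null set \<open>N\<close> are forced into an open set of small measure, so by absolute continuity the increments of \<open>h\<close> over
  them are negligible; the integrand may be taken to be \<open>0\<close> there.
\<close>

theorem fundamental_theorem_of_calculus_abs_continuous:
  fixes h :: "real \<Rightarrow> 'b::banach"
  assumes "a \<le> b" and ac: "abs_continuous_on {a..b} h" and "negligible N"
    and der: "\<And>x. x \<in> {a..b} - N \<Longrightarrow> (h has_vector_derivative h' x) (at x within {a..b})"
  shows "(h' has_integral (h b - h a)) {a..b}"
proof -
  define g where "g x = (if x \<in> N then 0 else h' x)" for x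
  have "(g has_integral (h b - h a)) (cbox a b)"
    unfolding has_integral
  proof (intro allI impI)
    fix e :: real assume "e > 0"
    define e1 where "e1 = e / (2 * (b - a + 1))"
    have "e1 > 0" using \<open>e > 0\<close> \<open>a \<le> b\<close> by (simp add: e1_def)
    obtain \<delta> where \<delta>: "\<delta> > 0" "\<And>d t. d division_of t \<Longrightarrow> t \<subseteq> {a..b} \<Longrightarrow> (\<Sum>J\<in>d. Sup J - Inf J) < \<delta> \<Longrightarrow>
      (\<Sum>J\<in>d. norm (h (Sup J) - h (Inf J))) < e / 2"
      using ac \<open>e > 0\<close> unfolding abs_continuous_on_def by (meson half_gt_zero)
    have "N \<in> lmeasurable" "measure lebesgue N = 0"
      using \<open>negligible N\<close> by (auto simp: negligible_imp_measurable negligible_imp_measure0)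
    then obtain U where U: "open U" "N \<subseteq> U" "U \<in> lmeasurable" "measure lebesgue U < \<delta>"
    proof -
      obtain U where U: "open U" "N \<subseteq> U" "U - N \<in> lmeasurable" "emeasure lebesgue (U - N) < ennreal \<delta>"
        using sets_lebesgue_outer_open[OF fmeasurableD[OF \<open>N \<in> lmeasurable\<close>] \<open>\<delta> > 0\<close>] by blast
      have "measure lebesgue (U - N) < \<delta>"
        using U(3,4) \<open>\<delta> > 0\<close> by (simp add: emeasure_eq_measure2 ennreal_less_iff)
      moreover have "(U - N) \<union> N = U" using U(2) by auto
      moreover have "U \<in> lmeasurable"
        using fmeasurable.Un[OF U(3) \<open>N \<in> lmeasurable\<close>] \<open>(U - N) \<union> N = U\<close> by simp
      moreover have "measure lebesgue U \<le> measure lebesgue (U - N) + measure lebesgue N"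
        using measure_Un_le[of "U - N" lebesgue N] U(3) \<open>N \<in> lmeasurable\<close> \<open>(U - N) \<union> N = U\<close>
        by (simp add: fmeasurableD)
      ultimately show ?thesis
        using that[of U] U(1,2) \<open>measure lebesgue N = 0\<close> by simp
    qed
    define near where "near x d \<longleftrightarrow> d > 0 \<and> (x \<in> N \<longrightarrow> ball x d \<subseteq> U) \<and> (x \<in> {a..b} - N \<longrightarrow>
        (\<forall>u v. u \<in> {a..b} \<longrightarrow> v \<in> {a..b} \<longrightarrow> u \<le> x \<longrightarrow> x \<le> v \<longrightarrow> u \<in> ball x d \<longrightarrow> v \<in> ball x d \<longrightarrow>
          norm (h v - h u - (v - u) *\<^sub>R h' x) \<le> e1 * (v - u)))" for x d
    have "\<exists>d. near x d" for x
    proof (cases "x \<in> N")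
      case True
      then show ?thesis using U unfolding near_def by (meson DiffD2 openE subset_eq)
    next
      case False
      show ?thesis
      proof (cases "x \<in> {a..b}")
        case True
        with False der have "(h has_vector_derivative h' x) (at x within {a..b})" by simp
        from vector_derivative_straddle[OF this \<open>e1 > 0\<close>] obtain d where "d > 0"
          "\<And>u v. u \<in> {a..b} \<Longrightarrow> v \<in> {a..b} \<Longrightarrow> u \<le> x \<Longrightarrow> x \<le> v \<Longrightarrow> u \<in> ball x d \<Longrightarrow> v \<in> ball x d \<Longrightarrow>
            norm (h v - h u - (v - u) *\<^sub>R h' x) \<le> e1 * (v - u)" by blast
        then show ?thesis using False unfolding near_def by blast
      next
        case outside: False
        show ?thesis by (rule exI[of _ 1]) (use False outside in \<open>auto simp: near_def\<close>)
      qed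
    qed
    then obtain d where "\<And>x. near x (d x)" by metis
    then have d: "\<And>x. d x > 0" "\<And>x. x \<in> N \<Longrightarrow> ball x (d x) \<subseteq> U"
      "\<And>x u v. x \<in> {a..b} - N \<Longrightarrow> u \<in> {a..b} \<Longrightarrow> v \<in> {a..b} \<Longrightarrow> u \<le> x \<Longrightarrow> x \<le> v \<Longrightarrow>
        u \<in> ball x (d x) \<Longrightarrow> v \<in> ball x (d x) \<Longrightarrow> norm (h v - h u - (v - u) *\<^sub>R h' x) \<le> e1 * (v - u)"
      unfolding near_def by blast+
    show "\<exists>\<gamma>. gauge \<gamma> \<and> (\<forall>\<D>. \<D> tagged_division_of cbox a b \<and> \<gamma> fine \<D> \<longrightarrow>
        norm ((\<Sum>(x,k)\<in>\<D>. measure lborel k *\<^sub>R g x) - (h b - h a)) < e)"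
    proof (intro exI conjI allI impI)
      show "gauge (\<lambda>x. ball x (d x))" using d(1) by (simp add: gauge_def)
      fix p assume p: "p tagged_division_of cbox a b \<and> (\<lambda>x. ball x (d x)) fine p"
      then have pt: "p tagged_division_of {a..b}" and fin: "finite p" by auto
      have cell: "\<exists>u v. k = {u..v} \<and> u \<le> v \<and> x \<in> {u..v} \<and> {u..v} \<subseteq> {a..b} \<and> {u..v} \<subseteq> ball x (d x)"
        if "(x, k) \<in> p" for x k
      proof -
        have "x \<in> k" "k \<subseteq> {a..b}" "\<exists>u v. k = cbox u v"
          using tagged_division_ofD(2,3,4)[OF pt that] by auto
        then show ?thesis using fineD[OF conjunct2[OF p] that] by fastforce
      qed
      \<comment> \<open>The intervals tagged in \<open>N\<close>: together they form a division of a subset of \<open>U\<close>.\<close>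
      define q where "q = {(x, k). (x, k) \<in> p \<and> x \<in> N}"
      have "q \<subseteq> p" by (auto simp: q_def)
      have "q tagged_partial_division_of {a..b}"
        by (rule tagged_partial_division_subset[OF conjunct1[OF pt[unfolded tagged_division_of_def]] \<open>q \<subseteq> p\<close>])
      then have qt: "q tagged_division_of \<Union>(snd ` q)"
        by (rule tagged_partial_division_of_Union_self)
      have qd: "snd ` q division_of \<Union>(snd ` q)"
        using qt by (rule division_of_tagged_division)
      have "\<Union>(snd ` q) \<subseteq> U"
      proof
        fix y assume "y \<in> \<Union>(snd ` q)"
        then obtain x k where xk: "(x, k) \<in> p" "x \<in> N" "y \<in> k" by (auto simp: q_def)
        then show "y \<in> U" using cell[OF xk(1)] d(2)[OF xk(2)] by auto
      qed
      then have "measure lebesgue (\<Union>(snd ` q)) \<le> measure lebesgue U"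
        using U qd by (intro measure_mono_fmeasurable) (auto intro!: fmeasurableD lmeasurable_division)
      then have "(\<Sum>J\<in>snd ` q. Sup J - Inf J) < \<delta>"
        using sum_division_lengths[OF qd] U(4) by simp
      moreover have "\<Union>(snd ` q) \<subseteq> {a..b}"
        using cell \<open>q \<subseteq> p\<close> by fastforce
      ultimately have small: "(\<Sum>J\<in>snd ` q. norm (h (Sup J) - h (Inf J))) < e / 2"
        using \<delta>(2)[OF qd] by blast
      \<comment> \<open>Set to \<open>0\<close> on the empty interval, where \<open>Sup\<close> and \<open>Inf\<close> have no meaning.\<close>
      define jump where "jump k = (if k = {} then 0 else norm (h (Sup k) - h (Inf k)))" for k
      have "(\<Sum>(x,k)\<in>q. norm (h (Sup k) - h (Inf k))) = (\<Sum>(x,k)\<in>q. jump k)"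
      proof -
        have "k \<noteq> {}" if "(x, k) \<in> q" for x k
          using cell[of x k] that \<open>q \<subseteq> p\<close> by auto
        then show ?thesis by (intro sum.cong) (auto simp: jump_def)
      qed
      also have "\<dots> = (\<Sum>J\<in>snd ` q. jump J)"
      proof (rule sum.over_tagged_division_lemma[OF qt])
        fix u v :: real assume "box u v = {}"
        then have "v \<le> u" by simp
        then show "jump (cbox u v) = 0"
          by (cases "u = v") (auto simp: jump_def)
      qed
      also have "\<dots> = (\<Sum>J\<in>snd ` q. norm (h (Sup J) - h (Inf J)))"
        by (rule sum.cong) (use division_ofD(3)[OF qd] in \<open>auto simp: jump_def\<close>)
      finally have "(\<Sum>(x,k)\<in>q. norm (h (Sup k) - h (Inf k))) = (\<Sum>J\<in>snd ` q. norm (h (Sup J) - h (Inf J)))" .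
      then have small': "(\<Sum>(x,k)\<in>q. norm (h (Sup k) - h (Inf k))) < e / 2"
        using small by simp
      have bad: "norm (measure lborel k *\<^sub>R g x - (h (Sup k) - h (Inf k))) \<le> norm (h (Sup k) - h (Inf k))"
        if "(x, k) \<in> q" for x k
        using that by (simp add: q_def g_def norm_minus_commute)
      have good: "norm (measure lborel k *\<^sub>R g x - (h (Sup k) - h (Inf k))) \<le> e1 * measure lborel k"
        if "(x, k) \<in> p - q" for x k
      proof -
        from that have xk: "(x, k) \<in> p" "x \<notin> N" by (auto simp: q_def)
        obtain u v where uv: "k = {u..v}" "u \<le> v" "x \<in> {u..v}" "{u..v} \<subseteq> {a..b}" "{u..v} \<subseteq> ball x (d x)"
          using cell[OF xk(1)] by blast
        have "u \<in> {u..v}" "v \<in> {u..v}" using uv(2) by auto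
        then have "norm (h v - h u - (v - u) *\<^sub>R h' x) \<le> e1 * (v - u)"
          using d(3)[of x u v] uv xk(2) uv(5)[THEN subsetD] by force
        then show ?thesis
          using uv xk(2) by (simp add: g_def norm_minus_commute)
      qed
      have "norm ((\<Sum>(x,k)\<in>p. measure lborel k *\<^sub>R g x) - (h b - h a))
          = norm (\<Sum>(x,k)\<in>p. measure lborel k *\<^sub>R g x - (h (Sup k) - h (Inf k)))"
        using additive_tagged_division_1[OF \<open>a \<le> b\<close> pt, of h]
        by (simp add: split_def sum_subtractf)
      also have "\<dots> \<le> (\<Sum>(x,k)\<in>p. norm (measure lborel k *\<^sub>R g x - (h (Sup k) - h (Inf k))))"
        by (simp add: split_def norm_sum)
      also have "\<dots> = (\<Sum>(x,k)\<in>p - q. norm (measure lborel k *\<^sub>R g x - (h (Sup k) - h (Inf k))))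
          + (\<Sum>(x,k)\<in>q. norm (measure lborel k *\<^sub>R g x - (h (Sup k) - h (Inf k))))"
        by (rule sum.subset_diff[OF \<open>q \<subseteq> p\<close> fin])
      also have "\<dots> \<le> (\<Sum>(x,k)\<in>p - q. e1 * measure lborel k) + (\<Sum>(x,k)\<in>q. norm (h (Sup k) - h (Inf k)))"
        using good bad by (intro add_mono sum_mono) auto
      also have "(\<Sum>(x,k)\<in>p - q. e1 * measure lborel k) \<le> (\<Sum>(x,k)\<in>p. e1 * measure lborel k)"
        using fin \<open>e1 > 0\<close> by (intro sum_mono2) (auto simp: split_def)
      also have "\<dots> = e1 * (\<Sum>(x,k)\<in>p. measure lborel k)"
        by (simp add: sum_distrib_left split_def)
      also have "(\<Sum>(x,k)\<in>p. measure lborel k) = b - a"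
        using additive_content_tagged_division[of p a b] p \<open>a \<le> b\<close> by simp
      also have "e1 * (b - a) \<le> e / 2"
        using \<open>a \<le> b\<close> \<open>e > 0\<close> by (simp add: e1_def field_simps)
      finally show "norm ((\<Sum>(x,k)\<in>p. measure lborel k *\<^sub>R g x) - (h b - h a)) < e"
        using small' by linarith
    qed
  qed
  then show ?thesis
    using has_integral_spike[OF \<open>negligible N\<close>, of "cbox a b" h' g] by (auto simp: g_def)
qed

lemma has_vector_derivative_iff_quotient:
  "(f has_vector_derivative D) (at x within S) \<longleftrightarrow>
    ((\<lambda>y. (f y - f x) /\<^sub>R (y - x)) \<longlongrightarrow> D) (at x within S)"
proof -
  have eq: "norm (f y - f x - (y - x) *\<^sub>R D) / norm (y - x) = norm ((f y - f x) /\<^sub>R (y - x) - D)"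
    if "y \<noteq> x" for y
  proof -
    have "(f y - f x) /\<^sub>R (y - x) - D = (f y - f x - (y - x) *\<^sub>R D) /\<^sub>R (y - x)"
      using that by (simp add: scaleR_diff_right)
    then show ?thesis by (simp add: divide_inverse mult.commute)
  qed
  have "(f has_vector_derivative D) (at x within S) \<longleftrightarrow>
      ((\<lambda>y. norm (f y - f x - (y - x) *\<^sub>R D) / norm (y - x)) \<longlongrightarrow> 0) (at x within S)"
    by (simp add: has_vector_derivative_def has_derivative_iff_norm bounded_linear_scaleR_left)
  also have "\<dots> \<longleftrightarrow> ((\<lambda>y. norm ((f y - f x) /\<^sub>R (y - x) - D)) \<longlongrightarrow> 0) (at x within S)"
    by (rule filterlim_cong[OF refl refl])
      (simp only: eventually_at_filter, rule always_eventually, use eq in blast)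
  also have "\<dots> \<longleftrightarrow> ((\<lambda>y. (f y - f x) /\<^sub>R (y - x)) \<longlongrightarrow> D) (at x within S)"
    by (simp add: tendsto_norm_zero_iff LIM_zero_iff)
  finally show ?thesis .
qed

lemma AE_leb01_iff: "(AE \<xi> in leb01. Q \<xi>) \<longleftrightarrow> (\<exists>N. negligible N \<and> (\<forall>\<xi>\<in>{0..1} - N. Q \<xi>))"
proof
  assume "AE \<xi> in leb01. Q \<xi>"
  then have "AE \<xi> in lebesgue. \<xi> \<in> {0..1} \<longrightarrow> Q \<xi>"
    by (subst (asm) AE_restrict_space_iff) auto
  then have "negligible {\<xi>. \<not> (\<xi> \<in> {0..1} \<longrightarrow> Q \<xi>)}"
    by (simp add: completion.AE_iff_null_sets negligible_iff_null_sets)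
  moreover have "\<forall>\<xi>\<in>{0..1} - {\<xi>. \<not> (\<xi> \<in> {0..1} \<longrightarrow> Q \<xi>)}. Q \<xi>" by blast
  ultimately show "\<exists>N. negligible N \<and> (\<forall>\<xi>\<in>{0..1} - N. Q \<xi>)" by blast
next
  assume "\<exists>N. negligible N \<and> (\<forall>\<xi>\<in>{0..1} - N. Q \<xi>)"
  then obtain N where N: "negligible N" "\<And>\<xi>. \<xi> \<in> {0..1} \<Longrightarrow> \<xi> \<notin> N \<Longrightarrow> Q \<xi>" by blast
  have "AE \<xi> in lebesgue. \<xi> \<notin> N"
    using N(1) by (simp add: negligible_iff_null_sets AE_not_in)
  then have "AE \<xi> in lebesgue. \<xi> \<in> {0..1} \<longrightarrow> Q \<xi>"
    by eventually_elim (use N(2) in blast)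
  then show "AE \<xi> in leb01. Q \<xi>"
    by (subst AE_restrict_space_iff) auto
qed

lemma AE_leb01_interval: "AE \<xi> in leb01. \<xi> \<in> {0..1}"
  by (rule AE_I2) simp

lemma abs_continuous_on_bounded:
  fixes h :: "real \<Rightarrow> 'b::real_normed_vector"
  assumes "abs_continuous_on {a..b} h"
  obtains B where "0 \<le> B" "\<And>\<xi>. \<xi> \<in> {a..b} \<Longrightarrow> norm (h \<xi>) \<le> B"
proof -
  have "bounded (h ` {a..b})"
    using abs_continuous_on_imp_continuous[OF assms]
    by (intro compact_imp_bounded compact_continuous_image) auto
  then obtain B where "\<forall>x\<in>h ` {a..b}. norm x \<le> B" unfolding bounded_iff by blast
  then have "norm (h \<xi>) \<le> max B 0" if "\<xi> \<in> {a..b}" for \<xi> using that by (simp add: max.coboundedI1)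
  from that[OF max.cobounded2 this] show ?thesis .
qed

lemma ac_with_derivativeD:
  assumes "ac_with_derivative h h'"
  shows "abs_continuous_on {0..1} h"
    "AE \<xi> in leb01. (h has_vector_derivative h' \<xi>) (at \<xi> within {0..1})"
    "continuous_on {0..1} h"
  using assms abs_continuous_on_imp_continuous by (auto simp: ac_with_derivative_def)

lemma ac_with_derivative_bilinear:
  assumes H: "bounded_bilinear H" and f: "ac_with_derivative f f'" and g: "ac_with_derivative g g'"
  shows "ac_with_derivative (\<lambda>\<xi>. H (f \<xi>) (g \<xi>)) (\<lambda>\<xi>. H (f \<xi>) (g' \<xi>) + H (f' \<xi>) (g \<xi>))"
  unfolding ac_with_derivative_def
proof
  obtain K where K: "0 \<le> K" "\<And>x y. norm (H x y) \<le> norm x * norm y * K"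
    using bounded_bilinear.nonneg_bounded[OF H] by blast
  obtain Bf where Bf: "0 \<le> Bf" "\<And>\<xi>. \<xi> \<in> {0..1} \<Longrightarrow> norm (f \<xi>) \<le> Bf"
    using abs_continuous_on_bounded[OF ac_with_derivativeD(1)[OF f]] by blast
  obtain Bg where Bg: "0 \<le> Bg" "\<And>\<xi>. \<xi> \<in> {0..1} \<Longrightarrow> norm (g \<xi>) \<le> Bg"
    using abs_continuous_on_bounded[OF ac_with_derivativeD(1)[OF g]] by blast
  show "abs_continuous_on {0..1} (\<lambda>\<xi>. H (f \<xi>) (g \<xi>))"
  proof (rule abs_continuous_on_dominated[OF ac_with_derivativeD(1)[OF f] ac_with_derivativeD(1)[OF g]])
    show "0 \<le> K * (Bf + Bg)" using K Bf Bg by simp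
    fix u v :: real assume uv: "u \<in> {0..1}" "v \<in> {0..1}"
    have "H (f v) (g v) - H (f u) (g u) = H (f v - f u) (g v) + H (f u) (g v - g u)"
      by (simp add: bounded_bilinear.diff_left[OF H] bounded_bilinear.diff_right[OF H])
    also have "norm \<dots> \<le> norm (f v - f u) * norm (g v) * K + norm (f u) * norm (g v - g u) * K"
      using norm_triangle_le[OF add_mono[OF K(2) K(2)]] .
    also have "\<dots> \<le> norm (f v - f u) * Bg * K + Bf * norm (g v - g u) * K"
      using K(1) Bf Bg uv by (intro add_mono mult_right_mono mult_left_mono) auto
    also have "\<dots> \<le> K * (Bf + Bg) * (norm (f v - f u) + norm (g v - g u))"
      using K(1) Bf(1) Bg(1) by (simp add: algebra_simps)
    finally show "norm (H (f v) (g v) - H (f u) (g u)) \<le> K * (Bf + Bg) * (norm (f v - f u) + norm (g v - g u))" .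
  qed
  show "AE \<xi> in leb01. ((\<lambda>\<xi>. H (f \<xi>) (g \<xi>)) has_vector_derivative H (f \<xi>) (g' \<xi>) + H (f' \<xi>) (g \<xi>))
      (at \<xi> within {0..1})"
    using ac_with_derivativeD(2)[OF f] ac_with_derivativeD(2)[OF g]
    by eventually_elim (rule bounded_bilinear.has_vector_derivative[OF H])
qed

lemma ac_with_derivative_C1:
  fixes f :: "real \<Rightarrow> 'b::real_normed_vector"
  assumes der: "\<And>\<xi>. \<xi> \<in> {0..1} \<Longrightarrow> (f has_vector_derivative f' \<xi>) (at \<xi> within {0..1})"
    and cont: "continuous_on {0..1} f'"
  shows "ac_with_derivative f f'"
proof -
  have "bounded (f' ` {0..1})" using cont by (intro compact_imp_bounded compact_continuous_image) auto
  then obtain B where B: "\<And>\<xi>. \<xi> \<in> {0..1} \<Longrightarrow> norm (f' \<xi>) \<le> B" unfolding bounded_iff by blast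
  have "norm (f v - f u) \<le> B * \<bar>v - u\<bar>" if "u \<in> {0..1}" "v \<in> {0..1}" for u v
  proof -
    have "norm (f v - f u) \<le> B * norm (v - u)"
    proof (rule differentiable_bound[of "{0..1}" f "\<lambda>x t. t *\<^sub>R f' x"])
      show "(f has_derivative (\<lambda>t. t *\<^sub>R f' x)) (at x within {0..1})" if "x \<in> {0..1}" for x
        using der[OF that] by (simp add: has_vector_derivative_def)
      show "onorm (\<lambda>t. t *\<^sub>R f' x) \<le> B" if "x \<in> {0..1}" for x
      proof (rule onorm_le)
        show "norm (t *\<^sub>R f' x) \<le> B * norm t" for t
          using mult_right_mono[OF B[OF that] abs_ge_zero[of t]] by (simp add: mult.commute)
      qed
    qed (use that in auto)
    then show ?thesis by simp
  qed
  then have "abs_continuous_on {0..1} f" by (rule abs_continuous_on_lipschitz)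
  then show ?thesis using der by (auto simp: ac_with_derivative_def intro!: AE_I2)
qed

lemma ac_with_derivative_const: "ac_with_derivative (\<lambda>_. c) (\<lambda>_. 0)"
  by (rule ac_with_derivative_C1) auto

lemma ac_with_derivative_exp:
  "ac_with_derivative (\<lambda>\<xi>. exp (c * \<xi>)) (\<lambda>\<xi>. c * exp (c * \<xi>) :: real)"
  by (rule ac_with_derivative_C1)
    (auto intro!: derivative_eq_intros continuous_intros simp: has_real_derivative_iff_has_vector_derivative[symmetric])

lemma ac_with_derivative_has_integral:
  fixes h :: "real \<Rightarrow> 'b::banach"
  assumes h: "ac_with_derivative h h'" and ab: "0 \<le> a" "a \<le> b" "b \<le> 1"
    and "AE \<xi> in leb01. k \<xi> = h' \<xi>"
  shows "(k has_integral (h b - h a)) {a..b}"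
proof -
  have "AE \<xi> in leb01. (h has_vector_derivative k \<xi>) (at \<xi> within {0..1})"
    using ac_with_derivativeD(2)[OF h] assms(5) by eventually_elim simp
  then obtain N where N: "negligible N"
    "\<And>\<xi>. \<xi> \<in> {0..1} \<Longrightarrow> \<xi> \<notin> N \<Longrightarrow> (h has_vector_derivative k \<xi>) (at \<xi> within {0..1})"
    unfolding AE_leb01_iff by blast
  show ?thesis
  proof (rule fundamental_theorem_of_calculus_abs_continuous[OF ab(2) _ N(1)])
    show "abs_continuous_on {a..b} h"
      using ac_with_derivativeD(1)[OF h] ab by (auto intro: abs_continuous_on_subset)
    show "(h has_vector_derivative k x) (at x within {a..b})" if "x \<in> {a..b} - N" for x
      using N(2)[of x] that ab by (auto intro: has_vector_derivative_within_subset)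
  qed
qed

lemma ac_with_derivative_nonneg_imp_ge:
  fixes r :: "real \<Rightarrow> real"
  assumes r: "ac_with_derivative r r'" and nonneg: "AE \<xi> in leb01. 0 \<le> r' \<xi>" and "\<xi> \<in> {0..1}"
  shows "r 0 \<le> r \<xi>"
proof -
  have "AE \<xi> in leb01. max 0 (r' \<xi>) = r' \<xi>"
    using nonneg by eventually_elim simp
  then have "((\<lambda>\<xi>. max 0 (r' \<xi>)) has_integral (r \<xi> - r 0)) {0..\<xi>}"
    using \<open>\<xi> \<in> {0..1}\<close> by (intro ac_with_derivative_has_integral[OF r]) auto
  then have "0 \<le> r \<xi> - r 0" by (rule has_integral_nonneg) simp
  then show ?thesis by simp
qed

section \<open>Orbits of strongly continuous semigroups\<close>

lemma c0_semigroupD: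
  assumes "c0_semigroup T"
  shows "t \<ge> 0 \<Longrightarrow> bounded_linear (T t)" "T 0 = id"
    "s \<ge> 0 \<Longrightarrow> t \<ge> 0 \<Longrightarrow> T (s + t) x = T s (T t x)"
    "((\<lambda>t. T t x) \<longlongrightarrow> x) (at_right 0)"
  using assms unfolding c0_semigroup_def by auto

lemma semigroup_orbit_continuous_right:
  assumes T: "c0_semigroup T" and "t \<ge> 0"
  shows "((\<lambda>s. T s x) \<longlongrightarrow> T t x) (at_right t)"
proof -
  have "((\<lambda>h. T t (T h x)) \<longlongrightarrow> T t x) (at_right 0)"
    using bounded_linear.tendsto[OF c0_semigroupD(1)[OF T \<open>t \<ge> 0\<close>] c0_semigroupD(4)[OF T]] .
  then have "((\<lambda>h. T (h + t) x) \<longlongrightarrow> T t x) (at_right 0)"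
    by (rule Lim_transform_eventually)
      (use eventually_at_right_less[of 0] in \<open>eventually_elim, use c0_semigroupD(3)[OF T \<open>t \<ge> 0\<close>] in \<open>auto simp: add.commute\<close>\<close>)
  then show ?thesis
    by (subst filterlim_at_right_to_0) simp
qed

text \<open>
  The Baire category theorem, applied on the time axis rather than in the state space. The sets \<open>E n\<close> of times with \<open>\<parallel>T t\<parallel> \<le> n\<close> cover a
  compact interval, so the closure of some \<open>E n\<close> contains an open interval. Every time in that interval is a
  limit from the right of times in \<open>E n\<close>, and right continuity of the orbits carries the bound over to it.
\<close>

lemma semigroup_bounded_on_some_interval:
  fixes T :: "real \<Rightarrow> 'x::real_normed_vector \<Rightarrow> 'x"
  assumes T: "c0_semigroup T" and "0 < a"
  obtains c d :: real and B where "0 < c" "c < d" "d < a"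
    "\<And>t x. c < t \<Longrightarrow> t < d \<Longrightarrow> norm (T t x) \<le> B * norm x"
proof -
  define E where "E n = {t \<in> {a/3..a/2}. \<forall>x. norm (T t x) \<le> real n * norm x}" for n
  have cover: "{a/3..a/2} \<subseteq> (\<Union>n. E n)"
  proof
    fix t assume t: "t \<in> {a/3..a/2}"
    then obtain K where "\<And>x. norm (T t x) \<le> norm x * K"
      using bounded_linear.bounded[OF c0_semigroupD(1)[OF T, of t]] \<open>0 < a\<close> by auto
    moreover obtain n where "K \<le> real n" using real_arch_simple by blast
    ultimately have "norm (T t x) \<le> real n * norm x" for x
      by (metis mult.commute mult_left_mono norm_ge_zero order_trans)
    then show "t \<in> (\<Union>n. E n)" using t by (auto simp: E_def)
  qed
  have "\<exists>n. interior (closure (E n)) \<noteq> {}"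
  proof (rule ccontr)
    assume "\<not> ?thesis"
    then have empty: "interior (closure (E n)) = {}" for n by blast
    have "UNIV \<subseteq> closure (\<Inter>(range (\<lambda>n. - closure (E n))))"
      by (rule Baire) (auto simp: closure_complement empty)
    moreover have "box (a/3) (a/2) \<inter> (\<Inter>(range (\<lambda>n. - closure (E n)))) = {}"
    proof (rule equals0I)
      fix t assume t: "t \<in> box (a/3) (a/2) \<inter> (\<Inter>(range (\<lambda>n. - closure (E n))))"
      then have "t \<in> {a/3..a/2}" by auto
      then obtain n where "t \<in> E n" using cover by blast
      then have "t \<in> closure (E n)" using closure_subset by blast
      then show False using t by blast
    qed
    ultimately have "box (a/3) (a/2) \<inter> UNIV = {}"
      using open_Int_closure_eq_empty[of "box (a/3) (a/2)" "\<Inter>(range (\<lambda>n. - closure (E n)))"]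
      by (metis open_box top.extremum_uniqueI)
    then show False using \<open>0 < a\<close> by simp
  qed
  then obtain n p where "p \<in> interior (closure (E n))" by blast
  then obtain e where e: "e > 0" "ball p e \<subseteq> closure (E n)"
    unfolding mem_interior by blast
  have "closure (E n) \<subseteq> {a/3..a/2}" by (rule closure_minimal) (auto simp: E_def)
  have bound: "norm (T t x) \<le> real n * norm x" if "p - e < t" "t < p + e" for t x
  proof -
    have "t \<in> ball p e" using that by (auto simp: dist_real_def)
    then have "t \<ge> 0" using e(2) \<open>closure (E n) \<subseteq> _\<close> \<open>0 < a\<close> by fastforce
    define S where "S = {t<..<p + e} \<inter> E n"
    \<comment> \<open>Approach \<open>t\<close> from the right only, where the orbit is known to be continuous.\<close>
    have "t islimpt S"
      unfolding islimpt_approachable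
    proof (intro allI impI)
      fix \<epsilon> :: real assume "\<epsilon> > 0"
      define m where "m = min (p + e) (t + \<epsilon>)"
      have m: "t < m" "m \<le> p + e" using that \<open>\<epsilon> > 0\<close> by (auto simp: m_def)
      have "\<bar>p - (t + m) / 2\<bar> < e" unfolding abs_less_iff using m that by (simp add: field_simps)
      then have "(t + m) / 2 \<in> ball p e" by (simp add: dist_real_def)
      then have "(t + m) / 2 \<in> {t<..<m} \<inter> closure (E n)" using e(2) m(1) by auto
      then have "{t<..<m} \<inter> E n \<noteq> {}"
        using open_Int_closure_eq_empty[of "{t<..<m}" "E n"] by (metis empty_iff open_greaterThanLessThan)
      then obtain s where "s \<in> E n" "t < s" "s < m" by auto
      then show "\<exists>s\<in>S. s \<noteq> t \<and> dist s t < \<epsilon>"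
        by (intro bexI[of _ s]) (auto simp: S_def m_def dist_real_def)
    qed
    then have nontriv: "at t within S \<noteq> bot" by (simp add: trivial_limit_within)
    have "((\<lambda>s. T s x) \<longlongrightarrow> T t x) (at t within S)"
      by (rule tendsto_mono[OF _ semigroup_orbit_continuous_right[OF T \<open>t \<ge> 0\<close>]])
        (auto intro!: at_le simp: S_def)
    then have "((\<lambda>s. norm (T s x)) \<longlongrightarrow> norm (T t x)) (at t within S)"
      by (rule tendsto_norm)
    moreover have "\<forall>\<^sub>F s in at t within S. norm (T s x) \<le> real n * norm x"
      by (auto simp: eventually_at_filter S_def E_def)
    ultimately show ?thesis using tendsto_upperbound nontriv by blast
  qed
  have "ball p e \<subseteq> {a/3..a/2}" using e \<open>closure (E n) \<subseteq> _\<close> by blast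
  moreover have "p - e / 2 \<in> ball p e" "p + e / 2 \<in> ball p e" using e(1) by (auto simp: dist_real_def)
  ultimately have "p - e / 2 \<in> {a/3..a/2}" "p + e / 2 \<in> {a/3..a/2}" by blast+
  then show ?thesis
    using that[of "p - e / 2" "p + e / 2" "real n"] bound e(1) \<open>0 < a\<close> by auto
qed

text \<open>
  A bound on any interval to the left of \<open>t\<close> is transported to a neighbourhood of \<open>t\<close> by the bounded operator
  that bridges the distance.
\<close>

lemma semigroup_locally_bounded:
  fixes T :: "real \<Rightarrow> 'x::real_normed_vector \<Rightarrow> 'x"
  assumes T: "c0_semigroup T" and "0 < t"
  obtains \<eta> B where "0 < \<eta>" "\<eta> < t" "0 \<le> B"
    "\<And>s x. \<bar>s - t\<bar> < \<eta> \<Longrightarrow> norm (T s x) \<le> B * norm x"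
proof -
  obtain c d :: real and B where cd: "0 < c" "c < d" "d < t"
    and B: "\<And>s x. c < s \<Longrightarrow> s < d \<Longrightarrow> norm (T s x) \<le> B * norm x"
    using semigroup_bounded_on_some_interval[OF T \<open>0 < t\<close>] by blast
  define m where "m = (c + d) / 2"
  obtain K where K: "K \<ge> 0" "\<And>x. norm (T (t - m) x) \<le> norm x * K"
    using bounded_linear.nonneg_bounded[OF c0_semigroupD(1)[OF T, of "t - m"]] cd by (auto simp: m_def)
  have "norm (T s x) \<le> (\<bar>B\<bar> * K) * norm x" if "\<bar>s - t\<bar> < (d - c) / 2" for s x
  proof -
    define r where "r = s - (t - m)"
    have r: "c < r" "r < d" using that cd by (auto simp: r_def m_def abs_if field_simps split: if_splits)
    have "T s x = T r (T (t - m) x)"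
      using c0_semigroupD(3)[OF T, of r "t - m" x] r cd by (simp add: r_def m_def)
    also have "norm \<dots> \<le> \<bar>B\<bar> * norm (T (t - m) x)"
      using B[OF r, of "T (t - m) x"] mult_right_mono[OF abs_ge_self[of B] norm_ge_zero, of "T (t - m) x"] by linarith
    also have "\<dots> \<le> \<bar>B\<bar> * (norm x * K)" using K(2) by (intro mult_left_mono) auto
    finally show ?thesis by (simp add: mult_ac)
  qed
  then show ?thesis
    using that[of "(d - c) / 2" "\<bar>B\<bar> * K"] cd K(1) by auto
qed

text \<open>
  Continuity from the left is where local boundedness enters:
  \<open>T t x - T (t - h) x = T (t - h) (T h x - x)\<close>.
\<close>

lemma semigroup_orbit_continuous:
  fixes T :: "real \<Rightarrow> 'x::real_normed_vector \<Rightarrow> 'x"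
  assumes T: "c0_semigroup T"
  shows "continuous_on {0..} (\<lambda>t. T t x)"
proof -
  have left: "((\<lambda>s. T s x) \<longlongrightarrow> T t x) (at_left t)" if "t > 0" for t
  proof -
    obtain \<eta> B where \<eta>: "0 < \<eta>" "\<eta> < t" "0 \<le> B"
      and B: "\<And>s x. \<bar>s - t\<bar> < \<eta> \<Longrightarrow> norm (T s x) \<le> B * norm x"
      using semigroup_locally_bounded[OF T \<open>t > 0\<close>] by blast
    have "((\<lambda>h. T h x - x) \<longlongrightarrow> 0) (at_right 0)"
      using tendsto_diff[OF c0_semigroupD(4)[OF T, of x] tendsto_const[of x]] by simp
    then have "((\<lambda>h. B * norm (T h x - x)) \<longlongrightarrow> 0) (at_right 0)"
      by (intro tendsto_mult_right_zero tendsto_norm_zero)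
    moreover have "\<forall>\<^sub>F h in at_right 0. norm (T t x - T (t - h) x) \<le> B * norm (T h x - x)"
    proof (rule eventually_at_rightI)
      fix h assume h: "h \<in> {0<..<\<eta>}"
      have "T t x - T (t - h) x = T (t - h) (T h x - x)"
        using c0_semigroupD(3)[OF T, of "t - h" h x] h \<eta>
          bounded_linear.linear[OF c0_semigroupD(1)[OF T, of "t - h"]] by (simp add: linear_diff)
      then show "norm (T t x - T (t - h) x) \<le> B * norm (T h x - x)" using B[of "t - h"] h by simp
    qed (use \<eta> in auto)
    ultimately have "((\<lambda>h. T t x - T (t - h) x) \<longlongrightarrow> 0) (at_right 0)"
      by (rule Lim_null_comparison[rotated])
    from tendsto_diff[OF tendsto_const[of "T t x"] this]
    have "((\<lambda>h. T (t - h) x) \<longlongrightarrow> T t x) (at_right 0)" by simp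
    then show ?thesis
      by (simp add: filterlim_at_left_to_right[of _ _ t] filterlim_at_right_to_0[of _ _ "- t"])
  qed
  show ?thesis
    unfolding continuous_on
  proof
    fix t :: real assume "t \<in> {0..}"
    then consider "t = 0" | "t > 0" by fastforce
    then show "((\<lambda>t. T t x) \<longlongrightarrow> T t x) (at t within {0..})"
    proof cases
      case 1
      then show ?thesis
        using semigroup_orbit_continuous_right[OF T, of 0 x] by (simp add: at_within_Ici_at_right)
    next
      case 2
      then have "((\<lambda>s. T s x) \<longlongrightarrow> T t x) (at t)"
        using left semigroup_orbit_continuous_right[OF T, of t x] by (simp add: filterlim_at_split)
      then show ?thesis by (rule tendsto_within_subset) simp
    qed
  qed
qed

lemma generator_orbit_quotient:
  assumes T: "c0_semigroup T" and xy: "(x, y) \<in> generator T" and "t \<ge> 0"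
  shows "((\<lambda>h. (T (t + h) x - T t x) /\<^sub>R h) \<longlongrightarrow> T t y) (at_right 0)"
proof -
  note lin = c0_semigroupD(1)[OF T \<open>t \<ge> 0\<close>]
  have "((\<lambda>h. T t ((T h x - x) /\<^sub>R h)) \<longlongrightarrow> T t y) (at_right 0)"
    using xy by (intro bounded_linear.tendsto[OF lin]) (simp add: generator_def)
  then show ?thesis
  proof (rule Lim_transform_eventually)
    show "\<forall>\<^sub>F h in at_right 0. T t ((T h x - x) /\<^sub>R h) = (T (t + h) x - T t x) /\<^sub>R h"
      using eventually_at_right_less[of 0]
      by eventually_elim (use c0_semigroupD(3)[OF T \<open>t \<ge> 0\<close>] lin in
        \<open>simp add: linear_diff linear_scale bounded_linear.linear\<close>)
  qed
qed

lemma generator_invariant: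
  assumes T: "c0_semigroup T" and xy: "(x, y) \<in> generator T" and "t \<ge> 0"
  shows "(T t x, T t y) \<in> generator T"
proof -
  have "\<forall>\<^sub>F h in at_right 0. (T (t + h) x - T t x) /\<^sub>R h = (T h (T t x) - T t x) /\<^sub>R h"
    using eventually_at_right_less[of 0]
    by eventually_elim (use c0_semigroupD(3)[OF T _ \<open>t \<ge> 0\<close>] in \<open>simp add: add.commute\<close>)
  from Lim_transform_eventually[OF generator_orbit_quotient[OF assms] this]
  show ?thesis by (simp add: generator_def)
qed

text \<open>
  The right derivative is the definition of the generator, shifted by \<open>T t\<close>. For the left derivative the
  difference quotient at \<open>t\<close> is \<open>T (t - h)\<close> applied to a quotient that tends to \<open>y\<close>, so local boundedness and
  continuity of the orbit of \<open>y\<close> are needed.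
\<close>

lemma semigroup_orbit_has_vector_derivative:
  fixes T :: "real \<Rightarrow> 'x::real_normed_vector \<Rightarrow> 'x"
  assumes T: "c0_semigroup T" and xy: "(x, y) \<in> generator T" and "t > 0"
  shows "((\<lambda>t. T t x) has_vector_derivative T t y) (at t)"
proof -
  obtain \<eta> B where \<eta>: "0 < \<eta>" "\<eta> < t" "0 \<le> B"
    and B: "\<And>s x. \<bar>s - t\<bar> < \<eta> \<Longrightarrow> norm (T s x) \<le> B * norm x"
    using semigroup_locally_bounded[OF T \<open>t > 0\<close>] by blast
  have right: "((\<lambda>h. (T (t + h) x - T t x) /\<^sub>R h) \<longlongrightarrow> T t y) (at_right 0)"
    using generator_orbit_quotient[OF T xy] \<open>t > 0\<close> by simp
  have "((\<lambda>h. (T h x - x) /\<^sub>R h - y) \<longlongrightarrow> 0) (at_right 0)"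
    using xy by (simp add: generator_def LIM_zero)
  then have "((\<lambda>h. B * norm ((T h x - x) /\<^sub>R h - y)) \<longlongrightarrow> 0) (at_right 0)"
    by (intro tendsto_mult_right_zero tendsto_norm_zero)
  moreover have "\<forall>\<^sub>F h in at_right 0. norm ((T (t - h) x - T t x) /\<^sub>R (- h) - T (t - h) y)
      \<le> B * norm ((T h x - x) /\<^sub>R h - y)"
  proof (rule eventually_at_rightI)
    fix h assume h: "h \<in> {0<..<\<eta>}"
    have lin: "linear (T (t - h))"
      using bounded_linear.linear[OF c0_semigroupD(1)[OF T, of "t - h"]] h \<eta> by simp
    have "(T (t - h) x - T t x) /\<^sub>R (- h) - T (t - h) y = T (t - h) ((T h x - x) /\<^sub>R h - y)"
      using c0_semigroupD(3)[OF T, of "t - h" h x] h \<eta>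
      by (simp add: linear_diff[OF lin] linear_scale[OF lin] scaleR_diff_right)
    then show "norm ((T (t - h) x - T t x) /\<^sub>R (- h) - T (t - h) y) \<le> B * norm ((T h x - x) /\<^sub>R h - y)"
      using B[of "t - h"] h by simp
  qed (use \<eta> in auto)
  ultimately have "((\<lambda>h. (T (t - h) x - T t x) /\<^sub>R (- h) - T (t - h) y) \<longlongrightarrow> 0) (at_right 0)"
    by (rule Lim_null_comparison[rotated])
  moreover have "((\<lambda>h. T (t - h) y) \<longlongrightarrow> T t y) (at_right 0)"
  proof -
    have "continuous_on {0<..} (\<lambda>s. T s y)"
      using semigroup_orbit_continuous[OF T, of y] by (rule continuous_on_subset) auto
    then have "((\<lambda>s. T s y) \<longlongrightarrow> T t y) (at t)"
      using \<open>t > 0\<close> by (simp add: continuous_on_eq_continuous_at isCont_def)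
    then have "((\<lambda>s. T s y) \<longlongrightarrow> T t y) (at_left t)" by (simp add: filterlim_at_split)
    then show ?thesis
      by (simp add: filterlim_at_left_to_right[of _ _ t] filterlim_at_right_to_0[of _ _ "- t"])
  qed
  ultimately have "((\<lambda>h. (T (t - h) x - T t x) /\<^sub>R (- h)) \<longlongrightarrow> T t y) (at_right 0)"
    using tendsto_add by fastforce
  then have "((\<lambda>h. (T (t + h) x - T t x) /\<^sub>R h) \<longlongrightarrow> T t y) (at_left 0)"
    by (simp add: filterlim_at_left_to_right[of _ _ 0])
  with right have "((\<lambda>h. (T (t + h) x - T t x) /\<^sub>R h) \<longlongrightarrow> T t y) (at 0)"
    by (simp add: filterlim_at_split)
  then have "((\<lambda>s. (T s x - T t x) /\<^sub>R (s - t)) \<longlongrightarrow> T t y) (at t)"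
    by (subst filterlim_at_to_0) (simp add: add.commute)
  then show ?thesis unfolding has_vector_derivative_iff_quotient .
qed

text \<open>
  Along orbits in the domain, \<open>e\<^sup>\<nu>\<^sup>t \<Phi>(T t x, T t x)\<close> has nonpositive derivative; both sides of the
  estimate are continuous in \<open>x\<close>, so it extends to the closure of the domain.
  Applied to \<open>-\<Phi>\<close> with \<open>\<nu> = 0\<close> the estimate says that \<open>\<Phi>\<close> grows.
\<close>

lemma lyapunov_estimate:
  fixes T :: "real \<Rightarrow> 'x::real_normed_vector \<Rightarrow> 'x" and \<Phi> :: "'x \<Rightarrow> 'x \<Rightarrow> real"
  assumes T: "c0_semigroup T" and bil: "bounded_bilinear \<Phi>" and sym: "\<And>x y. \<Phi> x y = \<Phi> y x"
    and diss: "\<And>x y. (x, y) \<in> generator T \<Longrightarrow> 2 * \<Phi> x y \<le> - \<nu> * \<Phi> x x"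
    and dense: "closure (Domain (generator T)) = UNIV" and "t \<ge> 0"
  shows "\<Phi> (T t x) (T t x) \<le> exp (- \<nu> * t) * \<Phi> x x"
proof -
  have "\<Phi> (T t x) (T t x) \<le> exp (- \<nu> * t) * \<Phi> x x" if "(x, y) \<in> generator T" for x y
  proof -
    define f where "f s = exp (\<nu> * s) * \<Phi> (T s x) (T s x)" for s
    have "f t \<le> f 0"
    proof (rule DERIV_nonpos_imp_decreasing_open[OF \<open>t \<ge> 0\<close>])
      fix s assume s: "0 < s" "s < t"
      have "((\<lambda>s. \<Phi> (T s x) (T s x)) has_vector_derivative \<Phi> (T s x) (T s y) + \<Phi> (T s y) (T s x)) (at s)"
        using semigroup_orbit_has_vector_derivative[OF T that s(1)]
        by (intro bounded_bilinear.has_vector_derivative[OF bil])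
      then have "((\<lambda>s. \<Phi> (T s x) (T s x)) has_real_derivative 2 * \<Phi> (T s x) (T s y)) (at s)"
        by (simp add: has_real_derivative_iff_has_vector_derivative sym)
      then have "(f has_real_derivative
          exp (\<nu> * s) * (2 * \<Phi> (T s x) (T s y) + \<nu> * \<Phi> (T s x) (T s x))) (at s)"
        unfolding f_def by (auto intro!: derivative_eq_intros simp: algebra_simps)
      moreover have "2 * \<Phi> (T s x) (T s y) + \<nu> * \<Phi> (T s x) (T s x) \<le> 0"
        using diss[OF generator_invariant[OF T that, of s]] s by simp
      ultimately show "\<exists>y. (f has_real_derivative y) (at s) \<and> y \<le> 0"
        by (meson exp_ge_zero mult_nonneg_nonpos)
    next
      have "continuous_on {0..t} (\<lambda>s. T s x)"
        using semigroup_orbit_continuous[OF T] by (rule continuous_on_subset) auto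
      then show "continuous_on {0..t} f"
        unfolding f_def by (intro continuous_intros bounded_bilinear.continuous_on[OF bil])
    qed
    then have "exp (- \<nu> * t) * (exp (\<nu> * t) * \<Phi> (T t x) (T t x)) \<le> exp (- \<nu> * t) * \<Phi> x x"
      using c0_semigroupD(2)[OF T] by (intro mult_left_mono) (auto simp: f_def)
    then show ?thesis by (simp add: mult.assoc[symmetric] exp_add[symmetric])
  qed
  then have sub: "Domain (generator T) \<subseteq> {x. \<Phi> (T t x) (T t x) \<le> exp (- \<nu> * t) * \<Phi> x x}"
    by auto
  have "continuous_on UNIV (T t)"
    using bounded_linear.continuous_on[OF c0_semigroupD(1)[OF T \<open>t \<ge> 0\<close>]] continuous_on_id by blast
  then have "closed {x. \<Phi> (T t x) (T t x) \<le> exp (- \<nu> * t) * \<Phi> x x}"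
    by (intro closed_Collect_le continuous_intros bounded_bilinear.continuous_on[OF bil])
  then show ?thesis using closure_minimal[OF sub] dense by auto
qed

section \<open>Quadratic forms adapted to the spectrum of a matrix\<close>

text \<open>
  The vector \<open>p(M) v\<close>, by Horner's rule.
\<close>

definition poly_act :: "complex poly \<Rightarrow> complex^'n^'n \<Rightarrow> complex^'n \<Rightarrow> complex^'n"
  where "poly_act p M v = fold_coeffs (\<lambda>a w. a *s v + M *v w) p 0"

lemma poly_act_0: "poly_act 0 M v = 0"
  by (simp add: poly_act_def)

lemma poly_act_pCons: "poly_act (pCons a p) M v = a *s v + M *v poly_act p M v"
  by (cases "a = 0 \<and> p = 0") (auto simp: poly_act_def fold_coeffs_pCons_coeff_not_0_eq
    fold_coeffs_pCons_not_0_0_eq)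

lemma poly_act_add: "poly_act (p + q) M v = poly_act p M v + poly_act q M v"
proof (induction p q rule: poly_induct2)
  case 0
  show ?case by (simp add: poly_act_0)
next
  case (pCons a p b q)
  then show ?case
    by (simp add: poly_act_pCons matrix_vector_right_distrib vec.scale_left_distrib)
qed

lemma poly_act_smult: "poly_act (smult c p) M v = c *s poly_act p M v"
  by (induction p) (simp_all add: poly_act_0 poly_act_pCons vector_smult_assoc
      vector_add_ldistrib vec.scale)

lemma poly_act_diff: "poly_act (p - q) M v = poly_act p M v - poly_act q M v"
  using poly_act_add[of "p - q" q M v] by simp

lemma poly_act_sum: "poly_act (\<Sum>i\<in>I. f i) M v = (\<Sum>i\<in>I. poly_act (f i) M v)"
  by (induction I rule: infinite_finite_induct) (simp_all add: poly_act_0 poly_act_add)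

lemma poly_act_monom: "poly_act (monom c i) M v = c *s (((*v) M) ^^ i) v"
  by (induction i) (simp_all add: monom_0 monom_Suc poly_act_pCons poly_act_0 vec.scale)

lemma poly_act_linear_factor_mult:
  "poly_act ([:- z, 1:] * q) M v = poly_act q M (M *v v - z *s v)"
proof -
  have "poly_act q M (M *v v - z *s v) = M *v poly_act q M v - z *s poly_act q M v"
  proof (induction q)
    case (pCons a q)
    then show ?case
      by (simp add: poly_act_pCons matrix_vector_right_distrib matrix_vector_mult_diff_distrib
        vec.scale vector_ssub_ldistrib vector_add_ldistrib vector_smult_assoc mult.commute)
  qed (simp add: poly_act_0)
  then show ?thesis
    by (simp add: mult_pCons_left poly_act_diff poly_act_add poly_act_smult poly_act_pCons poly_act_0)
qed

text \<open>
  A family indexed by more elements than the dimension satisfies a nontrivial linear relation. Repetitions in the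
  family, which a statement about dependent sets would not see, are treated separately.
\<close>

lemma real_linear_relation:
  fixes w :: "nat \<Rightarrow> 'b::euclidean_space"
  obtains c where "\<exists>i\<le>DIM('b). c i \<noteq> 0" "(\<Sum>i\<le>DIM('b). c i *\<^sub>R w i) = 0"
proof (cases "inj_on w {..DIM('b)}")
  case True
  then have "card (w ` {..DIM('b)}) > DIM('b)" by (simp add: card_image)
  then have "dependent (w ` {..DIM('b)})" using dependent_biggerset by blast
  then obtain u where u: "\<exists>x\<in>w ` {..DIM('b)}. u x \<noteq> 0" "(\<Sum>x\<in>w ` {..DIM('b)}. u x *\<^sub>R x) = 0"
    using real_vector.dependent_finite[of "w ` {..DIM('b)}"] by auto
  then show ?thesis
    using that[of "u \<circ> w"] True by (auto simp: sum.reindex)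
next
  case False
  then obtain i j where ij: "i \<le> DIM('b)" "j \<le> DIM('b)" "i \<noteq> j" "w i = w j"
    by (auto simp: inj_on_def)
  define c :: "nat \<Rightarrow> real" where "c k = (if k = i then 1 else if k = j then -1 else 0)" for k
  have "(\<Sum>k\<le>DIM('b). c k *\<^sub>R w k) = (\<Sum>k\<in>{i, j}. c k *\<^sub>R w k)"
    by (rule sum.mono_neutral_right) (use ij in \<open>auto simp: c_def\<close>)
  also have "\<dots> = 0" using ij by (simp add: c_def)
  finally have "(\<Sum>k\<le>DIM('b). c k *\<^sub>R w k) = 0" .
  moreover have "\<exists>i\<le>DIM('b). c i \<noteq> 0" using ij(1) by (intro exI[of _ i]) (simp add: c_def)
  ultimately show ?thesis by (intro that)
qed

lemma annihilating_polynomial: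
  fixes M :: "complex^'n^'n"
  obtains p where "p \<noteq> 0" "poly_act p M v = 0"
proof -
  obtain c where c: "\<exists>i\<le>DIM(complex^'n). c i \<noteq> 0"
      "(\<Sum>i\<le>DIM(complex^'n). c i *\<^sub>R (((*v) M) ^^ i) v) = 0"
    by (rule real_linear_relation[of "\<lambda>i. (((*v) M) ^^ i) v"])
  define p where "p = (\<Sum>i\<le>DIM(complex^'n). monom (complex_of_real (c i)) i)"
  have "coeff p i = (if i \<le> DIM(complex^'n) then complex_of_real (c i) else 0)" for i
    unfolding p_def by (simp add: coeff_sum if_distrib cong: if_cong)
  then have "p \<noteq> 0" using c(1) by (metis coeff_0 of_real_eq_0_iff)
  moreover have "poly_act p M v = 0"
  proof -
    have "complex_of_real r *s x = r *\<^sub>R x" for r and x :: "complex^'n"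
      by (simp add: vec_eq_iff scaleR_conv_of_real[of r "x $ _"])
    then show ?thesis using c(2) by (simp add: p_def poly_act_sum poly_act_monom)
  qed
  ultimately show ?thesis using that by blast
qed

lemma norm_scalar_mult: "norm (z *s v) = norm z * norm (v :: 'a::real_normed_field^'n)"
  by (simp add: norm_vec_def norm_mult L2_set_right_distrib)

lemma perturbed_geometric_tendsto_0:
  fixes a :: "nat \<Rightarrow> real"
  assumes r: "0 \<le> r" "r < 1" and a0: "\<And>k. 0 \<le> a k" and b: "b \<longlonglongrightarrow> 0"
    and rec: "\<And>k. a (Suc k) \<le> r * a k + b k"
  shows "a \<longlonglongrightarrow> 0"
proof (rule LIMSEQ_I)
  fix e :: real assume "e > 0"
  then have "e / 2 * (1 - r) > 0" using r by simp
  from LIMSEQ_D[OF b this] obtain K where K: "\<And>k. k \<ge> K \<Longrightarrow> \<bar>b k\<bar> < e / 2 * (1 - r)" by auto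
  have step: "a (K + j) \<le> r ^ j * a K + e / 2" for j
  proof (induction j)
    case 0
    then show ?case using \<open>e > 0\<close> by simp
  next
    case (Suc j)
    have "a (K + Suc j) \<le> r * a (K + j) + b (K + j)" using rec[of "K + j"] by simp
    also have "\<dots> \<le> r * (r ^ j * a K + e / 2) + e / 2 * (1 - r)"
      using K[of "K + j"] by (intro add_mono mult_left_mono Suc r) auto
    finally show ?case by (simp add: algebra_simps diff_divide_distrib)
  qed
  have "(\<lambda>j. r ^ j * a K) \<longlonglongrightarrow> 0"
    using LIMSEQ_power_zero[of r] r by (intro tendsto_mult_left_zero) simp
  from LIMSEQ_D[OF this half_gt_zero[OF \<open>e > 0\<close>]]
  obtain J where J: "\<And>j. j \<ge> J \<Longrightarrow> \<bar>r ^ j * a K\<bar> < e / 2" by auto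
  show "\<exists>n0. \<forall>n\<ge>n0. norm (a n - 0) < e"
  proof (intro exI allI impI)
    fix n assume "n \<ge> K + J"
    then obtain j where j: "n = K + j" "j \<ge> J" by (metis add.assoc le_Suc_ex le_add1)
    then show "norm (a n - 0) < e" using step[of j] J[of j] a0[of n] by simp
  qed
qed

text \<open>
  Induction on the degree of a polynomial \<open>p \<noteq> 0\<close> with \<open>p(M) v = 0\<close>. Split off a root, \<open>p = (X - z) q\<close>; then
  \<open>u = (M - z) v\<close> is annihilated by \<open>q\<close>, so \<open>M\<^sup>k u\<close> tends to \<open>0\<close>. If \<open>|z| < 1\<close>, the recursion
  \<open>M\<^sup>k\<^sup>+\<^sup>1 v = z M\<^sup>k v + M\<^sup>k u\<close> makes \<open>M\<^sup>k v\<close> tend to \<open>0\<close>. Otherwise \<open>z\<close> is not an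
  eigenvalue, \<open>M - z\<close> is injective, and its inverse, which commutes with \<open>M\<close>, carries \<open>M\<^sup>k u\<close> to \<open>M\<^sup>k v\<close>.
\<close>

lemma matrix_power_orbit_tendsto_0:
  fixes M :: "complex^'n^'n"
  assumes spec: "\<And>z v. v \<noteq> 0 \<Longrightarrow> M *v v = z *s v \<Longrightarrow> norm z < 1"
  shows "(\<lambda>k. (((*v) M) ^^ k) v) \<longlonglongrightarrow> 0"
proof -
  have main: "(\<lambda>k. (((*v) M) ^^ k) v) \<longlonglongrightarrow> 0"
    if "p \<noteq> 0" "poly_act p M v = 0" for p v
    using that
  proof (induction "degree p" arbitrary: p v rule: less_induct)
    case less
    show ?case
    proof (cases "degree p = 0")
      case True
      then obtain c where "p = [:c:]" by (metis degree_eq_zeroE)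
      with less.prems have "v = 0" by (simp add: poly_act_pCons poly_act_0)
      moreover have "(((*v) M) ^^ k) 0 = 0" for k by (induction k) simp_all
      ultimately show ?thesis by simp
    next
      case False
      then obtain z where "poly p z = 0"
        using alg_closed_imp_poly_has_root[of p] by (metis constant_degree fundamental_theorem_of_algebra)
      then obtain q where q: "p = [:- z, 1:] * q" by (metis dvdE poly_eq_0_iff_dvd)
      define u where "u = M *v v - z *s v"
      have "q \<noteq> 0" using less.prems q by auto
      moreover have "degree q < degree p"
        using \<open>q \<noteq> 0\<close> unfolding q by (subst degree_mult_eq) auto
      moreover have "poly_act q M u = 0"
        using less.prems(2) unfolding q poly_act_linear_factor_mult u_def .
      ultimately have lim: "(\<lambda>k. (((*v) M) ^^ k) u) \<longlonglongrightarrow> 0" using less.hyps by blast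
      have pow_u: "(((*v) M) ^^ k) u = M *v (((*v) M) ^^ k) v - z *s (((*v) M) ^^ k) v" for k
        by (induction k) (simp_all add: u_def matrix_vector_mult_diff_distrib vec.scale)
      show ?thesis
      proof (cases "norm z < 1")
        case True
        have "(\<lambda>k. norm ((((*v) M) ^^ k) v)) \<longlonglongrightarrow> 0"
        proof (rule perturbed_geometric_tendsto_0[OF _ True])
          show "(\<lambda>k. norm ((((*v) M) ^^ k) u)) \<longlonglongrightarrow> 0" using lim by (rule tendsto_norm_zero)
          fix k
          have "(((*v) M) ^^ Suc k) v = z *s (((*v) M) ^^ k) v + (((*v) M) ^^ k) u"
            by (simp add: pow_u)
          then show "norm ((((*v) M) ^^ Suc k) v) \<le> norm z * norm ((((*v) M) ^^ k) v) + norm ((((*v) M) ^^ k) u)"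
            using norm_triangle_ineq[of "z *s (((*v) M) ^^ k) v" "(((*v) M) ^^ k) u"]
            by (simp add: norm_scalar_mult)
        qed auto
        then show ?thesis by (rule tendsto_norm_zero_cancel)
      next
        case False
        define f where "f x = M *v x - z *s x" for x
        have "linear ((*v) M)" by simp
        then have "linear f"
          by (intro linearI) (simp_all add: f_def linear_add linear_scale vec_eq_iff algebra_simps)
        moreover have "inj f"
          unfolding linear_injective_0[OF \<open>linear f\<close>] using spec[of _ z] False by (auto simp: f_def)
        ultimately obtain g where g: "linear g" "g \<circ> f = id" using linear_injective_left_inverse by blast
        have "(((*v) M) ^^ k) v = g ((((*v) M) ^^ k) u)" for k
          unfolding pow_u using pointfree_idE[OF g(2), of "(((*v) M) ^^ k) v"] by (simp only: f_def)
        moreover have "bounded_linear g" using g(1) by (simp add: linear_conv_bounded_linear)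
        then have "(\<lambda>k. g ((((*v) M) ^^ k) u)) \<longlonglongrightarrow> g 0" using lim by (rule bounded_linear.tendsto)
        ultimately show ?thesis unfolding linear_0[OF g(1)] by presburger
      qed
    qed
  qed
  obtain p where "p \<noteq> 0" "poly_act p M v = 0" by (rule annihilating_polynomial)
  then show ?thesis by (rule main)
qed

definition vec_to_complex :: "'a::real_or_complex^'n \<Rightarrow> complex^'n"
  where "vec_to_complex v = (\<chi> i. to_complex (v $ i))"

definition matrix_to_complex :: "'a::real_or_complex^'n^'m \<Rightarrow> complex^'n^'m"
  where "matrix_to_complex J = (\<chi> i j. to_complex (J $ i $ j))"

lemma linear_to_complex: "linear to_complex"
  by (rule linearI) (simp_all add: to_complex_add to_complex_scaleR)

lemma linear_vec_to_complex: "linear vec_to_complex"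
  by (rule linearI) (simp_all add: vec_to_complex_def vec_eq_iff to_complex_add to_complex_scaleR)

lemma norm_vec_to_complex: "norm (vec_to_complex v) = norm v"
  by (simp add: norm_vec_def vec_to_complex_def norm_to_complex)

lemma to_complex_sum: "to_complex (\<Sum>i\<in>I. f i) = (\<Sum>i\<in>I. to_complex (f i))"
  by (induction I rule: infinite_finite_induct) (simp_all add: to_complex_add linear_0[OF linear_to_complex])

lemma vec_to_complex_mult: "vec_to_complex (J *v v) = matrix_to_complex J *v vec_to_complex v"
proof -
  have "to_complex (\<Sum>j\<in>UNIV. J $ i $ j * v $ j) = (\<Sum>j\<in>UNIV. to_complex (J $ i $ j) * to_complex (v $ j))" for i
    by (simp only: to_complex_sum to_complex_mult)
  then show ?thesis
    by (simp add: vec_eq_iff vec_to_complex_def matrix_to_complex_def matrix_vector_mult_def)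
qed

lemma orbit_tendsto_0_if_eigenvalues_in_disc:
  assumes "complex_eigenvalues J \<subseteq> {z. norm z < 1}"
  shows "(\<lambda>k. (((*v) J) ^^ k) v) \<longlonglongrightarrow> 0"
proof -
  have "(\<lambda>k. (((*v) (matrix_to_complex J)) ^^ k) (vec_to_complex v)) \<longlonglongrightarrow> 0"
  proof (rule matrix_power_orbit_tendsto_0)
    fix z w assume "w \<noteq> 0" "matrix_to_complex J *v w = z *s w"
    then have "z \<in> complex_eigenvalues J"
      unfolding complex_eigenvalues_def matrix_to_complex_def by (intro CollectI exI[of _ w] conjI)
    then show "norm z < 1" using assms by blast
  qed
  moreover have "(((*v) (matrix_to_complex J)) ^^ k) (vec_to_complex v) = vec_to_complex ((((*v) J) ^^ k) v)" for k
    by (induction k) (simp_all add: vec_to_complex_mult)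
  ultimately have "(\<lambda>k. vec_to_complex ((((*v) J) ^^ k) v)) \<longlonglongrightarrow> 0" by simp
  then have "(\<lambda>k. norm ((((*v) J) ^^ k) v)) \<longlonglongrightarrow> 0"
    by (subst norm_vec_to_complex[symmetric]) (rule tendsto_norm_zero)
  then show ?thesis by (rule tendsto_norm_zero_cancel)
qed

lemma linear_funpow:
  fixes f :: "'b::real_vector \<Rightarrow> 'b"
  assumes "linear f"
  shows "linear (f ^^ k)"
proof -
  have add: "(f ^^ k) (x + y) = (f ^^ k) x + (f ^^ k) y" for x y
    by (induction k) (simp_all add: linear_add[OF assms])
  have scale: "(f ^^ k) (c *\<^sub>R x) = c *\<^sub>R (f ^^ k) x" for c x
    by (induction k) (simp_all add: linear_scale[OF assms])
  show ?thesis by (rule linearI) (simp_all add: add scale)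
qed

lemma eventually_half_contraction:
  fixes f :: "'b::euclidean_space \<Rightarrow> 'b"
  assumes "linear f" and lim: "\<And>v. (\<lambda>k. (f ^^ k) v) \<longlonglongrightarrow> 0"
  obtains N where "N > 0" "\<And>v. norm ((f ^^ N) v) \<le> norm v / 2"
proof -
  have lin: "linear (f ^^ k)" for k by (rule linear_funpow[OF \<open>linear f\<close>])
  have "(\<lambda>k. \<Sum>b\<in>Basis. norm ((f ^^ k) b)) \<longlonglongrightarrow> 0"
    by (intro tendsto_null_sum tendsto_norm_zero lim)
  from LIMSEQ_D[OF this, of "1/2"] obtain n0 where
    n0: "\<And>n. n \<ge> n0 \<Longrightarrow> \<bar>\<Sum>b\<in>Basis. norm ((f ^^ n) b)\<bar> < 1/2" by auto
  define N where "N = Suc n0"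
  have "norm ((f ^^ N) v) \<le> norm v / 2" for v
  proof -
    have "norm ((f ^^ N) v) = norm (\<Sum>b\<in>Basis. (v \<bullet> b) *\<^sub>R (f ^^ N) b)"
      using linear_sum[OF lin[of N], of "\<lambda>b. (v \<bullet> b) *\<^sub>R b" Basis]
      by (simp add: euclidean_representation linear_scale[OF lin])
    also have "\<dots> \<le> (\<Sum>b\<in>Basis. norm v * norm ((f ^^ N) b))"
      by (rule order_trans[OF norm_sum]) (auto intro!: sum_mono mult_right_mono simp: Basis_le_norm)
    also have "\<dots> = norm v * (\<Sum>b\<in>Basis. norm ((f ^^ N) b))" by (simp add: sum_distrib_left)
    also have "\<dots> \<le> norm v * (1/2)" using n0[of N] by (intro mult_left_mono) (auto simp: N_def)
    finally show ?thesis by simp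
  qed
  then show ?thesis using that[of N] by (simp add: N_def)
qed

text \<open>
  Choose \<open>N\<close> with \<open>\<parallel>f\<^sup>N v\<parallel> \<le> \<parallel>v\<parallel>/2\<close> and \<open>\<rho>\<close> with \<open>\<rho>\<^sup>N = 1/4\<close>. In
  \<open>\<beta>(v, v) = \<Sum>k<N. \<rho>\<^sup>-\<^sup>k \<parallel>f\<^sup>k v\<parallel>\<^sup>2\<close> replacing \<open>v\<close> by \<open>f v\<close> shifts the sum: it is multiplied
  by \<open>\<rho>\<close>, loses the term for \<open>k = 0\<close>, which is \<open>\<parallel>v\<parallel>\<^sup>2\<close>, and gains the one for \<open>k = N\<close>, which is
  \<open>4 \<parallel>f\<^sup>N v\<parallel>\<^sup>2 \<le> \<parallel>v\<parallel>\<^sup>2\<close>.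
\<close>

lemma contractive_inner_product:
  fixes f :: "'b::euclidean_space \<Rightarrow> 'b"
  assumes "linear f" and lim: "\<And>v. (\<lambda>k. (f ^^ k) v) \<longlonglongrightarrow> 0"
  obtains \<beta> :: "'b \<Rightarrow> 'b \<Rightarrow> real" and \<rho> where "bounded_bilinear \<beta>" "\<And>u v. \<beta> u v = \<beta> v u"
    "0 < \<rho>" "\<rho> < 1" "\<And>v. \<beta> (f v) (f v) \<le> \<rho> * \<beta> v v" "\<And>v. (norm v)\<^sup>2 \<le> \<beta> v v"
proof -
  obtain N where N: "N > 0" "\<And>v. norm ((f ^^ N) v) \<le> norm v / 2"
    using eventually_half_contraction[OF assms] by blast
  have lin: "linear (f ^^ k)" for k by (rule linear_funpow[OF \<open>linear f\<close>])
  define \<rho> :: real where "\<rho> = root N (1/4)"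
  have \<rho>: "0 < \<rho>" "\<rho> < 1" "\<rho> ^ N = 1/4" using N(1) by (simp_all add: \<rho>_def)
  define \<beta> where "\<beta> u v = (\<Sum>k<N. (1 / \<rho>) ^ k * ((f ^^ k) u \<bullet> (f ^^ k) v))" for u v
  have "bounded_bilinear \<beta>"
    unfolding bilinear_conv_bounded_bilinear[symmetric] bilinear_def \<beta>_def
    by (intro conjI allI linearI)
      (simp_all add: linear_add[OF lin] linear_scale[OF lin] inner_add_left inner_add_right
        distrib_left sum.distrib sum_distrib_left mult_ac)
  moreover have "\<beta> u v = \<beta> v u" for u v by (simp add: \<beta>_def inner_commute)
  moreover have "\<beta> (f v) (f v) \<le> \<rho> * \<beta> v v" for v
  proof -
    define a where "a k = (1 / \<rho>) ^ k * ((f ^^ k) v \<bullet> (f ^^ k) v)" for k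
    have "\<beta> (f v) (f v) = (\<Sum>k<N. \<rho> * a (Suc k))"
      using \<rho>(1) by (simp add: \<beta>_def a_def funpow_swap1)
    also have "\<dots> = \<rho> * (\<Sum>k<N. a (Suc k))" by (simp only: sum_distrib_left)
    also have "(\<Sum>k<N. a (Suc k)) = \<beta> v v + a N - a 0"
      using sum.lessThan_Suc_shift[of a N] sum.lessThan_Suc[of a N] by (simp add: \<beta>_def a_def)
    also have "a N \<le> a 0"
    proof -
      have "(norm ((f ^^ N) v))\<^sup>2 \<le> (norm v / 2)\<^sup>2" using N(2) by (intro power_mono) auto
      moreover have "(1 / \<rho>) ^ N = 4" unfolding power_one_over \<rho>(3) by simp
      ultimately show ?thesis by (simp add: a_def power_divide power2_norm_eq_inner)
    qed
    finally show ?thesis using \<rho>(1) by (simp add: mult_left_mono)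
  qed
  moreover have "(norm v)\<^sup>2 \<le> \<beta> v v" for v
  proof -
    have "(norm v)\<^sup>2 = (\<Sum>k\<in>{0}. (1 / \<rho>) ^ k * ((f ^^ k) v \<bullet> (f ^^ k) v))"
      by (simp add: power2_norm_eq_inner)
    also have "\<dots> \<le> \<beta> v v"
      unfolding \<beta>_def using N(1) \<rho>(1) by (intro sum_mono2) auto
    finally show ?thesis .
  qed
  ultimately show ?thesis using that[of \<beta> \<rho>] \<rho> by blast
qed

text \<open>
  An eigenvalue \<open>z\<close> of \<open>J\<close> is also one of the transpose, so there is a complex linear functional \<open>l \<noteq> 0\<close>
  with \<open>l(J v) = z l(v)\<close>, and \<open>|l(v)|\<^sup>2\<close> is the form sought. Working with a functional rather than an
  eigenvector treats real and complex scalars alike: a complex eigenvector need not lie in the real coordinate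
  space, but a complex functional can be evaluated on it.
\<close>

lemma expansive_semi_inner_product:
  fixes J :: "'a::real_or_complex^'n^'n"
  assumes "\<not> complex_eigenvalues J \<subseteq> {z. norm z < 1}"
  obtains \<beta> :: "'a^'n \<Rightarrow> 'a^'n \<Rightarrow> real" and v0 where "bounded_bilinear \<beta>" "\<forall>u v. \<beta> u v = \<beta> v u"
    "\<forall>v. \<beta> v v \<le> \<beta> (J *v v) (J *v v)" "0 < \<beta> v0 v0"
proof -
  let ?J = "matrix_to_complex J"
  obtain z where z1: "z \<in> complex_eigenvalues J" "z \<notin> {z. norm z < 1}"
    using assms by blast
  obtain v where z: "v \<noteq> 0" "?J *v v = z *s v"
    using z1(1) unfolding complex_eigenvalues_def mem_Collect_eq matrix_to_complex_def[symmetric]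
    by (elim exE conjE) (rule that)
  have norm_z: "norm z \<ge> 1" using z1(2) by simp
  define S where "S = ?J - mat z"
  have mat: "mat z *v w = z *s w" for w :: "complex^'n"
    by (simp add: vec_eq_iff matrix_vector_mult_def mat_def if_distrib[of "\<lambda>x. x * _"] cong: if_cong)
  have "S *v v = 0" using z by (simp add: S_def matrix_vector_mult_diff_rdistrib mat)
  then have "\<not> invertible S" using z(1) by (metis invertible_left_inverse matrix_left_invertible_ker)
  then have "\<not> invertible (transpose S)" by (simp add: invertible_det_nz)
  then obtain y where y: "y \<noteq> 0" "transpose S *v y = 0"
    by (metis invertible_left_inverse matrix_left_invertible_ker)
  define l where "l w = (\<Sum>i\<in>UNIV. y $ i * w $ i)" for w :: "complex^'n"
  have "l (S *v w) = 0" for w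
  proof -
    have "l (S *v w) = (\<Sum>i\<in>UNIV. \<Sum>j\<in>UNIV. y $ i * (S $ i $ j * w $ j))"
      by (simp add: l_def matrix_vector_mult_def sum_distrib_left)
    also have "\<dots> = (\<Sum>j\<in>UNIV. \<Sum>i\<in>UNIV. y $ i * (S $ i $ j * w $ j))" by (rule sum.swap)
    also have "\<dots> = (\<Sum>j\<in>UNIV. (transpose S *v y) $ j * w $ j)"
      by (simp add: matrix_vector_mult_def transpose_def sum_distrib_left sum_distrib_right mult_ac)
    finally show ?thesis by (simp only: y(2) zero_index mult_zero_left sum.neutral_const)
  qed
  moreover have "l (S *v w) = l (?J *v w) - z * l w" for w
    by (simp add: S_def matrix_vector_mult_diff_rdistrib mat l_def sum_subtractf sum_distrib_left algebra_simps)
  ultimately have l: "l (?J *v w) = z * l w" for w by simp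
  have "linear l"
    by (rule linearI) (simp_all add: l_def sum.distrib scaleR_sum_right algebra_simps)
  then have lin: "bounded_linear (\<lambda>v. l (vec_to_complex v))"
    using linear_compose[OF linear_vec_to_complex \<open>linear l\<close>] by (simp add: linear_conv_bounded_linear o_def)
  define \<beta> where "\<beta> u v = l (vec_to_complex u) \<bullet> l (vec_to_complex v)" for u v :: "'a^'n"
  have "bounded_bilinear \<beta>"
    unfolding \<beta>_def by (rule bounded_bilinear.comp[OF bounded_bilinear_inner lin lin])
  moreover have "\<beta> u v = \<beta> v u" for u v by (simp add: \<beta>_def inner_commute)
  moreover have "\<beta> v v \<le> \<beta> (J *v v) (J *v v)" for v
  proof -
    have "\<beta> (J *v v) (J *v v) = (norm z)\<^sup>2 * \<beta> v v"
      by (simp add: \<beta>_def vec_to_complex_mult l power2_norm_eq_inner[symmetric] norm_mult power_mult_distrib)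
    moreover have "1 * \<beta> v v \<le> (norm z)\<^sup>2 * \<beta> v v"
      using norm_z by (intro mult_right_mono) (auto simp: \<beta>_def)
    ultimately show ?thesis by simp
  qed
  moreover obtain i where "y $ i \<noteq> 0" using y(1) by (auto simp: vec_eq_iff)
  then have "0 < \<beta> (axis i 1) (axis i 1)"
    by (simp add: \<beta>_def l_def vec_to_complex_def axis_def if_distrib[of to_complex] if_distrib[of "\<lambda>x. _ * x"]
      to_complex_one linear_0[OF linear_to_complex] cong: if_cong)
  ultimately show ?thesis using that by blast
qed

section \<open>Square-integrable functions\<close>

lemma represents_exists: obtains f where "represents f x"
proof -
  have "\<exists>f. represents f x"
    by (induction x rule: L2.abs_induct) (auto simp: represents_def L2_eq_def)
  then show ?thesis using that by blast
qed

lemma L2_eq_refl: "square_integrable f \<Longrightarrow> L2_eq f f"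
  by (simp add: L2_eq_def)

lemma representsD:
  assumes "represents f x"
  shows "square_integrable f" "f \<in> borel_measurable leb01" "integrable leb01 (\<lambda>\<xi>. (norm (f \<xi>))\<^sup>2)"
  using assms by (auto simp: represents_def square_integrable_def)

lemma represents_AE_unique:
  assumes "represents f x" "represents g x"
  shows "AE \<xi> in leb01. f \<xi> = g \<xi>"
proof -
  have "L2_eq f g"
    using assms by (subst Quotient3_rel[OF Quotient3_L2, symmetric]) (simp add: represents_def L2_eq_refl)
  then show ?thesis by (simp add: L2_eq_def)
qed

lemma represents_add:
  "represents f x \<Longrightarrow> represents g y \<Longrightarrow> represents (\<lambda>\<xi>. f \<xi> + g \<xi>) (x + y)"
  by (auto simp: represents_def plus_L2.abs_eq L2_eq_refl square_integrable_add)

lemma represents_diff: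
  "represents f x \<Longrightarrow> represents g y \<Longrightarrow> represents (\<lambda>\<xi>. f \<xi> - g \<xi>) (x - y)"
  by (auto simp: represents_def minus_L2.abs_eq L2_eq_refl square_integrable_diff)

lemma represents_scaleR:
  "represents f x \<Longrightarrow> represents (\<lambda>\<xi>. c *\<^sub>R f \<xi>) (c *\<^sub>R x)"
  by (auto simp: represents_def scaleR_L2.abs_eq L2_eq_refl square_integrable_scaleR)

lemma represents_norm:
  "represents f x \<Longrightarrow> (norm x)\<^sup>2 = (LINT \<xi>|leb01. (norm (f \<xi>))\<^sup>2)"
  by (auto simp: represents_def norm_L2.abs_eq L2_eq_refl)

lemma square_integrable_bound:
  fixes f :: "real \<Rightarrow> 'b::euclidean_space" and g :: "real \<Rightarrow> 'c::euclidean_space"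
  assumes g: "g \<in> borel_measurable leb01" and f: "square_integrable f"
    and bound: "AE \<xi> in leb01. norm (g \<xi>) \<le> c * norm (f \<xi>)"
  shows "square_integrable g"
proof -
  have "integrable leb01 (\<lambda>\<xi>. c\<^sup>2 * (norm (f \<xi>))\<^sup>2)"
    using f by (simp add: square_integrable_def)
  then have "integrable leb01 (\<lambda>\<xi>. (norm (g \<xi>))\<^sup>2)"
  proof (rule Bochner_Integration.integrable_bound)
    show "(\<lambda>\<xi>. (norm (g \<xi>))\<^sup>2) \<in> borel_measurable leb01" using g by measurable
    show "AE \<xi> in leb01. norm ((norm (g \<xi>))\<^sup>2) \<le> norm (c\<^sup>2 * (norm (f \<xi>))\<^sup>2)"
      using bound
    proof eventually_elim
      case (elim \<xi>)
      then have "(norm (g \<xi>))\<^sup>2 \<le> (c * norm (f \<xi>))\<^sup>2" by (intro power_mono) auto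
      then show ?case by (simp add: power_mult_distrib)
    qed
  qed
  with g show ?thesis by (simp add: square_integrable_def)
qed

lemma represents_norm_le:
  fixes f :: "real \<Rightarrow> 'b::euclidean_space" and g :: "real \<Rightarrow> 'c::euclidean_space"
  assumes f: "represents f x" and g: "represents g y" and "0 \<le> c"
    and bound: "AE \<xi> in leb01. norm (f \<xi>) \<le> c * norm (g \<xi>)"
  shows "norm x \<le> c * norm y"
proof (rule power2_le_imp_le)
  have "(norm x)\<^sup>2 \<le> (LINT \<xi>|leb01. c\<^sup>2 * (norm (g \<xi>))\<^sup>2)"
    unfolding represents_norm[OF f]
  proof (rule integral_mono_AE)
    show "AE \<xi> in leb01. (norm (f \<xi>))\<^sup>2 \<le> c\<^sup>2 * (norm (g \<xi>))\<^sup>2"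
      using bound
    proof eventually_elim
      case (elim \<xi>)
      then have "(norm (f \<xi>))\<^sup>2 \<le> (c * norm (g \<xi>))\<^sup>2" by (intro power_mono) auto
      then show ?case by (simp add: power_mult_distrib)
    qed
  qed (use representsD[OF f] representsD[OF g] in auto)
  then show "(norm x)\<^sup>2 \<le> (c * norm y)\<^sup>2"
    using represents_norm[OF g] by (simp add: power_mult_distrib)
qed (use \<open>0 \<le> c\<close> in simp)

lemma bounded_imp_square_integrable:
  fixes f :: "real \<Rightarrow> 'b::euclidean_space"
  assumes "f \<in> borel_measurable leb01" "AE \<xi> in leb01. norm (f \<xi>) \<le> c"
  shows "square_integrable f"
proof (rule square_integrable_bound[OF assms(1)])
  show "square_integrable (\<lambda>\<xi>. 1 :: real)"
    by (simp add: square_integrable_def integrable_const_ivl)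
  show "AE \<xi> in leb01. norm (f \<xi>) \<le> c * norm (1 :: real)" using assms(2) by simp
qed

lemma continuous_imp_square_integrable:
  fixes f :: "real \<Rightarrow> 'b::euclidean_space"
  assumes "continuous_on {0..1} f"
  shows "square_integrable f"
proof -
  have "bounded (f ` {0..1})" using assms by (intro compact_imp_bounded compact_continuous_image) auto
  then obtain c where "\<And>\<xi>. \<xi> \<in> {0..1} \<Longrightarrow> norm (f \<xi>) \<le> c" unfolding bounded_iff by blast
  then show ?thesis
    using assms by (intro bounded_imp_square_integrable[of f c])
      (auto intro!: AE_I2 continuous_imp_measurable_on_sets_lebesgue)
qed

text \<open>
  The form in which dominated convergence produces all the approximations in the density lemmas below.
\<close>

lemma L2_tendsto_dominated:
  fixes F :: "real \<Rightarrow> 'b::euclidean_space"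
  assumes F: "represents F x" and G: "\<And>n. represents (G n) (X n)"
    and lim: "AE \<xi> in leb01. (\<lambda>n. G n \<xi>) \<longlonglongrightarrow> F \<xi>"
    and B: "square_integrable (B :: real \<Rightarrow> real)" "\<And>n. AE \<xi> in leb01. norm (G n \<xi>) \<le> B \<xi>"
  shows "X \<longlonglongrightarrow> x"
proof -
  have "AE \<xi> in leb01. \<forall>n. norm (G n \<xi>) \<le> B \<xi>" using B(2) by (simp add: AE_all_countable)
  then have dist: "AE \<xi> in leb01. \<forall>n. norm (G n \<xi> - F \<xi>) \<le> 2 * B \<xi>"
    using lim
  proof eventually_elim
    case (elim \<xi>)
    then have "norm (F \<xi>) \<le> B \<xi>"
      by (intro tendsto_upperbound[OF tendsto_norm[OF elim(2)]]) auto
    then show ?case using elim(1) norm_triangle_ineq4[of "G _ \<xi>" "F \<xi>"] by (smt (verit))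
  qed
  note [measurable] = representsD(2)[OF F] representsD(2)[OF G]
  have "(\<lambda>n. LINT \<xi>|leb01. (norm (G n \<xi> - F \<xi>))\<^sup>2) \<longlonglongrightarrow> (LINT \<xi>|leb01. 0)"
  proof (rule integral_dominated_convergence)
    show "integrable leb01 (\<lambda>\<xi>. 4 * (B \<xi>)\<^sup>2)" using B(1) by (simp add: square_integrable_def)
    show "AE \<xi> in leb01. (\<lambda>n. (norm (G n \<xi> - F \<xi>))\<^sup>2) \<longlonglongrightarrow> 0"
      using lim
    proof eventually_elim
      case (elim \<xi>)
      then have "(\<lambda>n. norm (G n \<xi> - F \<xi>)) \<longlonglongrightarrow> 0" by (intro tendsto_norm_zero LIM_zero)
      from tendsto_power[OF this, of 2] show ?case by simp
    qed
    show "AE \<xi> in leb01. norm ((norm (G n \<xi> - F \<xi>))\<^sup>2) \<le> 4 * (B \<xi>)\<^sup>2" for n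
      using dist
    proof eventually_elim
      case (elim \<xi>)
      then have "(norm (G n \<xi> - F \<xi>))\<^sup>2 \<le> (2 * B \<xi>)\<^sup>2" by (intro power_mono) auto
      then show ?case by (simp add: power_mult_distrib)
    qed
  qed measurable
  then have "(\<lambda>n. (norm (X n - x))\<^sup>2) \<longlonglongrightarrow> 0"
    by (simp add: represents_norm[OF represents_diff[OF G F]])
  from tendsto_real_sqrt[OF this] have "(\<lambda>n. norm (X n - x)) \<longlonglongrightarrow> 0" by simp
  then show ?thesis by (simp add: tendsto_norm_zero_iff LIM_zero_iff)
qed

lemma closure_sequentialI:
  fixes x :: "'a::real_normed_vector"
  shows "(\<And>n. X n \<in> S) \<Longrightarrow> X \<longlonglongrightarrow> x \<Longrightarrow> x \<in> closure S"
  by (auto simp: closure_sequential)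

text \<open>
  Radial retraction onto the ball of radius \<open>R\<close>.
\<close>

definition truncate :: "real \<Rightarrow> 'b::real_normed_vector \<Rightarrow> 'b"
  where "truncate R v = (R / max R (norm v)) *\<^sub>R v"

lemma norm_truncate: "R > 0 \<Longrightarrow> norm (truncate R v) \<le> R"
  by (auto simp: truncate_def max_def divide_simps)

lemma norm_truncate_le: "R > 0 \<Longrightarrow> norm (truncate R v) \<le> norm v"
  by (auto simp: truncate_def max_def divide_simps mult_right_mono)

lemma truncate_eq: "norm v \<le> R \<Longrightarrow> R > 0 \<Longrightarrow> truncate R v = v"
  by (simp add: truncate_def max_def)

lemma continuous_truncate: "R > 0 \<Longrightarrow> continuous_on UNIV (truncate R)"
  unfolding truncate_def by (intro continuous_intros) (auto simp: max_def)

lemma borel_measurable_truncate [measurable]: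
  "R > 0 \<Longrightarrow> truncate R \<in> borel_measurable borel"
  by (rule borel_measurable_continuous_onI[OF continuous_truncate])

lemma bounded_functions_dense:
  "closure {x :: 'b::euclidean_space L2. \<exists>f R. R > 0 \<and> represents f x \<and> (\<forall>\<xi>. norm (f \<xi>) \<le> R)} = UNIV"
  (is "closure ?S = _")
proof -
  have "x \<in> closure ?S" for x
  proof -
    obtain f where f: "represents f x" by (rule represents_exists)
    note [measurable] = representsD(2)[OF f]
    define G where "G n \<xi> = truncate (real (Suc n)) (f \<xi>)" for n \<xi>
    have [measurable]: "G n \<in> borel_measurable leb01" for n
      unfolding G_def by (rule measurable_compose[OF representsD(2)[OF f]]) simp
    have "square_integrable (G n)" for n
      by (rule square_integrable_bound[OF _ representsD(1)[OF f], of _ 1]) (auto simp: G_def norm_truncate_le)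
    then have rep: "represents (G n) (abs_L2 (G n))" for n by (simp add: represents_def)
    have "(\<lambda>n. abs_L2 (G n)) \<longlonglongrightarrow> x"
    proof (rule L2_tendsto_dominated[OF f rep])
      show "square_integrable (\<lambda>\<xi>. norm (f \<xi>))"
        by (rule square_integrable_bound[OF _ representsD(1)[OF f], of _ 1]) auto
      show "AE \<xi> in leb01. norm (G n \<xi>) \<le> norm (f \<xi>)" for n by (simp add: G_def norm_truncate_le)
      show "AE \<xi> in leb01. (\<lambda>n. G n \<xi>) \<longlonglongrightarrow> f \<xi>"
      proof (rule AE_I2)
        fix \<xi>
        obtain N where "norm (f \<xi>) \<le> real N" using real_arch_simple by blast
        then have "\<forall>\<^sub>F n in sequentially. G n \<xi> = f \<xi>"
          unfolding eventually_sequentially G_def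
          by (intro exI[of _ N] allI impI truncate_eq) auto
        then show "(\<lambda>n. G n \<xi>) \<longlonglongrightarrow> f \<xi>" by (rule tendsto_eventually)
      qed
    qed
    moreover have "abs_L2 (G n) \<in> ?S" for n
      using rep[of n] by (auto intro!: exI[of _ "G n"] exI[of _ "real (Suc n)"] simp: G_def norm_truncate)
    ultimately show ?thesis by (rule closure_sequentialI[rotated])
  qed
  then show ?thesis by auto
qed

text \<open>
  A measurable function is an almost everywhere limit of continuous functions; for a bounded function these may
  be truncated, so that dominated convergence applies.
\<close>

lemma continuous_functions_dense:
  "closure {x :: 'b::euclidean_space L2. \<exists>f. represents f x \<and> continuous_on {0..1} f} = UNIV"
  (is "closure ?S = _")
proof -
  have "x \<in> closure ?S" if fx: "represents f x" "R > 0" "\<And>\<xi>. norm (f \<xi>) \<le> R" for f R x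
  proof -
    have "f measurable_on {0..1}"
      using representsD(2)[OF fx(1)] by (subst measurable_on_iff_borel_measurable) auto
    then obtain N g where N: "negligible N" and g: "\<And>n. continuous_on UNIV (g n)"
      and lim: "\<And>\<xi>. \<xi> \<notin> N \<Longrightarrow> (\<lambda>n. g n \<xi>) \<longlonglongrightarrow> (if \<xi> \<in> {0..1} then f \<xi> else 0)"
      unfolding measurable_on_def by blast
    define G where "G n \<xi> = truncate R (g n \<xi>)" for n and \<xi> :: real
    have cont: "continuous_on {0..1} (G n)" for n
      unfolding G_def using continuous_on_compose2[OF continuous_truncate[OF fx(2)] g[of n]]
      by (auto intro: continuous_on_subset)
    then have rep: "represents (G n) (abs_L2 (G n))" for n
      by (simp add: represents_def continuous_imp_square_integrable)
    have "(\<lambda>n. abs_L2 (G n)) \<longlonglongrightarrow> x"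
    proof (rule L2_tendsto_dominated[OF fx(1) rep])
      show "square_integrable (\<lambda>\<xi>. R)" by (rule continuous_imp_square_integrable) simp
      show "AE \<xi> in leb01. norm (G n \<xi>) \<le> R" for n using fx(2) by (simp add: G_def norm_truncate)
      have "AE \<xi> in lebesgue. \<xi> \<notin> N"
        using N by (simp add: negligible_iff_null_sets AE_not_in)
      then have "AE \<xi> in lebesgue. \<xi> \<in> {0..1} \<longrightarrow> (\<lambda>n. G n \<xi>) \<longlonglongrightarrow> f \<xi>"
      proof eventually_elim
        case (elim \<xi>)
        have "(\<lambda>n. G n \<xi>) \<longlonglongrightarrow> truncate R (f \<xi>)" if "\<xi> \<in> {0..1}"
          unfolding G_def using lim[OF elim] that continuous_truncate[OF fx(2)]
          by (intro isCont_tendsto_compose[of _ "truncate R"]) (auto simp: continuous_on_eq_continuous_at)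
        then show ?case using truncate_eq[OF fx(3) fx(2)] by simp
      qed
      then show "AE \<xi> in leb01. (\<lambda>n. G n \<xi>) \<longlonglongrightarrow> f \<xi>"
        by (subst AE_restrict_space_iff) auto
    qed
    moreover have "abs_L2 (G n) \<in> ?S" for n using rep[of n] cont[of n] by blast
    ultimately show ?thesis by (rule closure_sequentialI[rotated])
  qed
  then have "closure {x :: 'b L2. \<exists>f R. R > 0 \<and> represents f x \<and> (\<forall>\<xi>. norm (f \<xi>) \<le> R)} \<subseteq> closure ?S"
    by (intro closure_minimal) auto
  then show ?thesis unfolding bounded_functions_dense by auto
qed

lemma polynomial_functions_dense:
  "closure {x :: 'b::euclidean_space L2. \<exists>f. represents f x \<and> polynomial_function f} = UNIV"
  (is "closure ?S = _")
proof -
  have "x \<in> closure ?S" if fx: "represents f x" "continuous_on {0..1} f" for f x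
    unfolding closure_approachable
  proof (intro allI impI)
    fix e :: real assume "e > 0"
    then obtain p where p: "polynomial_function p" "\<And>\<xi>. \<xi> \<in> {0..1} \<Longrightarrow> norm (f \<xi> - p \<xi>) < e / 2"
      using Stone_Weierstrass_polynomial_function[OF _ fx(2), of "e / 2"] by auto
    have rep: "represents p (abs_L2 p)"
      using continuous_on_polymonial_function[OF p(1)]
      by (simp add: represents_def continuous_imp_square_integrable)
    have one: "represents (\<lambda>_. 1 :: real) (abs_L2 (\<lambda>_. 1))"
      by (simp add: represents_def continuous_imp_square_integrable)
    have "(norm (abs_L2 (\<lambda>_. 1 :: real)))\<^sup>2 = 1"
      by (simp add: represents_norm[OF one] measure_restrict_space)
    then have "norm (abs_L2 (\<lambda>_. 1 :: real)) = 1"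
      using norm_ge_zero power2_eq_1_iff by (smt (verit))
    moreover have "norm (abs_L2 p - x) \<le> e / 2 * norm (abs_L2 (\<lambda>_. 1 :: real))"
      using p(2) \<open>e > 0\<close>
      by (intro represents_norm_le[OF represents_diff[OF rep fx(1)] one] AE_I2)
        (auto simp: norm_minus_commute less_imp_le)
    ultimately show "\<exists>y\<in>?S. dist y x < e"
      using rep p(1) \<open>e > 0\<close> by (intro bexI[of _ "abs_L2 p"]) (auto simp: dist_norm)
  qed
  then have "closure {x :: 'b L2. \<exists>f. represents f x \<and> continuous_on {0..1} f} \<subseteq> closure ?S"
    by (intro closure_minimal) auto
  then show ?thesis unfolding continuous_functions_dense by auto
qed

text \<open>
  The factors \<open>1 - (1 - 2 \<xi>)\<^sup>2\<^sup>n\<close> vanish at both ends and tend to \<open>1\<close> in between. Smooth functions that vanish at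
  the ends satisfy every linear homogeneous boundary condition, so they lie in the domain of the
  transport operator up to division by the speed.
\<close>

lemma polynomial_functions_vanishing_at_ends_dense:
  "closure {x :: 'b::euclidean_space L2. \<exists>f. represents f x \<and> polynomial_function f \<and> f 0 = 0 \<and> f 1 = 0} = UNIV"
  (is "closure ?S = _")
proof -
  have "x \<in> closure ?S" if fx: "represents f x" "polynomial_function f" for f x
  proof -
    define G where "G n \<xi> = (1 - ((1 - 2 * \<xi>)\<^sup>2) ^ Suc n) *\<^sub>R f \<xi>" for n \<xi>
    have poly: "polynomial_function (G n)" for n
    proof -
      have "real_polynomial_function (\<lambda>\<xi>. 1 - ((1 - 2 * \<xi>)\<^sup>2) ^ Suc n)"
        by (intro real_polynomial_function_diff real_polynomial_function_power
            real_polynomial_function.intros bounded_linear_mult_right)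
      then have "polynomial_function (\<lambda>\<xi>. 1 - ((1 - 2 * \<xi>)\<^sup>2) ^ Suc n :: real)"
        by (simp only: real_polynomial_function_eq)
      then show ?thesis unfolding G_def using fx(2) by (rule polynomial_function_mult)
    qed
    have unit: "0 \<le> 1 - ((1 - 2 * \<xi>)\<^sup>2) ^ Suc n" "1 - ((1 - 2 * \<xi>)\<^sup>2) ^ Suc n \<le> 1" if "\<xi> \<in> {0..1}" for \<xi> :: real and n
    proof -
      have "(1 - 2 * \<xi>)\<^sup>2 \<le> 1" using that by (intro abs_square_le_1[THEN iffD2]) auto
      then show "0 \<le> 1 - ((1 - 2 * \<xi>)\<^sup>2) ^ Suc n" using power_le_one[of "(1 - 2 * \<xi>)\<^sup>2" "Suc n"] by simp
      show "1 - ((1 - 2 * \<xi>)\<^sup>2) ^ Suc n \<le> 1" by (simp del: power_Suc)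
    qed
    have rep: "represents (G n) (abs_L2 (G n))" for n
      using continuous_on_polymonial_function[OF poly]
      by (simp add: represents_def continuous_imp_square_integrable)
    have "(\<lambda>n. abs_L2 (G n)) \<longlonglongrightarrow> x"
    proof (rule L2_tendsto_dominated[OF fx(1) rep])
      show "square_integrable (\<lambda>\<xi>. norm (f \<xi>))"
        using continuous_on_polymonial_function[OF fx(2)]
        by (intro continuous_imp_square_integrable continuous_intros)
      show "AE \<xi> in leb01. norm (G n \<xi>) \<le> norm (f \<xi>)" for n
      proof (rule AE_I2)
        fix \<xi> assume "\<xi> \<in> space leb01"
        then have "\<xi> \<in> {0..1}" by simp
        then show "norm (G n \<xi>) \<le> norm (f \<xi>)"
          using unit[of \<xi> n] mult_right_mono[OF unit(2)[of \<xi> n] norm_ge_zero[of "f \<xi>"]]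
          by (simp add: G_def del: power_Suc)
      qed
      have "AE \<xi> in lebesgue. \<xi> \<notin> {0, 1 :: real}"
        by (rule AE_not_in) (simp add: negligible_iff_null_sets[symmetric])
      then have "AE \<xi> in lebesgue. \<xi> \<in> {0..1} \<longrightarrow> (\<lambda>n. G n \<xi>) \<longlonglongrightarrow> f \<xi>"
      proof eventually_elim
        case (elim \<xi>)
        have "(\<lambda>n. G n \<xi>) \<longlonglongrightarrow> (1 - 0) *\<^sub>R f \<xi>" if "\<xi> \<in> {0..1}"
        proof -
          have "\<bar>1 - 2 * \<xi>\<bar> < 1" using elim that by (auto simp: abs_if)
          then have "(1 - 2 * \<xi>)\<^sup>2 < 1" by (simp add: abs_square_less_1)
          then have "(\<lambda>n. ((1 - 2 * \<xi>)\<^sup>2) ^ n) \<longlonglongrightarrow> 0" by (intro LIMSEQ_power_zero) simp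
          from LIMSEQ_Suc[OF this] show ?thesis unfolding G_def by (intro tendsto_intros)
        qed
        then show ?case by simp
      qed
      then show "AE \<xi> in leb01. (\<lambda>n. G n \<xi>) \<longlonglongrightarrow> f \<xi>"
        by (subst AE_restrict_space_iff) auto
    qed
    moreover have "abs_L2 (G n) \<in> ?S" for n
      using rep[of n] poly[of n] by (auto intro!: exI[of _ "G n"] simp: G_def)
    ultimately show ?thesis by (rule closure_sequentialI[rotated])
  qed
  then have "closure {x :: 'b L2. \<exists>f. represents f x \<and> polynomial_function f} \<subseteq> closure ?S"
    by (intro closure_minimal) auto
  then show ?thesis unfolding polynomial_functions_dense by auto
qed

lemma represents_rep_L2: "represents (rep_L2 x) x"
  using Quotient3_rep_reflp[OF Quotient3_L2, of x] Quotient3_abs_rep[OF Quotient3_L2, of x]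
  by (simp add: represents_def L2_eq_def)

text \<open>
  The Cauchy--Schwarz inequality for the pointwise norms. They are themselves elements of a real \<open>L\<^sup>2\<close> space
  with the same norms, so the inequality there applies.
\<close>

lemma integral_norm_mult_le:
  fixes f :: "real \<Rightarrow> 'b::euclidean_space" and g :: "real \<Rightarrow> 'c::euclidean_space"
  assumes f: "represents f x" and g: "represents g y"
  shows "integrable leb01 (\<lambda>\<xi>. norm (f \<xi>) * norm (g \<xi>))"
    and "(LINT \<xi>|leb01. norm (f \<xi>) * norm (g \<xi>)) \<le> norm x * norm y"
proof -
  have rep: "represents (\<lambda>\<xi>. norm (k \<xi>)) (abs_L2 (\<lambda>\<xi>. norm (k \<xi>)))"
    if "represents k z" for k :: "real \<Rightarrow> 'd::euclidean_space" and z
    unfolding represents_def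
    using representsD(2)[OF that] by (auto intro!: square_integrable_bound[OF _ representsD(1)[OF that], of _ 1])
  have norm: "norm (abs_L2 (\<lambda>\<xi>. norm (k \<xi>))) = norm z"
    if "represents k z" for k :: "real \<Rightarrow> 'd::euclidean_space" and z
    using represents_norm[OF rep[OF that]] represents_norm[OF that]
    by (intro power2_eq_imp_eq[OF _ norm_ge_zero norm_ge_zero]) simp
  show "integrable leb01 (\<lambda>\<xi>. norm (f \<xi>) * norm (g \<xi>))"
    using integrable_inner_square_integrable[OF representsD(1)[OF rep[OF f]] representsD(1)[OF rep[OF g]]]
    by simp
  have "abs_L2 (\<lambda>\<xi>. norm (f \<xi>)) \<bullet> abs_L2 (\<lambda>\<xi>. norm (g \<xi>)) = (LINT \<xi>|leb01. norm (f \<xi>) * norm (g \<xi>))"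
    using representsD(1)[OF rep[OF f]] representsD(1)[OF rep[OF g]] by (simp add: inner_L2.abs_eq L2_eq_refl)
  then show "(LINT \<xi>|leb01. norm (f \<xi>) * norm (g \<xi>)) \<le> norm x * norm y"
    using norm_cauchy_schwarz[of "abs_L2 (\<lambda>\<xi>. norm (f \<xi>))" "abs_L2 (\<lambda>\<xi>. norm (g \<xi>))"]
    by (simp add: norm[OF f] norm[OF g])
qed

lemma Linfty_bound:
  assumes "Linfty f"
  obtains c where "0 < c" "AE \<xi> in leb01. norm (f \<xi>) \<le> c"
proof -
  obtain c where c: "AE \<xi> in leb01. norm (f \<xi>) \<le> c" using assms by (auto simp: Linfty_def)
  have "AE \<xi> in leb01. norm (f \<xi>) \<le> max c 1" using c by eventually_elim simp
  then show ?thesis by (rule that[rotated]) simp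
qed

lemma matrix_vector_scaleR:
  fixes A :: "'a::real_or_complex^'n^'m"
  shows "A *v (c *\<^sub>R x) = c *\<^sub>R (A *v x)" "(c *\<^sub>R A) *v x = c *\<^sub>R (A *v x)"
  by (simp_all add: vec_eq_iff matrix_vector_mult_def scaleR_sum_right)

lemma bounded_bilinear_matrix_vector_mult:
  "bounded_bilinear ((*v) :: 'a::real_or_complex^'n^'m \<Rightarrow> 'a^'n \<Rightarrow> 'a^'m)"
  unfolding bilinear_conv_bounded_bilinear[symmetric] bilinear_def
  by (intro conjI allI linearI)
    (simp_all add: matrix_vector_right_distrib matrix_vector_mult_add_rdistrib matrix_vector_scaleR)

lemma borel_measurable_bounded_bilinear:
  fixes H :: "'a::euclidean_space \<Rightarrow> 'b::euclidean_space \<Rightarrow> 'c::euclidean_space"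
  assumes "bounded_bilinear H" "f \<in> borel_measurable M" "g \<in> borel_measurable M"
  shows "(\<lambda>x. H (f x) (g x)) \<in> borel_measurable M"
  by (rule borel_measurable_continuous_Pair[OF assms(2,3)])
    (intro bounded_bilinear.continuous_on[OF assms(1)] continuous_intros)

lemma square_integrable_matrix_vector_mult:
  fixes A :: "real \<Rightarrow> 'a::real_or_complex^'n^'n"
  assumes A: "Linfty A" and f: "square_integrable f"
  shows "square_integrable (\<lambda>\<xi>. A \<xi> *v f \<xi>)"
proof -
  obtain k where k: "0 < k" "AE \<xi> in leb01. norm (A \<xi>) \<le> k" using Linfty_bound[OF A] by blast
  obtain K where K: "0 \<le> K" "\<And>(A :: 'a^'n^'n) v. norm (A *v v) \<le> norm A * norm v * K"
    using bounded_bilinear.nonneg_bounded[OF bounded_bilinear_matrix_vector_mult] by blast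
  show ?thesis
  proof (rule square_integrable_bound[OF _ f])
    show "(\<lambda>\<xi>. A \<xi> *v f \<xi>) \<in> borel_measurable leb01"
      using A f by (intro borel_measurable_bounded_bilinear[OF bounded_bilinear_matrix_vector_mult])
        (auto simp: Linfty_def square_integrable_def)
    show "AE \<xi> in leb01. norm (A \<xi> *v f \<xi>) \<le> (k * K) * norm (f \<xi>)"
      using k(2)
    proof eventually_elim
      case (elim \<xi>)
      have "norm (A \<xi> *v f \<xi>) \<le> norm (A \<xi>) * norm (f \<xi>) * K" by (rule K(2))
      also have "\<dots> \<le> k * norm (f \<xi>) * K" using elim K(1) by (intro mult_right_mono) auto
      finally show ?case by (simp add: mult_ac)
    qed
  qed
qed

section \<open>The inverse of the fundamental matrix\<close>

text \<open>
  Gronwall's argument: for \<open>u = P v\<close>, the function \<open>e\<^sup>2\<^sup>b\<^sup>\<xi> \<parallel>u(\<xi>)\<parallel>\<^sup>2\<close> has nonnegative derivative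
  almost everywhere if \<open>b\<close> bounds the operator norm of \<open>P0\<close>, so \<open>\<parallel>u(\<xi>)\<parallel>\<close> cannot drop below
  \<open>e\<^sup>-\<^sup>b \<parallel>v\<parallel>\<close>. This yields both the invertibility of \<open>P\<close> and the bound on its inverse.
\<close>

lemma fundamental_solution_lower_bound:
  fixes P :: "real \<Rightarrow> 'a::real_or_complex^'n^'n"
  assumes P: "fundamental_solution P0 P" and "Linfty P0"
  obtains c where "0 < c" "\<And>\<xi> v. \<xi> \<in> {0..1} \<Longrightarrow> c * norm v \<le> norm (P \<xi> *v v)"
proof -
  obtain k where k: "0 < k" "AE \<xi> in leb01. norm (P0 \<xi>) \<le> k" using Linfty_bound[OF \<open>Linfty P0\<close>] by blast
  obtain K where K: "0 < K" "\<And>(A :: 'a^'n^'n) v. norm (A *v v) \<le> norm A * norm v * K"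
    using bounded_bilinear.pos_bounded[OF bounded_bilinear_matrix_vector_mult] by blast
  define b where "b = k * K"
  have acP: "ac_with_derivative P (\<lambda>\<xi>. P0 \<xi> ** P \<xi>)" and P_0: "P 0 = mat 1"
    using P by (auto simp: fundamental_solution_def)
  have "exp (- b) * norm v \<le> norm (P \<xi> *v v)" if "\<xi> \<in> {0..1}" for \<xi> v
  proof -
    let ?u = "\<lambda>\<xi>. P \<xi> *v v"
    define r where "r \<xi> = exp ((2 * b) * \<xi>) * (?u \<xi> \<bullet> ?u \<xi>)" for \<xi>
    have u: "ac_with_derivative ?u (\<lambda>\<xi>. P0 \<xi> *v ?u \<xi>)"
      using ac_with_derivative_bilinear[OF bounded_bilinear_matrix_vector_mult acP ac_with_derivative_const[of v]]
      by (simp add: matrix_vector_mul_assoc)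
    have r: "ac_with_derivative r (\<lambda>\<xi>. exp ((2 * b) * \<xi>) * (?u \<xi> \<bullet> (P0 \<xi> *v ?u \<xi>) + (P0 \<xi> *v ?u \<xi>) \<bullet> ?u \<xi>)
        + 2 * b * exp ((2 * b) * \<xi>) * (?u \<xi> \<bullet> ?u \<xi>))"
      unfolding r_def
      by (rule ac_with_derivative_bilinear[OF bounded_bilinear_mult ac_with_derivative_exp
        ac_with_derivative_bilinear[OF bounded_bilinear_inner u u]])
    have "r 0 \<le> r \<xi>"
    proof (rule ac_with_derivative_nonneg_imp_ge[OF r _ that])
      show "AE \<xi> in leb01. 0 \<le> exp ((2 * b) * \<xi>) * (?u \<xi> \<bullet> (P0 \<xi> *v ?u \<xi>) + (P0 \<xi> *v ?u \<xi>) \<bullet> ?u \<xi>)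
        + 2 * b * exp ((2 * b) * \<xi>) * (?u \<xi> \<bullet> ?u \<xi>)"
        using k(2)
      proof eventually_elim
        case (elim \<xi>)
        have "norm (P0 \<xi> *v ?u \<xi>) \<le> norm (P0 \<xi>) * norm (?u \<xi>) * K" by (rule K(2))
        also have "\<dots> \<le> k * norm (?u \<xi>) * K"
          using elim K(1) by (intro mult_right_mono) auto
        finally have "norm (?u \<xi>) * norm (P0 \<xi> *v ?u \<xi>) \<le> norm (?u \<xi>) * (b * norm (?u \<xi>))"
          by (intro mult_left_mono) (auto simp: b_def mult_ac)
        then have "\<bar>?u \<xi> \<bullet> (P0 \<xi> *v ?u \<xi>)\<bar> \<le> b * (?u \<xi> \<bullet> ?u \<xi>)"
          using Cauchy_Schwarz_ineq2[of "?u \<xi>" "P0 \<xi> *v ?u \<xi>"]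
          by (simp add: power2_norm_eq_inner[symmetric] power2_eq_square mult_ac)
        then have "0 \<le> exp ((2 * b) * \<xi>) * (2 * (?u \<xi> \<bullet> (P0 \<xi> *v ?u \<xi>)) + 2 * b * (?u \<xi> \<bullet> ?u \<xi>))"
          by (intro mult_nonneg_nonneg) auto
        then show ?case by (simp add: inner_commute algebra_simps)
      qed
    qed
    then have "(norm v)\<^sup>2 \<le> exp ((2 * b) * \<xi>) * (norm (?u \<xi>))\<^sup>2"
      by (simp add: r_def P_0 power2_norm_eq_inner)
    also have "\<dots> \<le> exp (2 * b) * (norm (?u \<xi>))\<^sup>2"
      using that k(1) K(1) by (intro mult_right_mono) (auto simp: b_def)
    also have "\<dots> = (exp b * norm (?u \<xi>))\<^sup>2"
      by (simp add: power_mult_distrib exp_double)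
    finally have "norm v \<le> exp b * norm (?u \<xi>)"
      by (rule power2_le_imp_le) simp
    then have "exp (- b) * norm v \<le> exp (- b) * (exp b * norm (?u \<xi>))" by (intro mult_left_mono) auto
    then show ?thesis by (simp add: mult.assoc[symmetric] exp_add[symmetric])
  qed
  from that[OF exp_gt_zero this] show ?thesis .
qed

text \<open>
  Absolute continuity and the quotient rule for \<open>g = P\<^sup>-\<^sup>1 h\<close>.
  By the uniform lower bound on \<open>P\<close>, increments and difference quotients of \<open>g\<close> are controlled by their images
  under \<open>P\<close>, and these are known from \<open>P g = h\<close>.
\<close>

lemma ac_with_derivative_matrix_solve:
  fixes P :: "real \<Rightarrow> 'a::real_or_complex^'n^'n"
  assumes P: "ac_with_derivative P P'" and h: "ac_with_derivative h h'"
    and c: "0 < c" "\<And>\<xi> v. \<xi> \<in> {0..1} \<Longrightarrow> c * norm v \<le> norm (P \<xi> *v v)"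
    and g: "\<And>\<xi>. \<xi> \<in> {0..1} \<Longrightarrow> P \<xi> *v g \<xi> = h \<xi>"
    and g': "\<And>\<xi>. \<xi> \<in> {0..1} \<Longrightarrow> P \<xi> *v g' \<xi> = h' \<xi> - P' \<xi> *v g \<xi>"
  shows "ac_with_derivative g g'"
  unfolding ac_with_derivative_def
proof
  note bil = bounded_bilinear_matrix_vector_mult
  obtain K where K: "0 \<le> K" "\<And>(A :: 'a^'n^'n) v. norm (A *v v) \<le> norm A * norm v * K"
    using bounded_bilinear.nonneg_bounded[OF bil] by blast
  obtain B where B: "0 \<le> B" "\<And>\<xi>. \<xi> \<in> {0..1} \<Longrightarrow> norm (h \<xi>) \<le> B"
    using abs_continuous_on_bounded[OF ac_with_derivativeD(1)[OF h]] by blast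
  have lower: "norm v \<le> inverse c * norm (P \<xi> *v v)" if "\<xi> \<in> {0..1}" for \<xi> v
    using c(2)[OF that, of v] c(1) by (simp add: field_simps)
  have gB: "norm (g \<xi>) \<le> inverse c * B" if "\<xi> \<in> {0..1}" for \<xi>
    using lower[OF that, of "g \<xi>"] B(2)[OF that] c(1) g[OF that]
    by (metis (no_types, opaque_lifting) inverse_nonnegative_iff_nonnegative less_imp_le mult_left_mono order_trans)
  show "abs_continuous_on {0..1} g"
  proof (rule abs_continuous_on_dominated[OF ac_with_derivativeD(1)[OF h] ac_with_derivativeD(1)[OF P]])
    show "0 \<le> inverse c * (1 + inverse c * B * K)" using c(1) B(1) K(1) by simp
    fix u v :: real assume uv: "u \<in> {0..1}" "v \<in> {0..1}"
    have "P v *v (g v - g u) = (h v - h u) - (P v - P u) *v g u"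
      using g[OF uv(1)] g[OF uv(2)]
      by (simp add: bounded_bilinear.diff_left[OF bil] bounded_bilinear.diff_right[OF bil])
    then have "norm (P v *v (g v - g u)) \<le> norm (h v - h u) + norm ((P v - P u) *v g u)"
      by (simp add: norm_triangle_ineq4)
    also have "norm ((P v - P u) *v g u) \<le> norm (P v - P u) * norm (g u) * K" by (rule K(2))
    also have "\<dots> \<le> norm (P v - P u) * (inverse c * B) * K"
      using gB[OF uv(1)] K(1) by (intro mult_right_mono mult_left_mono) auto
    also have "norm (h v - h u) + \<dots> \<le> (1 + inverse c * B * K) * (norm (h v - h u) + norm (P v - P u))"
      using c(1) B(1) K(1) by (simp add: algebra_simps)
    finally have "inverse c * norm (P v *v (g v - g u))
        \<le> inverse c * ((1 + inverse c * B * K) * (norm (h v - h u) + norm (P v - P u)))"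
      using c(1) by (intro mult_left_mono) auto
    then show "norm (g v - g u) \<le> inverse c * (1 + inverse c * B * K) * (norm (h v - h u) + norm (P v - P u))"
      using lower[OF uv(2), of "g v - g u"] by (simp add: mult.assoc)
  qed
  show "AE \<xi> in leb01. (g has_vector_derivative g' \<xi>) (at \<xi> within {0..1})"
    using ac_with_derivativeD(2)[OF h] ac_with_derivativeD(2)[OF P] AE_leb01_interval
  proof eventually_elim
    case (elim x)
    let ?F = "at x within {0..1}"
    define q where "q y = (g y - g x) /\<^sub>R (y - x)" for y
    have Pq: "P y *v (q y - g' x) =
        (h y - h x) /\<^sub>R (y - x) - ((P y - P x) /\<^sub>R (y - x)) *v g x - P y *v g' x" if "y \<in> {0..1}" for y
    proof -
      have "P y *v (g y - g x) = (h y - h x) - (P y - P x) *v g x"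
        using g[OF that] g[OF elim(3)]
        by (simp add: bounded_bilinear.diff_left[OF bil] bounded_bilinear.diff_right[OF bil])
      then have "P y *v q y = (h y - h x) /\<^sub>R (y - x) - ((P y - P x) /\<^sub>R (y - x)) *v g x"
        by (simp only: q_def matrix_vector_scaleR scaleR_diff_right[symmetric])
      then show ?thesis by (simp only: bounded_bilinear.diff_right[OF bil])
    qed
    have "continuous_on {0..1} P" by (rule ac_with_derivativeD(3)[OF P])
    then have "(P \<longlongrightarrow> P x) ?F" using elim(3) by (simp add: continuous_on)
    then have "((\<lambda>y. (h y - h x) /\<^sub>R (y - x) - ((P y - P x) /\<^sub>R (y - x)) *v g x - P y *v g' x)
        \<longlongrightarrow> h' x - P' x *v g x - P x *v g' x) ?F"
      using elim(1,2) unfolding has_vector_derivative_iff_quotient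
      by (intro tendsto_diff bounded_bilinear.tendsto[OF bil] tendsto_const)
    then have "((\<lambda>y. inverse c * norm ((h y - h x) /\<^sub>R (y - x) - ((P y - P x) /\<^sub>R (y - x)) *v g x - P y *v g' x))
        \<longlongrightarrow> 0) ?F"
      using g'[OF elim(3)] by (intro tendsto_mult_right_zero tendsto_norm_zero) simp
    moreover have "\<forall>\<^sub>F y in ?F. norm (q y - g' x)
        \<le> inverse c * norm ((h y - h x) /\<^sub>R (y - x) - ((P y - P x) /\<^sub>R (y - x)) *v g x - P y *v g' x)"
      unfolding eventually_at_filter
    proof (intro always_eventually allI impI)
      fix y :: real assume "y \<in> {0..1}"
      from lower[OF this, of "q y - g' x"] Pq[OF this]
      show "norm (q y - g' x)
        \<le> inverse c * norm ((h y - h x) /\<^sub>R (y - x) - ((P y - P x) /\<^sub>R (y - x)) *v g x - P y *v g' x)"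
        by simp
    qed
    ultimately have "((\<lambda>y. q y - g' x) \<longlongrightarrow> 0) ?F" by (rule Lim_null_comparison[rotated])
    then show ?case
      unfolding has_vector_derivative_iff_quotient q_def by (simp add: LIM_zero_iff)
  qed
qed

lemma invertible_matrix_inv:
  assumes "invertible A"
  shows "A ** matrix_inv A = mat 1" "matrix_inv A ** A = mat 1"
  using assms someI_ex[of "\<lambda>A'. A ** A' = mat 1 \<and> A' ** A = mat 1"]
  unfolding invertible_def matrix_inv_def by auto

locale transport_coefficients =
  fixes lam :: "real \<Rightarrow> real" and P0 P :: "real \<Rightarrow> 'a::real_or_complex^'n^'n"
  assumes Linfty_lam: "Linfty lam" and Linfty_inverse_lam: "Linfty (\<lambda>\<xi>. inverse (lam \<xi>))"
    and lam_pos: "AE \<xi> in leb01. 0 < lam \<xi>"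
    and Linfty_P0: "Linfty P0"
    and fundamental: "fundamental_solution P0 P"
begin

lemma lam_bounds:
  obtains a b where "0 < a" "0 < b" "AE \<xi> in leb01. a \<le> lam \<xi> \<and> lam \<xi> \<le> b"
proof -
  obtain b where b: "0 < b" "AE \<xi> in leb01. norm (lam \<xi>) \<le> b" using Linfty_bound[OF Linfty_lam] by blast
  obtain c where c: "0 < c" "AE \<xi> in leb01. norm (inverse (lam \<xi>)) \<le> c"
    using Linfty_bound[OF Linfty_inverse_lam] by blast
  have "AE \<xi> in leb01. inverse c \<le> lam \<xi> \<and> lam \<xi> \<le> b"
    using b(2) c(2) lam_pos by eventually_elim (use c(1) in \<open>auto simp: field_simps\<close>)
  then show ?thesis using that[of "inverse c" b] b(1) c(1) by simp
qed

lemma lam_measurable [measurable]: "lam \<in> borel_measurable leb01"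
  using Linfty_lam by (simp add: Linfty_def)

lemma ac_P: "ac_with_derivative P (\<lambda>\<xi>. P0 \<xi> ** P \<xi>)" and P_0: "P 0 = mat 1"
  using fundamental by (auto simp: fundamental_solution_def)

definition Pinv :: "real \<Rightarrow> 'a^'n^'n"
  where "Pinv \<xi> = matrix_inv (P \<xi>)"

lemma invertible_P: "\<xi> \<in> {0..1} \<Longrightarrow> invertible (P \<xi>)"
proof -
  assume \<xi>: "\<xi> \<in> {0..1}"
  obtain c where c: "0 < c" "\<And>\<xi> v. \<xi> \<in> {0..1} \<Longrightarrow> c * norm v \<le> norm (P \<xi> *v v)"
    using fundamental_solution_lower_bound[OF fundamental Linfty_P0] by blast
  have "v = 0" if "P \<xi> *v v = 0" for v
    using c(2)[OF \<xi>, of v] that c(1) by (simp add: mult_le_0_iff)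
  then show "invertible (P \<xi>)"
    unfolding invertible_left_inverse matrix_left_invertible_ker by blast
qed

lemma P_Pinv: "\<xi> \<in> {0..1} \<Longrightarrow> P \<xi> *v (Pinv \<xi> *v v) = v"
  and Pinv_P: "\<xi> \<in> {0..1} \<Longrightarrow> Pinv \<xi> *v (P \<xi> *v v) = v"
  using invertible_P[of \<xi>] by (simp_all add: Pinv_def matrix_vector_mul_assoc invertible_matrix_inv)

lemma Pinv_bounds:
  obtains c C where "0 < c" "0 < C"
    "\<forall>\<xi>\<in>{0..1}. \<forall>v. c * norm v \<le> norm (Pinv \<xi> *v v)"
    "\<forall>\<xi>\<in>{0..1}. \<forall>v. norm (Pinv \<xi> *v v) \<le> C * norm v"
proof -
  obtain c where c: "0 < c" "\<And>\<xi> v. \<xi> \<in> {0..1} \<Longrightarrow> c * norm v \<le> norm (P \<xi> *v v)"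
    using fundamental_solution_lower_bound[OF fundamental Linfty_P0] by blast
  obtain B where B: "0 \<le> B" "\<And>\<xi>. \<xi> \<in> {0..1} \<Longrightarrow> norm (P \<xi>) \<le> B"
    using abs_continuous_on_bounded[OF ac_with_derivativeD(1)[OF ac_P]] by blast
  obtain K where K: "0 < K" "\<And>(A :: 'a^'n^'n) v. norm (A *v v) \<le> norm A * norm v * K"
    using bounded_bilinear.pos_bounded[OF bounded_bilinear_matrix_vector_mult] by blast
  show ?thesis
  proof (rule that[of "inverse ((B + 1) * K)" "inverse c"])
    show "\<forall>\<xi>\<in>{0..1}. \<forall>v. inverse ((B + 1) * K) * norm v \<le> norm (Pinv \<xi> *v v)"
    proof (intro ballI allI)
      fix \<xi> :: real and v :: "'a^'n" assume \<xi>: "\<xi> \<in> {0..1}"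
      have "norm v \<le> norm (P \<xi>) * norm (Pinv \<xi> *v v) * K" using K(2)[of "P \<xi>" "Pinv \<xi> *v v"] P_Pinv[OF \<xi>] by simp
      also have "\<dots> \<le> (B + 1) * norm (Pinv \<xi> *v v) * K" using B(2)[OF \<xi>] K(1) by (intro mult_right_mono) auto
      finally show "inverse ((B + 1) * K) * norm v \<le> norm (Pinv \<xi> *v v)"
        using B(1) K(1) by (simp add: divide_simps mult_ac)
    qed
    show "\<forall>\<xi>\<in>{0..1}. \<forall>v. norm (Pinv \<xi> *v v) \<le> inverse c * norm v"
    proof (intro ballI allI)
      fix \<xi> :: real and v :: "'a^'n" assume \<xi>: "\<xi> \<in> {0..1}"
      show "norm (Pinv \<xi> *v v) \<le> inverse c * norm v"
        using c(2)[OF \<xi>, of "Pinv \<xi> *v v"] P_Pinv[OF \<xi>] c(1) by (simp add: field_simps)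
    qed
  qed (use B K c in auto)
qed

text \<open>
  This is the change of unknown that removes \<open>P0\<close> from the equation: the derivative of \<open>P\<^sup>-\<^sup>1 h\<close> is \<open>P\<^sup>-\<^sup>1\<close>
  applied to \<open>h' - P0 h\<close>, the negative of the transport operator.
\<close>

lemma ac_Pinv_mult:
  assumes h: "ac_with_derivative h h'"
  shows "ac_with_derivative (\<lambda>\<xi>. Pinv \<xi> *v h \<xi>) (\<lambda>\<xi>. Pinv \<xi> *v (h' \<xi> - P0 \<xi> *v h \<xi>))"
proof -
  obtain c where c: "0 < c" "\<And>\<xi> v. \<xi> \<in> {0..1} \<Longrightarrow> c * norm v \<le> norm (P \<xi> *v v)"
    using fundamental_solution_lower_bound[OF fundamental Linfty_P0] by blast
  show ?thesis
    by (rule ac_with_derivative_matrix_solve[OF ac_P h c])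
      (simp_all add: P_Pinv flip: matrix_vector_mul_assoc)
qed

lemma Pinv_mult_measurable:
  assumes "f \<in> borel_measurable leb01"
  shows "(\<lambda>\<xi>. Pinv \<xi> *v f \<xi>) \<in> borel_measurable leb01"
proof (rule borel_measurable_bounded_bilinear[OF bounded_bilinear_matrix_vector_mult _ assms])
  have "continuous_on {0..1} (\<lambda>\<xi>. Pinv \<xi> *v axis j 1)" for j
    by (rule ac_with_derivativeD(3)[OF ac_Pinv_mult[OF ac_with_derivative_const]])
  then have "continuous_on {0..1} (\<lambda>\<xi>. (Pinv \<xi> *v axis j 1) $ i)" for i j
    by (intro continuous_intros)
  then have "continuous_on {0..1} (\<lambda>\<xi>. \<chi> i j. (Pinv \<xi> *v axis j 1) $ i)"
    by (intro continuous_on_vec_lambda)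
  moreover have "(\<chi> i j. (Pinv \<xi> *v axis j 1) $ i) = Pinv \<xi>" for \<xi>
    by (simp add: vec_eq_iff matrix_vector_mult_def axis_def if_distrib[of "\<lambda>x. _ * x"] cong: if_cong)
  ultimately show "Pinv \<in> borel_measurable leb01"
    by (intro continuous_imp_measurable_on_sets_lebesgue) auto
qed

section \<open>The energy of a state\<close>

text \<open>
  For \<open>f = g\<close> this is \<open>e\<^sup>-\<^sup>\<mu>\<^sup>\<xi> lam\<^sup>-\<^sup>1 \<beta>(u, u)\<close> with the transported variable \<open>u = P\<^sup>-\<^sup>1 (lam f)\<close>; the two
  factors \<open>lam\<close> in the arguments of \<open>\<beta>\<close> have been moved in front.
\<close>

definition energy_density ::
    "real \<Rightarrow> ('a^'n \<Rightarrow> 'a^'n \<Rightarrow> real) \<Rightarrow> (real \<Rightarrow> 'a^'n) \<Rightarrow> (real \<Rightarrow> 'a^'n) \<Rightarrow> real \<Rightarrow> real"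
  where "energy_density \<mu> \<beta> f g \<xi> = exp (- \<mu> * \<xi>) * (lam \<xi> * \<beta> (Pinv \<xi> *v f \<xi>) (Pinv \<xi> *v g \<xi>))"

definition energy ::
    "real \<Rightarrow> ('a^'n \<Rightarrow> 'a^'n \<Rightarrow> real) \<Rightarrow> ('a^'n) L2 \<Rightarrow> ('a^'n) L2 \<Rightarrow> real"
  where "energy \<mu> \<beta> x y = (LINT \<xi>|leb01. energy_density \<mu> \<beta> (rep_L2 x) (rep_L2 y) \<xi>)"

lemma energy_density_measurable:
  assumes "bounded_bilinear \<beta>" "f \<in> borel_measurable leb01" "g \<in> borel_measurable leb01"
  shows "energy_density \<mu> \<beta> f g \<in> borel_measurable leb01"
proof -
  have [measurable]: "(\<lambda>\<xi>. \<beta> (Pinv \<xi> *v f \<xi>) (Pinv \<xi> *v g \<xi>)) \<in> borel_measurable leb01"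
    by (intro borel_measurable_bounded_bilinear[OF assms(1)] Pinv_mult_measurable assms)
  have [measurable]: "(\<lambda>\<xi>. exp (- \<mu> * \<xi>)) \<in> borel_measurable leb01"
    by (intro continuous_imp_measurable_on_sets_lebesgue continuous_intros) auto
  show ?thesis unfolding energy_density_def[abs_def] by measurable
qed

lemma energy_density_bound:
  assumes \<beta>: "bounded_bilinear \<beta>"
  obtains K where "0 \<le> K"
    "\<And>f g. AE \<xi> in leb01. \<bar>energy_density \<mu> \<beta> f g \<xi>\<bar> \<le> K * (norm (f \<xi>) * norm (g \<xi>))"
proof -
  obtain a b where ab: "0 < a" "0 < b" "AE \<xi> in leb01. a \<le> lam \<xi> \<and> lam \<xi> \<le> b" by (rule lam_bounds)
  obtain c C where C: "0 < c" "0 < C"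
    "\<forall>\<xi>\<in>{0..1}. \<forall>v. c * norm v \<le> norm (Pinv \<xi> *v v)"
    "\<forall>\<xi>\<in>{0..1}. \<forall>v. norm (Pinv \<xi> *v v) \<le> C * norm v"
    by (rule Pinv_bounds)
  obtain k where k: "0 \<le> k" "\<And>u v. norm (\<beta> u v) \<le> norm u * norm v * k"
    using bounded_bilinear.nonneg_bounded[OF \<beta>] by blast
  define K where "K = exp \<bar>\<mu>\<bar> * (b * (C * C * k))"
  have "AE \<xi> in leb01. \<bar>energy_density \<mu> \<beta> f g \<xi>\<bar> \<le> K * (norm (f \<xi>) * norm (g \<xi>))" for f g
    using ab(3) AE_leb01_interval
  proof eventually_elim
    case (elim \<xi>)
    have "- \<mu> * \<xi> \<le> \<bar>\<mu>\<bar> * \<xi>" using elim(2) by (intro mult_right_mono) auto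
    also have "\<dots> \<le> \<bar>\<mu>\<bar> * 1" using elim(2) by (intro mult_left_mono) auto
    finally have w: "exp (- \<mu> * \<xi>) \<le> exp \<bar>\<mu>\<bar>" by simp
    have "\<bar>\<beta> (Pinv \<xi> *v f \<xi>) (Pinv \<xi> *v g \<xi>)\<bar> \<le> norm (Pinv \<xi> *v f \<xi>) * norm (Pinv \<xi> *v g \<xi>) * k"
      using k(2) by simp
    also have "\<dots> \<le> (C * norm (f \<xi>)) * (C * norm (g \<xi>)) * k"
      using C(2) C(4)[rule_format, OF elim(2)] k(1) by (intro mult_right_mono mult_mono) auto
    finally have "\<bar>energy_density \<mu> \<beta> f g \<xi>\<bar> \<le> exp \<bar>\<mu>\<bar> * (b * ((C * norm (f \<xi>)) * (C * norm (g \<xi>)) * k))"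
      unfolding energy_density_def abs_mult
      using w elim(1) ab(1,2) C(2) k(1) by (intro mult_mono) auto
    then show ?case by (simp add: K_def mult_ac)
  qed
  moreover have "0 \<le> K" using ab C k by (simp add: K_def)
  ultimately show ?thesis using that by blast
qed

lemma energy_density_integrable:
  assumes \<beta>: "bounded_bilinear \<beta>" and f: "represents f x" and g: "represents g y"
  shows "integrable leb01 (energy_density \<mu> \<beta> f g)"
proof -
  obtain K where K: "0 \<le> K"
    "\<And>f g. AE \<xi> in leb01. \<bar>energy_density \<mu> \<beta> f g \<xi>\<bar> \<le> K * (norm (f \<xi>) * norm (g \<xi>))"
    using energy_density_bound[OF \<beta>, of \<mu>] by blast
  show ?thesis
  proof (rule Bochner_Integration.integrable_bound)
    show "integrable leb01 (\<lambda>\<xi>. K * (norm (f \<xi>) * norm (g \<xi>)))"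
      using integral_norm_mult_le(1)[OF f g] by simp
    show "energy_density \<mu> \<beta> f g \<in> borel_measurable leb01"
      using energy_density_measurable[OF \<beta>] representsD(2)[OF f] representsD(2)[OF g] by blast
    show "AE \<xi> in leb01. norm (energy_density \<mu> \<beta> f g \<xi>) \<le> norm (K * (norm (f \<xi>) * norm (g \<xi>)))"
      using K(2)[of f g] by eventually_elim (use K(1) in simp)
  qed
qed

lemma energy_eq:
  assumes \<beta>: "bounded_bilinear \<beta>" and f: "represents f x" and g: "represents g y"
  shows "energy \<mu> \<beta> x y = (LINT \<xi>|leb01. energy_density \<mu> \<beta> f g \<xi>)"
  unfolding energy_def
proof (rule integral_cong_AE)
  show "AE \<xi> in leb01. energy_density \<mu> \<beta> (rep_L2 x) (rep_L2 y) \<xi> = energy_density \<mu> \<beta> f g \<xi>"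
    using represents_AE_unique[OF represents_rep_L2 f] represents_AE_unique[OF represents_rep_L2 g]
    by eventually_elim (simp add: energy_density_def)
qed (use energy_density_measurable[OF \<beta>] representsD(2) represents_rep_L2 f g in blast)+

lemma bounded_bilinear_energy:
  assumes \<beta>: "bounded_bilinear \<beta>"
  shows "bounded_bilinear (energy \<mu> \<beta>)"
proof
  note bil = bounded_bilinear_matrix_vector_mult
  note lin = bounded_bilinear.add_left[OF \<beta>] bounded_bilinear.add_right[OF \<beta>]
    bounded_bilinear.scaleR_left[OF \<beta>] bounded_bilinear.scaleR_right[OF \<beta>]
    bounded_bilinear.add_right[OF bil] bounded_bilinear.scaleR_right[OF bil]
  fix x x' y y' :: "('a^'n) L2" and r :: real
  note rep = represents_rep_L2
  show "energy \<mu> \<beta> (x + x') y = energy \<mu> \<beta> x y + energy \<mu> \<beta> x' y"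
  proof -
    have "energy \<mu> \<beta> (x + x') y = (LINT \<xi>|leb01. energy_density \<mu> \<beta> (\<lambda>\<xi>. rep_L2 x \<xi> + rep_L2 x' \<xi>) (rep_L2 y) \<xi>)"
      by (rule energy_eq[OF \<beta> represents_add[OF rep rep] rep])
    also have "\<dots> = (LINT \<xi>|leb01. energy_density \<mu> \<beta> (rep_L2 x) (rep_L2 y) \<xi> + energy_density \<mu> \<beta> (rep_L2 x') (rep_L2 y) \<xi>)"
      by (simp add: energy_density_def lin algebra_simps)
    also have "\<dots> = energy \<mu> \<beta> x y + energy \<mu> \<beta> x' y"
      unfolding energy_def by (intro Bochner_Integration.integral_add energy_density_integrable[OF \<beta> rep rep])
    finally show ?thesis .
  qed
  show "energy \<mu> \<beta> x (y + y') = energy \<mu> \<beta> x y + energy \<mu> \<beta> x y'"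
  proof -
    have "energy \<mu> \<beta> x (y + y') = (LINT \<xi>|leb01. energy_density \<mu> \<beta> (rep_L2 x) (\<lambda>\<xi>. rep_L2 y \<xi> + rep_L2 y' \<xi>) \<xi>)"
      by (rule energy_eq[OF \<beta> rep represents_add[OF rep rep]])
    also have "\<dots> = (LINT \<xi>|leb01. energy_density \<mu> \<beta> (rep_L2 x) (rep_L2 y) \<xi> + energy_density \<mu> \<beta> (rep_L2 x) (rep_L2 y') \<xi>)"
      by (simp add: energy_density_def lin algebra_simps)
    also have "\<dots> = energy \<mu> \<beta> x y + energy \<mu> \<beta> x y'"
      unfolding energy_def by (intro Bochner_Integration.integral_add energy_density_integrable[OF \<beta> rep rep])
    finally show ?thesis .
  qed
  show "energy \<mu> \<beta> (r *\<^sub>R x) y = r *\<^sub>R energy \<mu> \<beta> x y"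
  proof -
    have "energy \<mu> \<beta> (r *\<^sub>R x) y = (LINT \<xi>|leb01. energy_density \<mu> \<beta> (\<lambda>\<xi>. r *\<^sub>R rep_L2 x \<xi>) (rep_L2 y) \<xi>)"
      by (rule energy_eq[OF \<beta> represents_scaleR[OF rep] rep])
    also have "\<dots> = (LINT \<xi>|leb01. r *\<^sub>R energy_density \<mu> \<beta> (rep_L2 x) (rep_L2 y) \<xi>)"
      by (simp add: energy_density_def lin algebra_simps)
    also have "\<dots> = r *\<^sub>R energy \<mu> \<beta> x y"
      unfolding energy_def by simp
    finally show ?thesis .
  qed
  show "energy \<mu> \<beta> x (r *\<^sub>R y) = r *\<^sub>R energy \<mu> \<beta> x y"
  proof -
    have "energy \<mu> \<beta> x (r *\<^sub>R y) = (LINT \<xi>|leb01. energy_density \<mu> \<beta> (rep_L2 x) (\<lambda>\<xi>. r *\<^sub>R rep_L2 y \<xi>) \<xi>)"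
      by (rule energy_eq[OF \<beta> rep represents_scaleR[OF rep]])
    also have "\<dots> = (LINT \<xi>|leb01. r *\<^sub>R energy_density \<mu> \<beta> (rep_L2 x) (rep_L2 y) \<xi>)"
      by (simp add: energy_density_def lin algebra_simps)
    also have "\<dots> = r *\<^sub>R energy \<mu> \<beta> x y"
      unfolding energy_def by simp
    finally show ?thesis .
  qed
  obtain K where K: "0 \<le> K"
    "\<And>f g. AE \<xi> in leb01. \<bar>energy_density \<mu> \<beta> f g \<xi>\<bar> \<le> K * (norm (f \<xi>) * norm (g \<xi>))"
    using energy_density_bound[OF \<beta>, of \<mu>] by blast
  have "norm (energy \<mu> \<beta> x y) \<le> norm x * norm y * K" for x y
  proof -
    have "norm (energy \<mu> \<beta> x y) \<le> (LINT \<xi>|leb01. K * (norm (rep_L2 x \<xi>) * norm (rep_L2 y \<xi>)))"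
      unfolding energy_def
      using integral_norm_mult_le(1)[OF rep rep] energy_density_integrable[OF \<beta> rep rep] K(2)
      by (intro order_trans[OF integral_norm_bound] integral_mono_AE) auto
    also have "\<dots> \<le> K * (norm x * norm y)"
      using mult_left_mono[OF integral_norm_mult_le(2)[OF rep[of x] rep[of y]] K(1)] by simp
    finally show ?thesis by (simp add: mult_ac)
  qed
  then show "\<exists>K. \<forall>x y. norm (energy \<mu> \<beta> x y) \<le> norm x * norm y * K" by blast
qed

lemma energy_commute: "(\<And>u v. \<beta> u v = \<beta> v u) \<Longrightarrow> energy \<mu> \<beta> x y = energy \<mu> \<beta> y x"
  by (simp add: energy_def energy_density_def)


text \<open>
  Here \<open>g = P\<^sup>-\<^sup>1 h\<close> and \<open>y\<close> is the image of \<open>x\<close> under the transport operator, so that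
  \<open>P\<^sup>-\<^sup>1 y = - g'\<close>. The factor \<open>lam\<close> in the energy turns \<open>P\<^sup>-\<^sup>1 f\<close> into \<open>g\<close>, hence
  \<open>2 \<Phi>(x, y) = - \<integral> e\<^sup>-\<^sup>\<mu>\<^sup>\<xi> (\<beta>(g, g))' d\<xi>\<close>, and integration by parts gives the boundary terms.
\<close>

lemma energy_identity:
  assumes \<beta>: "bounded_bilinear \<beta>" and sym: "\<And>u v. \<beta> u v = \<beta> v u"
    and f: "represents f x" and hf: "AE \<xi> in leb01. h \<xi> = lam \<xi> *\<^sub>R f \<xi>"
    and h: "ac_with_derivative h h'"
    and y: "represents (\<lambda>\<xi>. - h' \<xi> + P0 \<xi> *v h \<xi>) y"
  defines "g \<equiv> \<lambda>\<xi>. Pinv \<xi> *v h \<xi>"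
  shows "2 * energy \<mu> \<beta> x y = \<beta> (g 0) (g 0) - exp (- \<mu>) * \<beta> (g 1) (g 1)
      - \<mu> * (LINT \<xi>|leb01. exp (- \<mu> * \<xi>) * \<beta> (g \<xi>) (g \<xi>))"
proof -
  note bil = bounded_bilinear_matrix_vector_mult
  define g' where "g' \<xi> = Pinv \<xi> *v (h' \<xi> - P0 \<xi> *v h \<xi>)" for \<xi>
  define k where "k \<xi> = - h' \<xi> + P0 \<xi> *v h \<xi>" for \<xi>
  define r where "r \<xi> = exp ((- \<mu>) * \<xi>) * \<beta> (g \<xi>) (g \<xi>)" for \<xi>
  have g: "ac_with_derivative g g'"
    unfolding g_def g'_def by (rule ac_Pinv_mult[OF h])
  have r: "ac_with_derivative r (\<lambda>\<xi>. exp ((- \<mu>) * \<xi>) * (\<beta> (g \<xi>) (g' \<xi>) + \<beta> (g' \<xi>) (g \<xi>))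
      + (- \<mu>) * exp ((- \<mu>) * \<xi>) * \<beta> (g \<xi>) (g \<xi>))"
    unfolding r_def
    by (rule ac_with_derivative_bilinear[OF bounded_bilinear_mult ac_with_derivative_exp
      ac_with_derivative_bilinear[OF \<beta> g g]])
  have "AE \<xi> in leb01. - (2 * energy_density \<mu> \<beta> f k \<xi> + \<mu> * r \<xi>)
      = exp ((- \<mu>) * \<xi>) * (\<beta> (g \<xi>) (g' \<xi>) + \<beta> (g' \<xi>) (g \<xi>))
        + (- \<mu>) * exp ((- \<mu>) * \<xi>) * \<beta> (g \<xi>) (g \<xi>)"
    using hf
  proof eventually_elim
    case (elim \<xi>)
    have "Pinv \<xi> *v k \<xi> = - g' \<xi>"
      by (simp add: k_def g'_def flip: bounded_bilinear.minus_right[OF bil])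
    moreover have "g \<xi> = lam \<xi> *\<^sub>R (Pinv \<xi> *v f \<xi>)"
      by (simp add: g_def elim bounded_bilinear.scaleR_right[OF bil])
    ultimately have "energy_density \<mu> \<beta> f k \<xi> = - (exp ((- \<mu>) * \<xi>) * \<beta> (g \<xi>) (g' \<xi>))"
      by (simp add: energy_density_def bounded_bilinear.scaleR_left[OF \<beta>] bounded_bilinear.minus_right[OF \<beta>])
    then show ?case by (simp add: r_def sym[of "g' \<xi>"] algebra_simps)
  qed
  then have hk: "((\<lambda>\<xi>. - (2 * energy_density \<mu> \<beta> f k \<xi> + \<mu> * r \<xi>)) has_integral (r 1 - r 0)) {0..1}"
    by (intro ac_with_derivative_has_integral[OF r]) auto
  have "k = (\<lambda>\<xi>. - h' \<xi> + P0 \<xi> *v h \<xi>)" by (rule ext) (rule k_def)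
  with y have ky: "represents k y" by simp
  have int_E: "integrable leb01 (energy_density \<mu> \<beta> f k)"
    by (rule energy_density_integrable[OF \<beta> f ky])
  have "continuous_on {0..1} r" by (rule ac_with_derivativeD(3)[OF r])
  then have int_r: "integrable leb01 r" by (rule continuous_imp_integrable_real)
  have "((\<lambda>\<xi>. - (2 * energy_density \<mu> \<beta> f k \<xi> + \<mu> * r \<xi>)) has_integral
      (LINT \<xi>|leb01. - (2 * energy_density \<mu> \<beta> f k \<xi> + \<mu> * r \<xi>))) {0..1}"
    using int_E int_r by (intro has_integral_integral_lebesgue_on) auto
  from has_integral_unique[OF this hk]
  have "- (2 * (LINT \<xi>|leb01. energy_density \<mu> \<beta> f k \<xi>) + \<mu> * (LINT \<xi>|leb01. r \<xi>)) = r 1 - r 0"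
    using int_E int_r by simp
  moreover have "energy \<mu> \<beta> x y = (LINT \<xi>|leb01. energy_density \<mu> \<beta> f k \<xi>)"
    by (rule energy_eq[OF \<beta> f ky])
  ultimately show ?thesis by (simp add: r_def)
qed

text \<open>
  All the factors that distinguish the energy from the squared norm are bounded from below by positive constants.
\<close>

lemma energy_coercive:
  assumes \<beta>: "bounded_bilinear \<beta>" and pos: "\<And>v. (norm v)\<^sup>2 \<le> \<beta> v v"
  obtains c where "0 < c" "\<And>x. c * (norm x)\<^sup>2 \<le> energy \<mu> \<beta> x x"
proof -
  obtain a b where ab: "0 < a" "0 < b" "AE \<xi> in leb01. a \<le> lam \<xi> \<and> lam \<xi> \<le> b" by (rule lam_bounds)
  obtain c C where C: "0 < c" "0 < C"
    "\<forall>\<xi>\<in>{0..1}. \<forall>v. c * norm v \<le> norm (Pinv \<xi> *v v)"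
    "\<forall>\<xi>\<in>{0..1}. \<forall>v. norm (Pinv \<xi> *v v) \<le> C * norm v"
    by (rule Pinv_bounds)
  define d where "d = exp (- \<bar>\<mu>\<bar>) * (a * c\<^sup>2)"
  have "d * (norm x)\<^sup>2 \<le> energy \<mu> \<beta> x x" for x
  proof -
    note rep = represents_rep_L2[of x]
    have "AE \<xi> in leb01. d * (norm (rep_L2 x \<xi>))\<^sup>2 \<le> energy_density \<mu> \<beta> (rep_L2 x) (rep_L2 x) \<xi>"
      using ab(3) AE_leb01_interval
    proof eventually_elim
      case (elim \<xi>)
      have "\<mu> * \<xi> \<le> \<bar>\<mu>\<bar> * \<xi>" using elim(2) by (intro mult_right_mono) auto
      also have "\<dots> \<le> \<bar>\<mu>\<bar> * 1" using elim(2) by (intro mult_left_mono) auto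
      finally have w: "exp (- \<bar>\<mu>\<bar>) \<le> exp (- \<mu> * \<xi>)" by simp
      have "(c * norm (rep_L2 x \<xi>))\<^sup>2 \<le> (norm (Pinv \<xi> *v rep_L2 x \<xi>))\<^sup>2"
        using C(1) C(3)[rule_format, OF elim(2)] by (intro power_mono) auto
      also have "\<dots> \<le> \<beta> (Pinv \<xi> *v rep_L2 x \<xi>) (Pinv \<xi> *v rep_L2 x \<xi>)" by (rule pos)
      finally have "exp (- \<bar>\<mu>\<bar>) * (a * (c * norm (rep_L2 x \<xi>))\<^sup>2) \<le> energy_density \<mu> \<beta> (rep_L2 x) (rep_L2 x) \<xi>"
        unfolding energy_density_def using w elim(1) ab(1) by (intro mult_mono) auto
      then show ?case by (simp add: d_def power_mult_distrib mult_ac)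
    qed
    then have "(LINT \<xi>|leb01. d * (norm (rep_L2 x \<xi>))\<^sup>2) \<le> energy \<mu> \<beta> x x"
      unfolding energy_def
      using representsD(3)[OF rep] energy_density_integrable[OF \<beta> rep rep]
      by (intro integral_mono_AE) auto
    then show ?thesis by (simp add: represents_norm[OF rep])
  qed
  moreover have "0 < d" using ab(1) C(1) by (simp add: d_def)
  ultimately show ?thesis using that by blast
qed

text \<open>
  The state \<open>P v\<close> has constant image \<open>v\<close> under \<open>P\<^sup>-\<^sup>1\<close>, so its energy is \<open>\<beta> v v\<close> times the integral of \<open>lam\<close>.
\<close>

lemma energy_pos_at_steady_profile:
  assumes \<beta>: "bounded_bilinear \<beta>" and v: "0 < \<beta> v v"
  obtains x where "0 < energy 0 \<beta> x x"
proof -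
  obtain a b where ab: "0 < a" "0 < b" "AE \<xi> in leb01. a \<le> lam \<xi> \<and> lam \<xi> \<le> b" by (rule lam_bounds)
  have "continuous_on {0..1} (\<lambda>\<xi>. P \<xi> *v v)"
    by (intro bounded_bilinear.continuous_on[OF bounded_bilinear_matrix_vector_mult]
        ac_with_derivativeD(3)[OF ac_P] continuous_intros)
  then have rep: "represents (\<lambda>\<xi>. P \<xi> *v v) (abs_L2 (\<lambda>\<xi>. P \<xi> *v v))"
    by (simp add: represents_def continuous_imp_square_integrable)
  have "AE \<xi> in leb01. a * \<beta> v v \<le> energy_density 0 \<beta> (\<lambda>\<xi>. P \<xi> *v v) (\<lambda>\<xi>. P \<xi> *v v) \<xi>"
    using ab(3) AE_leb01_interval
    by eventually_elim (use v in \<open>simp add: energy_density_def Pinv_P mult_right_mono\<close>)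
  then have "(LINT \<xi>|leb01. a * \<beta> v v) \<le> energy 0 \<beta> (abs_L2 (\<lambda>\<xi>. P \<xi> *v v)) (abs_L2 (\<lambda>\<xi>. P \<xi> *v v))"
    unfolding energy_eq[OF \<beta> rep rep]
    using energy_density_integrable[OF \<beta> rep rep]
    by (intro integral_mono_AE integrable_const_ivl) auto
  moreover have "(LINT \<xi>|leb01. a * \<beta> v v) = a * \<beta> v v"
    by (simp add: measure_restrict_space)
  ultimately show ?thesis using that ab(1) v by (metis mult_pos_pos order_less_le_trans)
qed

section \<open>Stability of the transport semigroup\<close>

text \<open>
  Approximate \<open>lam f\<close> by polynomials \<open>h\<close> that vanish at both ends. Then \<open>h / lam\<close> lies in the domain, whatever
  the boundary matrices are, and it is close to \<open>f\<close> because \<open>1 / lam\<close> is bounded.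
\<close>

lemma transport_domain_dense: "closure (Domain (transport_operator lam P0 F G)) = UNIV"
proof -
  let ?S = "{x :: ('a^'n) L2. \<exists>f. represents f x \<and> polynomial_function f \<and> f 0 = 0 \<and> f 1 = 0}"
  obtain c where c: "0 < c" "AE \<xi> in leb01. norm (inverse (lam \<xi>)) \<le> c"
    using Linfty_bound[OF Linfty_inverse_lam] by blast
  have "x \<in> closure (Domain (transport_operator lam P0 F G))" for x :: "('a^'n) L2"
    unfolding closure_approachable
  proof (intro allI impI)
    fix e :: real assume "e > 0"
    obtain f where f: "represents f x" by (rule represents_exists)
    note [measurable] = representsD(2)[OF f]
    obtain b where b: "AE \<xi> in leb01. norm (lam \<xi>) \<le> b" using Linfty_bound[OF Linfty_lam] by blast
    have "square_integrable (\<lambda>\<xi>. lam \<xi> *\<^sub>R f \<xi>)"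
    proof (rule square_integrable_bound[OF _ representsD(1)[OF f]])
      show "AE \<xi> in leb01. norm (lam \<xi> *\<^sub>R f \<xi>) \<le> b * norm (f \<xi>)"
        using b by eventually_elim (simp add: mult_right_mono)
    qed measurable
    then have lf: "represents (\<lambda>\<xi>. lam \<xi> *\<^sub>R f \<xi>) (abs_L2 (\<lambda>\<xi>. lam \<xi> *\<^sub>R f \<xi>))" (is "represents _ ?X")
      by (simp add: represents_def)
    have "?X \<in> closure ?S" unfolding polynomial_functions_vanishing_at_ends_dense by simp
    then obtain z where "z \<in> ?S" "dist z ?X < e / c"
      unfolding closure_approachable using \<open>e > 0\<close> c(1) by (meson divide_pos_pos)
    then obtain h where h: "represents h z" "polynomial_function h" "h 0 = 0" "h 1 = 0"
      and close: "norm (z - ?X) < e / c" by (auto simp: dist_norm)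
    obtain h' where h': "polynomial_function h'" "\<And>\<xi>. (h has_vector_derivative h' \<xi>) (at \<xi>)"
      using has_vector_derivative_polynomial_function[OF h(2)] by blast
    note [measurable] = representsD(2)[OF h(1)]
    define f1 where "f1 \<xi> = inverse (lam \<xi>) *\<^sub>R h \<xi>" for \<xi>
    have "square_integrable f1"
    proof (rule square_integrable_bound[OF _ representsD(1)[OF h(1)]])
      show "AE \<xi> in leb01. norm (f1 \<xi>) \<le> c * norm (h \<xi>)"
        using c(2) by eventually_elim (simp add: f1_def mult_right_mono)
      show "f1 \<in> borel_measurable leb01" unfolding f1_def by measurable
    qed
    then have f1: "represents f1 (abs_L2 f1)" by (simp add: represents_def)
    have cont: "continuous_on {0..1} h" "continuous_on {0..1} h'"
      using h(2) h'(1) by (auto intro: continuous_on_polymonial_function)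
    have "square_integrable (\<lambda>\<xi>. - h' \<xi> + P0 \<xi> *v h \<xi>)"
      using cont by (intro square_integrable_add square_integrable_uminus
        square_integrable_matrix_vector_mult[OF Linfty_P0] continuous_imp_square_integrable)
    then have y: "represents (\<lambda>\<xi>. - h' \<xi> + P0 \<xi> *v h \<xi>) (abs_L2 (\<lambda>\<xi>. - h' \<xi> + P0 \<xi> *v h \<xi>))"
      by (simp add: represents_def)
    have "AE \<xi> in leb01. h \<xi> = lam \<xi> *\<^sub>R f1 \<xi>"
      using lam_pos by eventually_elim (simp add: f1_def)
    moreover have "ac_with_derivative h h'"
      using h'(2) cont(2) by (intro ac_with_derivative_C1) (auto intro: has_vector_derivative_at_within)
    moreover have "square_integrable h'" using cont(2) by (rule continuous_imp_square_integrable)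
    moreover have "F *v h 0 = - (G *v h 1)" using h(3,4) by simp
    ultimately have "(abs_L2 f1, abs_L2 (\<lambda>\<xi>. - h' \<xi> + P0 \<xi> *v h \<xi>)) \<in> transport_operator lam P0 F G"
      unfolding transport_operator_def using f1 y by blast
    then have "abs_L2 f1 \<in> Domain (transport_operator lam P0 F G)" by (rule DomainI)
    moreover have "norm (abs_L2 f1 - x) \<le> c * norm (z - ?X)"
    proof (rule represents_norm_le[OF represents_diff[OF f1 f] represents_diff[OF h(1) lf]])
      show "AE \<xi> in leb01. norm (f1 \<xi> - f \<xi>) \<le> c * norm (h \<xi> - lam \<xi> *\<^sub>R f \<xi>)"
        using c(2) lam_pos
      proof eventually_elim
        case (elim \<xi>)
        have "f1 \<xi> - f \<xi> = inverse (lam \<xi>) *\<^sub>R (h \<xi> - lam \<xi> *\<^sub>R f \<xi>)"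
          using elim(2) by (simp add: f1_def scaleR_diff_right)
        then have "norm (f1 \<xi> - f \<xi>) = norm (inverse (lam \<xi>)) * norm (h \<xi> - lam \<xi> *\<^sub>R f \<xi>)"
          by (simp only: norm_scaleR real_norm_def)
        also have "\<dots> \<le> c * norm (h \<xi> - lam \<xi> *\<^sub>R f \<xi>)" using elim(1) by (rule mult_right_mono) simp
        finally show ?case .
      qed
    qed (use c(1) in simp)
    then have "norm (abs_L2 f1 - x) < e" using close c(1) by (simp add: field_simps)
    ultimately show "\<exists>y\<in>Domain (transport_operator lam P0 F G). dist y x < e"
      unfolding dist_norm by blast
  qed
  then show ?thesis by blast
qed

text \<open>
  The exponential weight is chosen such that the loss \<open>e\<^sup>-\<^sup>\<mu>\<close> over the length of the interval equals the contraction
  factor \<open>\<rho>\<close> of \<open>J\<close>; the weight then still produces the decay rate \<open>\<mu> a\<close> of the energy, where \<open>a\<close> is a lower bound of the speed.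
\<close>

theorem transport_semigroup_stable_if:
  assumes T: "c0_semigroup T" and gen: "generator T = transport_operator lam P0 F G"
    and boundary: "\<And>h0 g1. F *v h0 = - (G *v (P 1 *v g1)) \<Longrightarrow> h0 = J *v g1"
    and J: "complex_eigenvalues J \<subseteq> {z. norm z < 1}"
  shows "exponentially_stable T"
proof -
  have "linear ((*v) J)" using bounded_linear.linear matrix_vector_mul_bounded_linear by blast
  from contractive_inner_product[OF this orbit_tendsto_0_if_eigenvalues_in_disc[OF J]]
  obtain \<beta> and \<rho> where \<beta>: "bounded_bilinear \<beta>" and sym: "\<And>u v. \<beta> u v = \<beta> v u"
    and \<rho>: "0 < \<rho>" "\<rho> < 1" and contr: "\<And>v. \<beta> (J *v v) (J *v v) \<le> \<rho> * \<beta> v v"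
    and pos: "\<And>v. (norm v)\<^sup>2 \<le> \<beta> v v" by blast
  have \<beta>_nonneg: "0 \<le> \<beta> v v" for v using pos[of v] by (rule order_trans[rotated]) simp
  define \<mu> where "\<mu> = - ln \<rho>"
  have \<mu>: "0 < \<mu>" "exp (- \<mu>) = \<rho>" using \<rho> by (simp_all add: \<mu>_def)
  obtain a b where ab: "0 < a" "0 < b" "AE \<xi> in leb01. a \<le> lam \<xi> \<and> lam \<xi> \<le> b" by (rule lam_bounds)
  let ?\<Phi> = "energy \<mu> \<beta>"
  note bil = bounded_bilinear_energy[OF \<beta>, of \<mu>]
  have diss: "2 * ?\<Phi> x y \<le> - (\<mu> * a) * ?\<Phi> x x" if "(x, y) \<in> generator T" for x y
  proof -
    obtain f h h' where f: "represents f x" "AE \<xi> in leb01. h \<xi> = lam \<xi> *\<^sub>R f \<xi>"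
      and h: "ac_with_derivative h h'" and h0: "F *v h 0 = - (G *v h 1)"
      and y: "represents (\<lambda>\<xi>. - h' \<xi> + P0 \<xi> *v h \<xi>) y"
      using \<open>(x, y) \<in> generator T\<close> unfolding gen transport_operator_def by blast
    define g where "g \<xi> = Pinv \<xi> *v h \<xi>" for \<xi>
    have "g 0 = h 0" using P_Pinv[of 0 "h 0"] by (simp add: g_def P_0)
    moreover have "h 0 = J *v g 1" by (rule boundary) (simp add: h0 g_def P_Pinv)
    ultimately have ends: "\<beta> (g 0) (g 0) \<le> exp (- \<mu>) * \<beta> (g 1) (g 1)" using contr \<mu>(2) by simp
    have "a * ?\<Phi> x x = (LINT \<xi>|leb01. a * energy_density \<mu> \<beta> f f \<xi>)"
      by (simp add: energy_eq[OF \<beta> f(1) f(1)])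
    also have "\<dots> \<le> (LINT \<xi>|leb01. exp (- \<mu> * \<xi>) * \<beta> (g \<xi>) (g \<xi>))"
    proof (rule integral_mono_AE)
      show "integrable leb01 (\<lambda>\<xi>. a * energy_density \<mu> \<beta> f f \<xi>)"
        using energy_density_integrable[OF \<beta> f(1) f(1)] by simp
      have "continuous_on {0..1} g"
        unfolding g_def by (rule ac_with_derivativeD(3)[OF ac_Pinv_mult[OF h]])
      then show "integrable leb01 (\<lambda>\<xi>. exp (- \<mu> * \<xi>) * \<beta> (g \<xi>) (g \<xi>))"
        by (intro continuous_imp_integrable_real continuous_intros bounded_bilinear.continuous_on[OF \<beta>])
      show "AE \<xi> in leb01. a * energy_density \<mu> \<beta> f f \<xi> \<le> exp (- \<mu> * \<xi>) * \<beta> (g \<xi>) (g \<xi>)"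
        using ab(3) f(2)
      proof eventually_elim
        case (elim \<xi>)
        let ?u = "Pinv \<xi> *v f \<xi>"
        have "g \<xi> = lam \<xi> *\<^sub>R ?u"
          by (simp add: g_def elim(2) bounded_bilinear.scaleR_right[OF bounded_bilinear_matrix_vector_mult])
        then have "\<beta> (g \<xi>) (g \<xi>) = lam \<xi> * (lam \<xi> * \<beta> ?u ?u)"
          by (simp add: bounded_bilinear.scaleR_left[OF \<beta>] bounded_bilinear.scaleR_right[OF \<beta>])
        moreover have "a * (lam \<xi> * \<beta> ?u ?u) \<le> lam \<xi> * (lam \<xi> * \<beta> ?u ?u)"
          using elim(1) ab(1) \<beta>_nonneg[of ?u] by (intro mult_right_mono mult_nonneg_nonneg) auto
        ultimately have "exp (- \<mu> * \<xi>) * (a * (lam \<xi> * \<beta> ?u ?u)) \<le> exp (- \<mu> * \<xi>) * \<beta> (g \<xi>) (g \<xi>)"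
          by (intro mult_left_mono) auto
        then show ?case by (simp add: energy_density_def mult_ac)
      qed
    qed
    finally have "\<mu> * (a * ?\<Phi> x x) \<le> \<mu> * (LINT \<xi>|leb01. exp (- \<mu> * \<xi>) * \<beta> (g \<xi>) (g \<xi>))"
      using \<mu>(1) by (intro mult_left_mono) auto
    then show ?thesis
      using energy_identity[OF \<beta> sym f h y, of \<mu>] ends unfolding g_def by simp
  qed
  obtain c where c: "0 < c" "\<And>x. c * (norm x)\<^sup>2 \<le> ?\<Phi> x x"
    using energy_coercive[OF \<beta> pos, of \<mu>] by blast
  obtain K where K: "0 < K" "\<And>x y. norm (?\<Phi> x y) \<le> norm x * norm y * K"
    using bounded_bilinear.pos_bounded[OF bil] by blast
  \<comment> \<open>Half the rate of the energy, which is quadratic in the state.\<close>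
  define \<omega> where "\<omega> = \<mu> * a / 2"
  define M where "M = max 1 (sqrt (K / c))"
  have "norm (T t x) \<le> M * exp (- \<omega> * t) * norm x" if "t > 0" for t x
  proof -
    have "c * (norm (T t x))\<^sup>2 \<le> ?\<Phi> (T t x) (T t x)" by (rule c(2))
    also have "\<dots> \<le> exp (- (\<mu> * a) * t) * ?\<Phi> x x"
      using that transport_domain_dense[of F G]
      by (intro lyapunov_estimate[OF T bil energy_commute[of \<beta>, OF sym] diss]) (auto simp: gen)
    also have "\<dots> \<le> exp (- (\<mu> * a) * t) * (norm x * norm x * K)"
      using K(2)[of x x] by (intro mult_left_mono) auto
    finally have "(norm (T t x))\<^sup>2 \<le> K / c * (exp (- (\<mu> * a) * t) * (norm x)\<^sup>2)"
      using c(1) by (simp add: field_simps power2_eq_square)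
    also have "\<dots> = (sqrt (K / c) * exp (- \<omega> * t) * norm x)\<^sup>2"
    proof -
      have "(exp (- \<omega> * t))\<^sup>2 = exp (- (\<mu> * a) * t)"
        by (simp add: \<omega>_def flip: exp_double)
      then show ?thesis using K(1) c(1) by (simp add: power_mult_distrib mult.assoc)
    qed
    finally have "norm (T t x) \<le> sqrt (K / c) * exp (- \<omega> * t) * norm x"
      by (rule power2_le_imp_le) (use K(1) c(1) in simp)
    also have "\<dots> \<le> M * exp (- \<omega> * t) * norm x"
      unfolding M_def by (intro mult_right_mono) auto
    finally show ?thesis .
  qed
  moreover have "\<omega> > 0" "M \<ge> 1" using \<mu>(1) ab(1) by (simp_all add: \<omega>_def M_def)
  ultimately show ?thesis unfolding exponentially_stable_def by blast
qed

text \<open>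
  The constant weight, \<open>\<mu> = 0\<close>, leaves only the boundary terms of the energy balance, and these are nonnegative for the
  expanding form. Since the growth estimate holds for all states by density, it applies to the
  state of positive energy even if that state is not in the domain.
\<close>

theorem transport_semigroup_stable_only_if:
  assumes T: "c0_semigroup T" and gen: "generator T = transport_operator lam P0 F G"
    and boundary: "\<And>h0 g1. F *v h0 = - (G *v (P 1 *v g1)) \<Longrightarrow> h0 = J *v g1"
    and stable: "asymptotically_stable T"
  shows "complex_eigenvalues J \<subseteq> {z. norm z < 1}"
proof (rule ccontr)
  assume unstable: "\<not> ?thesis"
  obtain \<beta> :: "'a^'n \<Rightarrow> 'a^'n \<Rightarrow> real" and v0 where \<beta>: "bounded_bilinear \<beta>"
    and commute: "\<forall>u v. \<beta> u v = \<beta> v u" and expand: "\<forall>v. \<beta> v v \<le> \<beta> (J *v v) (J *v v)"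
    and v0: "0 < \<beta> v0 v0"
    by (rule expansive_semi_inner_product[OF unstable])
  have sym: "\<And>u v. \<beta> u v = \<beta> v u" using commute by blast
  let ?\<Psi> = "\<lambda>x y. - energy 0 \<beta> x y"
  have bil: "bounded_bilinear (energy 0 \<beta>)" by (rule bounded_bilinear_energy[OF \<beta>])
  have bil': "bounded_bilinear ?\<Psi>"
    using bounded_bilinear.comp[OF bil bounded_linear_minus[OF bounded_linear_ident] bounded_linear_ident]
    by (simp add: bounded_bilinear.minus_left[OF bil])
  have diss: "2 * ?\<Psi> x y \<le> - 0 * ?\<Psi> x x" if "(x, y) \<in> generator T" for x y
  proof -
    obtain f h h' where f: "represents f x" "AE \<xi> in leb01. h \<xi> = lam \<xi> *\<^sub>R f \<xi>"
      and h: "ac_with_derivative h h'" and h0: "F *v h 0 = - (G *v h 1)"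
      and y: "represents (\<lambda>\<xi>. - h' \<xi> + P0 \<xi> *v h \<xi>) y"
      using \<open>(x, y) \<in> generator T\<close> unfolding gen transport_operator_def by blast
    have "Pinv 0 *v h 0 = h 0" using P_Pinv[of 0 "h 0"] by (simp add: P_0)
    moreover have "h 0 = J *v (Pinv 1 *v h 1)" by (rule boundary) (simp add: h0 P_Pinv)
    ultimately have "\<beta> (Pinv 1 *v h 1) (Pinv 1 *v h 1) \<le> \<beta> (Pinv 0 *v h 0) (Pinv 0 *v h 0)"
      using expand by metis
    then show ?thesis using energy_identity[OF \<beta> sym f h y, of 0] by simp
  qed
  obtain x where x: "0 < energy 0 \<beta> x x"
    using energy_pos_at_steady_profile[OF \<beta> v0] by blast
  have grow: "energy 0 \<beta> x x \<le> energy 0 \<beta> (T t x) (T t x)" if "t \<ge> 0" for t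
    using lyapunov_estimate[OF T bil' _ diss _ that, of x] energy_commute[of \<beta>, OF sym]
      transport_domain_dense[of F G] by (simp add: gen)
  have "((\<lambda>t. T t x) \<longlongrightarrow> 0) at_top" using stable by (simp add: asymptotically_stable_def)
  then have "((\<lambda>t. energy 0 \<beta> (T t x) (T t x)) \<longlongrightarrow> energy 0 \<beta> 0 0) at_top"
    by (intro bounded_bilinear.tendsto[OF bil])
  moreover have "\<forall>\<^sub>F t in at_top. energy 0 \<beta> x x \<le> energy 0 \<beta> (T t x) (T t x)"
    using eventually_ge_at_top[of 0] by eventually_elim (rule grow)
  ultimately have "energy 0 \<beta> x x \<le> energy 0 \<beta> 0 0"
    by (rule tendsto_lowerbound) simp
  then show False using x by (simp add: bounded_bilinear.zero_left[OF bil])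
qed

end

lemma exponentially_stable_imp_asymptotically_stable:
  assumes "exponentially_stable T"
  shows "asymptotically_stable T"
  unfolding asymptotically_stable_def
proof
  fix x
  obtain \<omega> M where \<omega>: "\<omega> > 0" and M: "\<And>t. t > 0 \<Longrightarrow> norm (T t x) \<le> M * exp (- \<omega> * t) * norm x"
    using assms unfolding exponentially_stable_def by blast
  have "((\<lambda>t. M * exp (- \<omega> * t) * norm x) \<longlongrightarrow> M * 0 * norm x) at_top"
  proof (intro tendsto_intros filterlim_compose[OF exp_at_bot])
    show "filterlim (\<lambda>t. - \<omega> * t) at_bot at_top"
      using \<omega> by (intro filterlim_tendsto_neg_mult_at_bot[OF tendsto_const]) (auto simp: filterlim_ident)
  qed
  then have "((\<lambda>t. M * exp (- \<omega> * t) * norm x) \<longlongrightarrow> 0) at_top" by simp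
  moreover have "\<forall>\<^sub>F t in at_top. norm (T t x) \<le> M * exp (- \<omega> * t) * norm x"
    using eventually_gt_at_top[of 0] by eventually_elim (rule M)
  ultimately show "((\<lambda>t. T t x) \<longlongrightarrow> 0) at_top" by (rule Lim_null_comparison[rotated])
qed

text \<open>
  With \<open>u = \<Delta> (Ky h0 + Ly P1 g1)\<close> for the feedback signal, the boundary condition reads \<open>K h0 + L P1 g1 = E u\<close>.
  Solving it for \<open>h0\<close> and inserting the result into the definition of \<open>u\<close> gives
  \<open>(I - \<Delta> D) u = - \<Delta> C g1\<close>; eliminating \<open>u\<close> yields the closed-loop matrix.
\<close>

lemma feedback_boundary_condition:
  fixes K L P1 :: "'a::field^'n^'n" and E :: "'a^'m^'n" and Ky Ly :: "'a^'n^'k" and \<Delta> :: "'a^'k^'m"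
  assumes "invertible K" and D: "D = Ky ** matrix_inv K ** E" and "invertible (mat 1 - \<Delta> ** D)"
    and A: "A = - (matrix_inv K ** L ** P1)" and B: "B = - (matrix_inv K ** E)"
    and C: "C = (Ky ** matrix_inv K ** L - Ly) ** P1"
    and bc: "(K - E ** \<Delta> ** Ky) *v h0 = - ((L - E ** \<Delta> ** Ly) *v (P1 *v g1))"
  shows "h0 = (A + B ** matrix_inv (mat 1 - \<Delta> ** D) ** \<Delta> ** C) *v g1"
proof -
  note distr = matrix_vector_mult_diff_rdistrib matrix_vector_mult_diff_distrib
    matrix_vector_mult_add_rdistrib matrix_vector_right_distrib matrix_vector_mul_assoc[symmetric]
  have neg: "(- X) *v w = - (X *v w)" for X :: "'a^'p^'q" and w
    by (simp add: vec_eq_iff matrix_vector_mult_def sum_negf)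
  have neg': "X *v (- w) = - (X *v w)" for X :: "'a^'p^'q" and w
    by (simp add: vec_eq_iff matrix_vector_mult_def sum_negf)
  define h1 where "h1 = P1 *v g1"
  define u where "u = \<Delta> *v (Ky *v h0 + Ly *v h1)"
  have Kinv: "matrix_inv K *v (K *v w) = w" for w
    using invertible_matrix_inv(2)[OF \<open>invertible K\<close>] by (simp add: matrix_vector_mul_assoc)
  have "K *v h0 = E *v u - L *v h1"
    using bc by (simp add: distr u_def h1_def algebra_simps)
  then have h0: "h0 = matrix_inv K *v (E *v u) - matrix_inv K *v (L *v h1)"
    using Kinv[of h0] by (simp add: distr)
  have "(mat 1 - \<Delta> ** D) *v u = - (\<Delta> *v (C *v g1))"
  proof -
    have Du: "\<Delta> *v (D *v u) = \<Delta> *v (Ky *v h0) + \<Delta> *v (Ky *v (matrix_inv K *v (L *v h1)))"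
      by (subst h0) (simp add: D distr)
    have "u = \<Delta> *v (Ky *v h0) + \<Delta> *v (Ly *v h1)" by (simp add: u_def distr)
    then have "u - \<Delta> *v (D *v u) = \<Delta> *v (Ly *v h1) - \<Delta> *v (Ky *v (matrix_inv K *v (L *v h1)))"
      unfolding Du by simp
    then show ?thesis by (simp add: distr C h1_def)
  qed
  then have "u = matrix_inv (mat 1 - \<Delta> ** D) *v (- (\<Delta> *v (C *v g1)))"
    using invertible_matrix_inv(2)[OF \<open>invertible (mat 1 - \<Delta> ** D)\<close>]
    by (metis matrix_vector_mul_assoc matrix_vector_mul_lid)
  then show ?thesis
    by (subst h0) (simp add: A B distr neg neg' h1_def)
qed

theorem proposition1p2:
  fixes lam0 :: "real \<Rightarrow> real"
    and P0 P :: "real \<Rightarrow> ('a::real_or_complex, 'n::{finite,linorder}, 'n) matrix"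
    and K L :: "('a, 'n, 'n) matrix"
    and Ky Ly :: "('a, 'k::finite, 'n) matrix"
    and E :: "('a, 'n, 'm::{finite,linorder}) matrix"
    and A :: "('a, 'n, 'n) matrix" and B :: "('a, 'n, 'm) matrix"
    and C :: "('a, 'k, 'n) matrix" and D :: "('a, 'k, 'm) matrix"
    and \<Delta> :: "('a, 'm, 'k) matrix"
    and T :: "real \<Rightarrow> ('a, 'n) vec L2 \<Rightarrow> ('a, 'n) vec L2"
  assumes "CARD('m) \<le> CARD('n)"
    and "Linfty lam0" "Linfty (\<lambda>\<xi>. inverse (lam0 \<xi>))" "AE \<xi> in leb01. 0 < lam0 \<xi>"
    and "Linfty P0"
    and "invertible K"
    and "fundamental_solution P0 P"
    and "E = E_mat"
    and "A = - (matrix_inv K ** L ** P 1)"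
    and "B = - (matrix_inv K ** E)"
    and "C = (Ky ** matrix_inv K ** L - Ly) ** P 1"
    and "D = Ky ** matrix_inv K ** E"
    and "invertible (mat 1 - \<Delta> ** D)"
    and "c0_semigroup T"
    and "generator T =
      transport_operator lam0 P0 (K - E ** \<Delta> ** Ky) (L - E ** \<Delta> ** Ly)"
  shows "(asymptotically_stable T \<longleftrightarrow> exponentially_stable T) \<and>
    (exponentially_stable T \<longleftrightarrow>
      complex_eigenvalues (A + B ** matrix_inv (mat 1 - \<Delta> ** D) ** \<Delta> ** C) \<subseteq> {z. norm z < 1})"
proof -
  let ?J = "A + B ** matrix_inv (mat 1 - \<Delta> ** D) ** \<Delta> ** C"
  interpret transport_coefficients lam0 P0 P
    using assms by unfold_locales
  note boundary = feedback_boundary_condition[OF assms(6,12,13,9,10,11)]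
  have "complex_eigenvalues ?J \<subseteq> {z. norm z < 1}" if "asymptotically_stable T"
    using transport_semigroup_stable_only_if[OF assms(14,15) boundary that] .
  moreover have "exponentially_stable T" if "complex_eigenvalues ?J \<subseteq> {z. norm z < 1}"
    using transport_semigroup_stable_if[OF assms(14,15) boundary that] .
  ultimately show ?thesis
    using exponentially_stable_imp_asymptotically_stable by blast
qed

end
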